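(* Let $\mathbf{\Sigma}$ be a normalized irreducible incommensurable random substitution system in $\mathbb{R}^d$ with prototiles $\tau_{\mathbf{\Sigma}}=(T_1,\ldots,T_n)$. Let $(\pi^{\mathbf{\Sigma}}_m)_{m\ge0}$ be a random Kakutani sequence of partitions of $T_i\in\tau_{\mathbf{\Sigma}}$, and let $1\le r\le n$. Let $\mathbf{v}\in\mathbb{R}^n$ be a left Perron--Frobenius eigenvector of $V_{\mathbf{\Sigma}}$ and $\mathbf{1}=(1,\ldots,1)^T\in\mathbb{R}^n$. Then, as $m\to\infty$, $$\frac{\mathbb{E}\left[\#\{\text{tiles of type } r \text{ in } \pi^{\mathbf{\Sigma}}_m\}\right]}{\mathbb{E}\left[\#\{\text{tiles in } \pi^{\mathbf{\Sigma}}_m\}\right]}=\frac{\left[\mathbf{v}^T\left(S_{\mathbf{\Sigma}}-V_{\mathbf{\Sigma}}\right)\right]_r}{\mathbf{v}^T\left(S_{\mathbf{\Sigma}}-V_{\mathbf{\Sigma}}\right)\mathbf{1}}+o(1),$$ $$\mathbb{E}\left[\mathrm{vol}\left(\bigcup\text{tiles of type } r \text{ in } \pi^{\mathbf{\Sigma}}_m\right)\right]=\frac{\left[\mathbf{v}^TH_{\mathbf{\Sigma}}\right]_r}{\mathbf{v}^TH_{\mathbf{\Sigma}}\mathbf{1}}+o(1).$$ In the non-random case (that is, when every prototile has exactly one substitution rule) the same formulas hold with the expectation symbols removed.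
   Context: A tile in $\mathbb{R}^d$ is a labeled measurable set of positive Lebesgue measure (denoted $\mathrm{vol}$) whose boundary has measure zero. A random substitution system $\mathbf{\Sigma}$ in $\mathbb{R}^d$ consists of: a finite list of prototiles $\tau_{\mathbf{\Sigma}}=(T_1,\ldots,T_n)$; for each $T_i$, a number $\ell_i\in\mathbb{N}$ of substitution rules $\varrho_1(T_i),\ldots,\varrho_{\ell_i}(T_i)$, where $\varrho_k(T_i)$ is a partition of $T_i$ into isometric copies of the elements of a finite list $\omega_k(T_i)$ of substitution tiles, each of the form $\alpha T_j$ with $\alpha\in(0,1)$ and $1\le j\le n$; and a probability vector $\mathbf{p}_i=(p_{i,1},\ldots,p_{i,\ell_i})$ with $p_{i,k}>0$ and $\sum_k p_{i,k}=1$. Any (rescaled, isometric) copy of $T_j$ carries the label $j$ and is said to be of type $j$. The system is normalized if all prototiles have volume $1$. Lists are counted with multiplicity. Associated graph $G_{\mathbf{\Sigma}}$: the directed multigraph with vertices $\{1,\ldots,n\}$ which, for every $i$, every $1\le k\le \ell_i$ and every substitution tile $T\in\omega_k(T_i)$ of type $j$, has an edge from $i$ to $j$ of length $\log\frac{1}{\mathrm{vol}\,T}$. $\mathbf{\Sigma}$ is irreducible if $G_{\mathbf{\Sigma}}$ is strongly connected, and incommensurable if $G_{\mathbf{\Sigma}}$ contains two closed paths of lengths $a,b$ (sums of edge lengths) with $a\notin b\mathbb{Q}$. Random Kakutani sequence of partitions of $T_i$: $\pi_0^{\mathbf{\Sigma}}=T_i$ (the trivial partition), and for every $m\ge 0$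 the partition $\pi_{m+1}^{\mathbf{\Sigma}}$ is obtained from $\pi_m^{\mathbf{\Sigma}}$ by substituting all tiles of maximal volume in $\pi_m^{\mathbf{\Sigma}}$; for each such tile, if it is of type $j$, an index $k$ is chosen with probability $p_{j,k}$, independently of all other tile substitutions, and the tile is partitioned according to the correspondingly rescaled (and moved by an isometry) copy of $\varrho_k(T_j)$. Matrices in $M_n(\mathbb{R})$ (inner sums are over tiles $T\in\omega_k(T_i)$ of type $j$): $$(S_{\mathbf{\Sigma}})_{ij}=\sum_{k=1}^{\ell_i}p_{i,k}\sum_{T}1,\quad (V_{\mathbf{\Sigma}})_{ij}=\sum_{k=1}^{\ell_i}p_{i,k}\sum_{T}\mathrm{vol}\,T,\quad (H_{\mathbf{\Sigma}})_{ij}=\sum_{k=1}^{\ell_i}p_{i,k}\sum_{T}-\mathrm{vol}\,T\cdot\log\mathrm{vol}\,T.$$ The Perron--Frobenius eigenvalue of $V_{\mathbf{\Sigma}}$ is $1$ (with right eigenvector $\mathbf{1}$). $[\mathbf{w}]_r$ denotes the $r$-th entry of a vector $\mathbf{w}$. *)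

theory Defs
  imports "HOL-Probability.Probability" "Graph_Theory.Digraph_Component"
begin

definition is_tile :: "'a::euclidean_space set \<Rightarrow> bool" where
  "is_tile T \<longleftrightarrow> T \<in> lmeasurable \<and> 0 < measure lebesgue T \<and> negligible (frontier T)"

text \<open>
  Partitions into tiles are understood up to sets of measure zero, so that prototiles may be
  closed, open or half-open. For two tiles, a null intersection is the same as disjoint interiors.
\<close>

definition is_partition :: "'a::euclidean_space set \<Rightarrow> 'a set list \<Rightarrow> bool" where
  "is_partition U Ts \<longleftrightarrow>
     negligible ((U - \<Union>(set Ts)) \<union> (\<Union>(set Ts) - U)) \<and>
     (\<forall>a<length Ts. \<forall>b<length Ts. a \<noteq> b \<longrightarrow> negligible (Ts ! a \<inter> Ts ! b))"

definition is_isometry :: "('a::metric_space \<Rightarrow> 'a) \<Rightarrow> bool" where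
  "is_isometry f \<longleftrightarrow> (\<forall>x y. dist (f x) (f y) = dist x y)"

text \<open>
  A piece stands for a substitution tile \<open>\<alpha> T\<^sub>j\<close> together with an isometry \<open>f\<close> placing a copy
  \<open>f (\<alpha> T\<^sub>j)\<close> of it: \<open>\<alpha>\<close> is \<open>piece_scale\<close>, \<open>j\<close> is \<open>piece_type\<close> and \<open>f\<close> is \<open>piece_iso\<close>.
  A rule \<open>\<rho>\<^sub>k(T\<^sub>i)\<close> is the list of its pieces; forgetting the isometries gives \<open>\<omega>\<^sub>k(T\<^sub>i)\<close>.
\<close>

record ('a, 'n) piece =
  piece_iso :: "'a \<Rightarrow> 'a"
  piece_scale :: real
  piece_type :: 'n

text \<open>
  The finite type \<open>'n\<close> plays the role of the index set \<open>{1,\<dots>,n}\<close>. Rules are indexed from 0: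
  \<open>rules \<Sigma> i ! k\<close> for \<open>k < length (rules \<Sigma> i)\<close>, and \<open>pmf (rule_pmf \<Sigma> i) k\<close> is \<open>p\<^sub>i\<^sub>,\<^sub>k\<close>.
\<close>

record ('a, 'n) subst_system =
  prototile :: "'n \<Rightarrow> 'a set"
  rules :: "'n \<Rightarrow> ('a, 'n) piece list list"
  rule_pmf :: "'n \<Rightarrow> nat pmf"

definition subst_tile ::
    "('a::euclidean_space, 'n) subst_system \<Rightarrow> ('a, 'n) piece \<Rightarrow> 'a set" where
  "subst_tile \<Sigma> p = (\<lambda>x. piece_scale p *\<^sub>R x) ` prototile \<Sigma> (piece_type p)"

definition subst_vol :: "('a::euclidean_space, 'n) subst_system \<Rightarrow> ('a, 'n) piece \<Rightarrow> real" where
  "subst_vol \<Sigma> p = measure lebesgue (subst_tile \<Sigma> p)"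

definition random_substitution_system ::
    "('a::euclidean_space, 'n::finite) subst_system \<Rightarrow> bool" where
  "random_substitution_system \<Sigma> \<longleftrightarrow>
     (\<forall>i. is_tile (prototile \<Sigma> i)) \<and>
     (\<forall>i. \<forall>\<rho>\<in>set (rules \<Sigma> i).
        (\<forall>p\<in>set \<rho>. is_isometry (piece_iso p) \<and> 0 < piece_scale p \<and> piece_scale p < 1) \<and>
        is_partition (prototile \<Sigma> i) (map (\<lambda>p. piece_iso p ` subst_tile \<Sigma> p) \<rho>)) \<and>
     (\<forall>i. set_pmf (rule_pmf \<Sigma> i) = {..<length (rules \<Sigma> i)})"

definition normalized :: "('a::euclidean_space, 'n::finite) subst_system \<Rightarrow> bool" where
  "normalized \<Sigma> \<longleftrightarrow> (\<forall>i. measure lebesgue (prototile \<Sigma> i) = 1)"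

text \<open>
  The edge \<open>(i, k, q)\<close> of the associated graph is the one given by the \<open>q\<close>-th element of the list
  \<open>\<omega>\<^sub>k(T\<^sub>i)\<close>.
\<close>

fun edge_piece ::
    "('a, 'n) subst_system \<Rightarrow> 'n \<times> nat \<times> nat \<Rightarrow> ('a, 'n) piece" where
  "edge_piece \<Sigma> (i, k, q) = rules \<Sigma> i ! k ! q"

definition assoc_graph ::
    "('a::euclidean_space, 'n::finite) subst_system \<Rightarrow> ('n, 'n \<times> nat \<times> nat) pre_digraph" where
  "assoc_graph \<Sigma> =
     \<lparr> verts = UNIV,
       arcs = {(i, k, q). k < length (rules \<Sigma> i) \<and> q < length (rules \<Sigma> i ! k)},
       tail = fst,
       head = (\<lambda>e. piece_type (edge_piece \<Sigma> e)) \<rparr>"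

definition edge_length ::
    "('a::euclidean_space, 'n::finite) subst_system \<Rightarrow> 'n \<times> nat \<times> nat \<Rightarrow> real" where
  "edge_length \<Sigma> e = ln (1 / subst_vol \<Sigma> (edge_piece \<Sigma> e))"

definition irreducible_system :: "('a::euclidean_space, 'n::finite) subst_system \<Rightarrow> bool" where
  "irreducible_system \<Sigma> \<longleftrightarrow> strongly_connected (assoc_graph \<Sigma>)"

text \<open>
  Closed paths are required to be nonempty: the empty path has length 0, which would make the
  condition below true for trivial reasons.
\<close>

definition closed_path_lengths ::
    "('a::euclidean_space, 'n::finite) subst_system \<Rightarrow> real set" where
  "closed_path_lengths \<Sigma> =
     {sum_list (map (edge_length \<Sigma>) p) | p u. pre_digraph.awalk (assoc_graph \<Sigma>) u p u \<and> p \<noteq> []}"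

definition incommensurable :: "('a::euclidean_space, 'n::finite) subst_system \<Rightarrow> bool" where
  "incommensurable \<Sigma> \<longleftrightarrow>
     (\<exists>a\<in>closed_path_lengths \<Sigma>. \<exists>b\<in>closed_path_lengths \<Sigma>. a \<notin> {b * q | q. q \<in> \<rat>})"

text \<open>
  A tile of type \<open>j\<close> occurring in a partition is represented by the pair \<open>(\<phi>, j)\<close>, where \<open>\<phi>\<close> is
  the similarity (an isometry composed with a scaling) that carries \<open>T\<^sub>j\<close> onto the tile. Substituting
  the tile by the rule \<open>\<rho>\<^sub>k(T\<^sub>j)\<close> means applying \<open>\<phi>\<close> to all pieces of the rule.
  A partition is the list of its tiles; the order of the list has no significance.
\<close>

type_synonym ('a, 'n) tile = "('a \<Rightarrow> 'a) \<times> 'n"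

definition tile_set :: "('a, 'n) subst_system \<Rightarrow> ('a, 'n) tile \<Rightarrow> 'a set" where
  "tile_set \<Sigma> t = fst t ` prototile \<Sigma> (snd t)"

definition tile_vol :: "('a::euclidean_space, 'n) subst_system \<Rightarrow> ('a, 'n) tile \<Rightarrow> real" where
  "tile_vol \<Sigma> t = measure lebesgue (tile_set \<Sigma> t)"

definition substitute ::
    "('a::euclidean_space, 'n) subst_system \<Rightarrow> nat \<Rightarrow> ('a, 'n) tile \<Rightarrow> ('a, 'n) tile list" where
  "substitute \<Sigma> k t =
     map (\<lambda>p. (\<lambda>x. fst t (piece_iso p (piece_scale p *\<^sub>R x)), piece_type p))
       (rules \<Sigma> (snd t) ! k)"

definition maximal_indices ::
    "('a::euclidean_space, 'n) subst_system \<Rightarrow> ('a, 'n) tile list \<Rightarrow> nat set" where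
  "maximal_indices \<Sigma> P =
     {q. q < length P \<and> (\<forall>t\<in>set P. tile_vol \<Sigma> t \<le> tile_vol \<Sigma> (P ! q))}"

definition kakutani_step ::
    "('a::euclidean_space, 'n) subst_system \<Rightarrow> ('a, 'n) tile list \<Rightarrow> ('a, 'n) tile list pmf" where
  "kakutani_step \<Sigma> P =
     map_pmf
       (\<lambda>\<kappa>. concat (map (\<lambda>q. if q \<in> maximal_indices \<Sigma> P then substitute \<Sigma> (\<kappa> q) (P ! q) else [P ! q])
              [0..<length P]))
       (Pi_pmf (maximal_indices \<Sigma> P) 0 (\<lambda>q. rule_pmf \<Sigma> (snd (P ! q))))"

text \<open>
  Every path is a sequence of partitions obtained by substituting the tiles of maximal volume, and
  \<open>kakutani_step \<Sigma> (\<pi> m)\<close> is the law of \<open>\<pi> (Suc m)\<close> conditional on the history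
  \<open>\<pi> 0, \<dots>, \<pi> m\<close>.
\<close>

definition random_kakutani_sequence ::
    "('a::euclidean_space, 'n::finite) subst_system \<Rightarrow> 'n \<Rightarrow> 'w measure \<Rightarrow>
     (nat \<Rightarrow> 'w \<Rightarrow> ('a, 'n) tile list) \<Rightarrow> bool" where
  "random_kakutani_sequence \<Sigma> i M \<pi> \<longleftrightarrow>
     prob_space M \<and>
     (\<forall>m. \<pi> m \<in> measurable M (count_space UNIV)) \<and>
     (\<forall>\<omega>\<in>space M. \<pi> 0 \<omega> = [(id, i)]) \<and>
     (\<forall>\<omega>\<in>space M. \<forall>m. \<pi> (Suc m) \<omega> \<in> set_pmf (kakutani_step \<Sigma> (\<pi> m \<omega>))) \<and>
     (\<forall>m P. measure M {\<omega> \<in> space M. \<forall>s\<le>Suc m. \<pi> s \<omega> = P s} =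
        measure M {\<omega> \<in> space M. \<forall>s\<le>m. \<pi> s \<omega> = P s} * pmf (kakutani_step \<Sigma> (P m)) (P (Suc m)))"

definition tiles_of_type :: "'n \<Rightarrow> ('a, 'n) tile list \<Rightarrow> ('a, 'n) tile list" where
  "tiles_of_type r P = filter (\<lambda>t. snd t = r) P"

definition type_vol ::
    "('a::euclidean_space, 'n) subst_system \<Rightarrow> 'n \<Rightarrow> ('a, 'n) tile list \<Rightarrow> real" where
  "type_vol \<Sigma> r P = measure lebesgue (\<Union>t\<in>set (tiles_of_type r P). tile_set \<Sigma> t)"

text \<open>The sum of \<open>g\<close> over the substitution tiles of type \<open>j\<close> of \<open>T\<^sub>i\<close>, averaged over the rules.\<close>

definition expected_matrix ::
    "('a::euclidean_space, 'n::finite) subst_system \<Rightarrow> (('a, 'n) piece \<Rightarrow> real) \<Rightarrow> real^'n^'n" where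
  "expected_matrix \<Sigma> g =
     (\<chi> i j. \<Sum>k<length (rules \<Sigma> i).
        pmf (rule_pmf \<Sigma> i) k * (\<Sum>p\<leftarrow>filter (\<lambda>p. piece_type p = j) (rules \<Sigma> i ! k). g p))"

definition S_matrix :: "('a::euclidean_space, 'n::finite) subst_system \<Rightarrow> real^'n^'n" where
  "S_matrix \<Sigma> = expected_matrix \<Sigma> (\<lambda>p. 1)"

definition V_matrix :: "('a::euclidean_space, 'n::finite) subst_system \<Rightarrow> real^'n^'n" where
  "V_matrix \<Sigma> = expected_matrix \<Sigma> (subst_vol \<Sigma>)"

definition H_matrix :: "('a::euclidean_space, 'n::finite) subst_system \<Rightarrow> real^'n^'n" where
  "H_matrix \<Sigma> = expected_matrix \<Sigma> (\<lambda>p. - subst_vol \<Sigma> p * ln (subst_vol \<Sigma> p))"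

text \<open>
  For a nonnegative matrix the Perron--Frobenius eigenvalue is the spectral radius, i.e. the largest
  modulus of a complex eigenvalue.
\<close>

definition perron_frobenius_eigenvalue :: "real^'n^'n \<Rightarrow> real" where
  "perron_frobenius_eigenvalue A =
     Sup {cmod z | z. \<exists>w::complex^'n. w \<noteq> 0 \<and> map_matrix complex_of_real A *v w = z *s w}"

definition left_perron_frobenius_eigenvector :: "real^'n^'n \<Rightarrow> real^'n \<Rightarrow> bool" where
  "left_perron_frobenius_eigenvector A v \<longleftrightarrow>
     v \<noteq> 0 \<and> v v* A = perron_frobenius_eigenvalue A *s v"

end

theory Submission
  imports Defs
begin

text \<open>
  Measure a tile by \<open>- ln\<close> of its volume, its length. Weighting edges by volume turns expected tile
  statistics at a volume threshold \<open>exp (- t)\<close> into solutions of a renewal equation along the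
  associated graph. The upper limit of a solution is determined as follows: by a maximum principle,
  and since incommensurability makes the lengths of walks asymptotically dense, the solution is
  nearly constant on long time windows; a weighted window integral of the solution, with the
  weights given by the left eigenvector, is conserved, which pins down the constant.

  In the random case, the threshold reached after \<open>m\<close> steps is itself random. For a fixed threshold
  \<open>t\<close>, an exponential moment bound shows that tile statistics deviate from their mean with
  probability at most \<open>exp (- c * exp t)\<close>. The possible thresholds form a set with at most
  exponentially many elements below \<open>t\<close>, so a union bound over all of them is affordable even after
  weighting with the number of tiles. Conservation of volume makes the limits independent of the
  type of the initial tile.
\<close>

section \<open>Walks and renewal equations\<close>

text \<open>Volume is conserved by every rule, so the factors exp (- length) of its pieces sum to 1.
  This makes the renewal kernel stochastic, with expected counts of order exp t at threshold t. The
  link to Kakutani sequences: if t is the length of the largest tiles of \<open>\<pi> m\<close>,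
  then \<open>\<pi> (Suc m)\<close> is the population stopped at t, and all its tiles have lengths
  in (t, t + \<open>longest\<close>]. The obstacle is that t depends on the random choices. Knowing
  that t occurs as a threshold biases the population, so means at a fixed t do not suffice. Moreover
  a count at threshold t has size exp t with t unbounded, so a rare event enters the expectation
  with that weight. The deviation bound must therefore beat exp t times the number of possible
  thresholds, both exponential in t.\<close>

inductive walk_length :: "'e set \<Rightarrow> ('e \<Rightarrow> 'n) \<Rightarrow> ('e \<Rightarrow> 'n) \<Rightarrow> ('e \<Rightarrow> real) \<Rightarrow> 'n \<Rightarrow> 'n \<Rightarrow> real \<Rightarrow> bool"
  for E src tgt len where
  walk_Nil: "walk_length E src tgt len i i 0"
| walk_Cons: "e \<in> E \<Longrightarrow> walk_length E src tgt len (tgt e) j x \<Longrightarrow> walk_length E src tgt len (src e) j (len e + x)"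

lemma walk_append:
  "walk_length E src tgt len i j x \<Longrightarrow> walk_length E src tgt len j k y \<Longrightarrow> walk_length E src tgt len i k (x + y)"
proof (induction rule: walk_length.induct)
  case (walk_Cons e j x)
  then show ?case using walk_length.walk_Cons[of e E src tgt len k "x + y"] by (simp add: add.assoc)
qed simp

lemma walk_repeat:
  assumes "walk_length E src tgt len i i a"
  shows "walk_length E src tgt len i i (real n * a)"
proof (induction n)
  case (Suc n)
  then show ?case using walk_append[OF assms Suc] by (simp add: algebra_simps)
qed (simp add: walk_Nil)

section \<open>Renewal equations on a finite graph with stochastic edge weights\<close>

locale markov_renewal =
  fixes E :: "'e set" and src tgt :: "'e \<Rightarrow> 'n::finite" and wt len :: "'e \<Rightarrow> real"
  assumes finite_E: "finite E"
    and wt_pos: "e \<in> E \<Longrightarrow> 0 < wt e"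
    and len_pos: "e \<in> E \<Longrightarrow> 0 < len e"
    and wt_sum: "(\<Sum>e | e \<in> E \<and> src e = i. wt e) = 1"
begin

definition out :: "'n \<Rightarrow> 'e set" where "out i = {e \<in> E. src e = i}"

abbreviation avg :: "'n \<Rightarrow> ('e \<Rightarrow> real) \<Rightarrow> real" where
  "avg i F \<equiv> (\<Sum>e\<in>out i. wt e * F e)"

definition gap :: real where "gap = Min (len ` E)"
definition longest :: real where "longest = Max (len ` E)"

lemma finite_out [simp]: "finite (out i)"
  using finite_E by (simp add: out_def)

lemma out_E: "e \<in> out i \<Longrightarrow> e \<in> E" and out_src: "e \<in> out i \<Longrightarrow> src e = i"
  by (simp_all add: out_def)

lemma wt_out: "(\<Sum>e\<in>out i. wt e) = 1"
  using wt_sum by (simp add: out_def)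

lemma E_nonempty: "E \<noteq> {}"
  using wt_out[of undefined] by (auto simp: out_def)

lemma gap_pos: "0 < gap"
  unfolding gap_def using finite_E E_nonempty len_pos by simp

lemma gap_le: "e \<in> E \<Longrightarrow> gap \<le> len e"
  unfolding gap_def using finite_E by simp

lemma le_longest: "e \<in> E \<Longrightarrow> len e \<le> longest"
  unfolding longest_def using finite_E by simp

lemma longest_pos: "0 < longest"
  using E_nonempty le_longest len_pos by fastforce

lemma sum_E_out: "(\<Sum>e\<in>E. f e) = (\<Sum>i\<in>UNIV. \<Sum>e\<in>out i. f e)"
  unfolding out_def by (rule sum.group[symmetric]) (use finite_E in auto)

lemma avg_le: assumes "\<And>e. e \<in> out i \<Longrightarrow> F e \<le> c" shows "avg i F \<le> c"
proof -
  have "avg i F \<le> (\<Sum>e\<in>out i. wt e * c)"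
    by (intro sum_mono mult_left_mono assms less_imp_le[OF wt_pos] out_E)
  then show ?thesis by (simp add: sum_distrib_right[symmetric] wt_out)
qed

lemma abs_avg_le: assumes "\<And>e. e \<in> out i \<Longrightarrow> \<bar>F e\<bar> \<le> c" shows "\<bar>avg i F\<bar> \<le> c"
proof -
  have "\<bar>avg i F\<bar> \<le> avg i (\<lambda>e. \<bar>F e\<bar>)"
    by (rule order.trans[OF sum_abs]) (auto intro!: sum_mono simp: abs_mult dest!: out_E wt_pos)
  also have "\<dots> \<le> c" by (intro avg_le assms)
  finally show ?thesis .
qed

lemma avg_nonneg: assumes "\<And>e. e \<in> out i \<Longrightarrow> 0 \<le> F e" shows "0 \<le> avg i F"
  by (intro sum_nonneg mult_nonneg_nonneg assms less_imp_le[OF wt_pos] out_E)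

text \<open>Each edge goes back in time by at least \<open>gap\<close>, so negative times are
  reached after finitely many steps: well-founded induction on real time, in blocks of length
  \<open>gap\<close>.\<close>

lemma time_induct:
  assumes neg: "\<And>i t. t < 0 \<Longrightarrow> P i t"
    and step: "\<And>i t. 0 \<le> t \<Longrightarrow> (\<And>e. e \<in> out i \<Longrightarrow> P (tgt e) (t - len e)) \<Longrightarrow> P i t"
  shows "P i t"
proof -
  have "\<forall>i t. t < real n * gap \<longrightarrow> P i t" for n
  proof (induction n)
    case 0
    then show ?case using neg by simp
  next
    case (Suc n)
    show ?case
    proof (intro allI impI)
      fix i t assume t: "t < real (Suc n) * gap"
      show "P i t"
      proof (cases "t < 0")
        case False
        have "P (tgt e) (t - len e)" if "e \<in> out i" for e
        proof -
          have "t - len e < real n * gap"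
            using gap_le[OF out_E[OF that]] t by (simp add: algebra_simps)
          then show ?thesis using Suc.IH by blast
        qed
        then show ?thesis using step False by simp
      qed (use neg in simp)
    qed
  qed
  moreover have "t < real (nat \<lceil>t / gap\<rceil> + 1) * gap"
  proof -
    have "t / gap < real (nat \<lceil>t / gap\<rceil> + 1)" by linarith
    then show ?thesis using gap_pos by (simp add: pos_divide_less_eq)
  qed
  ultimately show ?thesis by blast
qed

text \<open>The termination measure of \<open>renewal\<close>, \<open>mean\<close> and
  \<open>mgf\<close>. The \<open>+ 1\<close> separates times in [0, \<open>gap\<close>), of measure
  1, from negative times, of measure 0.\<close>

lemma floor_decreases:
  assumes "0 \<le> t" "gap \<le> l"
  shows "nat (\<lfloor>(t - l) / gap\<rfloor> + 1) < nat (\<lfloor>t / gap\<rfloor> + 1)"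
proof -
  have "(t - l) / gap \<le> t / gap - 1" using gap_pos assms by (simp add: field_simps)
  then have "\<lfloor>(t - l) / gap\<rfloor> \<le> \<lfloor>t / gap\<rfloor> - 1" by linarith
  moreover have "0 \<le> \<lfloor>t / gap\<rfloor>" using assms gap_pos by simp
  ultimately show ?thesis by simp
qed

text \<open>The Markov renewal equation with vanishing past and source \<open>g\<close>. Iterated,
  \<open>u i t\<close> is the expected sum of \<open>g\<close> along the random walk from
  \<open>i\<close> that runs back from time \<open>t\<close>.\<close>

definition solves :: "('n \<Rightarrow> real \<Rightarrow> real) \<Rightarrow> ('n \<Rightarrow> real \<Rightarrow> real) \<Rightarrow> bool" where
  "solves g u \<longleftrightarrow>
     (\<forall>i t. u i t = (if t < 0 then 0 else g i t + avg i (\<lambda>e. u (tgt e) (t - len e))))"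

lemma solvesD_neg: "solves g u \<Longrightarrow> t < 0 \<Longrightarrow> u i t = 0"
  by (simp add: solves_def)

lemma solvesD: "solves g u \<Longrightarrow> 0 \<le> t \<Longrightarrow> u i t = g i t + avg i (\<lambda>e. u (tgt e) (t - len e))"
  unfolding solves_def by (metis not_less)

function renewal :: "('n \<Rightarrow> real \<Rightarrow> real) \<Rightarrow> 'n \<Rightarrow> real \<Rightarrow> real" where
  "renewal g i t = (if t < 0 then 0 else g i t + avg i (\<lambda>e. renewal g (tgt e) (t - len e)))"
  by auto
termination
proof (relation "Wellfounded.measure (\<lambda>(g, i, t). nat (\<lfloor>t / gap\<rfloor> + 1))", goal_cases)
  case (2 g i t e)
  then have "nat (\<lfloor>(t - len e) / gap\<rfloor> + 1) < nat (\<lfloor>t / gap\<rfloor> + 1)"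
    by (intro floor_decreases gap_le out_E) auto
  then show ?case by simp
qed simp

declare renewal.simps [simp del]

lemma solves_renewal: "solves g (renewal g)"
  unfolding solves_def using renewal.simps by blast

lemma solves_uminus: "solves g u \<Longrightarrow> solves (\<lambda>i t. - g i t) (\<lambda>i t. - u i t)"
  by (auto simp: solves_def sum_negf)

text \<open>A minimum principle, by induction over time: an average of nonnegative earlier values is
  nonnegative. It compares solutions with different sources in
  \<open>renewal_theorem\<close>.\<close>

lemma nonneg_if_superharmonic:
  assumes "\<And>i t. t < 0 \<Longrightarrow> 0 \<le> w i t"
    and "\<And>i t. 0 \<le> t \<Longrightarrow> avg i (\<lambda>e. w (tgt e) (t - len e)) \<le> w i t"
  shows "0 \<le> w i t"
proof (induction i t rule: time_induct)
  case (2 i t)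
  have "0 \<le> avg i (\<lambda>e. w (tgt e) (t - len e))" by (rule avg_nonneg) (rule 2(2))
  then show ?case using assms(2)[OF 2(1), of i] by linarith
qed (use assms in simp)

text \<open>A walk running back from \<open>t\<close> meets [0, B] in at most B / \<open>gap\<close>
  + 1 points, each contributing at most \<open>M\<close>.\<close>

lemma solution_bound:
  assumes u: "solves g u" and M: "\<And>i t. \<bar>g i t\<bar> \<le> M" and B: "0 \<le> B" "\<And>i t. B < t \<Longrightarrow> g i t = 0"
  shows "\<bar>u i t\<bar> \<le> M * (B / gap + 1)"
proof -
  have M0: "0 \<le> M" using M[of undefined 0] by linarith
  \<comment> \<open>The number of visits to [0, B] still possible at time \<open>t\<close>, times
    \<open>M\<close>; the induction needs this dependence on \<open>t\<close>.\<close>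
  define K where "K t = (if t < 0 then 0 else M * (min t B / gap + 1))" for t
  have K: "K t \<le> M * (B / gap + 1)" for t
    using M0 B(1) gap_pos by (auto simp: K_def intro!: mult_left_mono divide_right_mono)
  have "\<bar>u i t\<bar> \<le> K t"
  proof (induction i t rule: time_induct)
    case (1 i t)
    then show ?case using solvesD_neg[OF u] by (simp add: K_def)
  next
    case (2 i t)
    note ui = solvesD[OF u 2(1), of i]
    show ?case
    proof (cases "t \<le> B")
      case True
      have "\<bar>avg i (\<lambda>e. u (tgt e) (t - len e))\<bar> \<le> M * (t / gap)"
      proof (rule abs_avg_le)
        fix e assume e: "e \<in> out i"
        have "K (t - len e) \<le> M * (t / gap)"
        proof (cases "t - len e < 0")
          case False
          have "min (t - len e) B / gap + 1 \<le> t / gap"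
          proof -
            have "min (t - len e) B / gap \<le> (t - gap) / gap"
              using gap_pos gap_le[OF out_E[OF e]] by (intro divide_right_mono) auto
            then show ?thesis using gap_pos by (simp add: diff_divide_distrib)
          qed
          then have "M * (min (t - len e) B / gap + 1) \<le> M * (t / gap)" using M0 by (rule mult_left_mono)
          then show ?thesis using False by (simp add: K_def)
        qed (use M0 2(1) gap_pos in \<open>simp add: K_def\<close>)
        then show "\<bar>u (tgt e) (t - len e)\<bar> \<le> M * (t / gap)" using 2(2)[OF e] by linarith
      qed
      then have "\<bar>u i t\<bar> \<le> M + M * (t / gap)" using ui M[of i t] by linarith
      then show ?thesis using True 2(1) by (simp add: K_def min_def algebra_simps)
    next
      case False
      have "\<bar>avg i (\<lambda>e. u (tgt e) (t - len e))\<bar> \<le> M * (B / gap + 1)"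
        by (rule abs_avg_le) (use 2(2) K order.trans in blast)
      then show ?thesis using ui B(2)[of t i] False 2(1) by (simp add: K_def min_def)
    qed
  qed
  then show ?thesis using K[of t] by linarith
qed

end

section \<open>Uniform continuity of solutions\<close>

lemma continuous_interval_bounded:
  fixes f :: "real \<Rightarrow> real"
  assumes "continuous_on UNIV f"
  shows "\<exists>A. \<forall>x. a \<le> x \<and> x \<le> b \<longrightarrow> \<bar>f x\<bar> \<le> A"
proof -
  have "bounded (f ` {a..b})"
    by (intro compact_imp_bounded compact_continuous_image continuous_on_subset[OF assms]) auto
  then obtain A where "\<forall>y\<in>f ` {a..b}. norm y \<le> A" unfolding bounded_iff by blast
  then show ?thesis by (intro exI[of _ A]) auto
qed

lemma compact_support_uniform:
  fixes f :: "real \<Rightarrow> real"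
  assumes c: "continuous_on UNIV f" and z: "\<And>t. t \<le> 0 \<or> B \<le> t \<Longrightarrow> f t = 0" and e: "0 < \<epsilon>"
  obtains d where "0 < d" "\<And>s t. \<bar>s - t\<bar> < d \<Longrightarrow> \<bar>f s - f t\<bar> < \<epsilon>"
proof -
  have "uniformly_continuous_on {-1..\<bar>B\<bar>+1} f"
    by (intro compact_uniformly_continuous continuous_on_subset[OF c]) auto
  then obtain d where d: "0 < d" "\<And>s t. s \<in> {-1..\<bar>B\<bar>+1} \<Longrightarrow> t \<in> {-1..\<bar>B\<bar>+1} \<Longrightarrow> dist s t < d \<Longrightarrow> dist (f s) (f t) < \<epsilon>"
    unfolding uniformly_continuous_on_def using e by metis
  show ?thesis
  proof (rule that)
    show "0 < min d 1" using d by simp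
    fix s t :: real assume st: "\<bar>s - t\<bar> < min d 1"
    show "\<bar>f s - f t\<bar> < \<epsilon>"
    proof (cases "s \<in> {-1..\<bar>B\<bar>+1} \<and> t \<in> {-1..\<bar>B\<bar>+1}")
      case True
      then show ?thesis using d(2)[of s t] st by (auto simp: dist_real_def)
    next
      case False
      then have "(s \<le> 0 \<or> B \<le> s) \<and> (t \<le> 0 \<or> B \<le> t)" using st by auto
      then show ?thesis using z e by auto
    qed
  qed
qed

context markov_renewal begin

text \<open>By linearity u(t) - u(t - k) solves the equation with source g(t) - g(t - k), which is
  uniformly small for small \<open>k\<close> and lives on a bounded interval;
  \<open>solution_bound\<close> then gives an estimate independent of \<open>t\<close>.\<close>

lemma solution_uniformly_continuous:
  assumes u: "solves g u" and c: "\<And>i. continuous_on UNIV (g i)"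
    and z: "\<And>i t. t \<le> 0 \<or> B \<le> t \<Longrightarrow> g i t = 0" and B: "0 \<le> B" and e: "0 < \<epsilon>"
  obtains h where "0 < h" "\<And>i s t. \<bar>s - t\<bar> \<le> h \<Longrightarrow> \<bar>u i s - u i t\<bar> \<le> \<epsilon>"
proof -
  \<comment> \<open>\<open>B + 1\<close> because a shift by at most 1 enlarges the support of the
    source by at most 1.\<close>
  define \<eta> where "\<eta> = \<epsilon> / ((B + 1) / gap + 1)"
  have den: "0 < (B + 1) / gap + 1" using B gap_pos by (intro add_nonneg_pos) auto
  have \<eta>: "0 < \<eta>" using e den by (simp add: \<eta>_def)
  have "\<exists>d>0. \<forall>s t. \<bar>s - t\<bar> < d \<longrightarrow> \<bar>g i s - g i t\<bar> < \<eta>" for i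
    using compact_support_uniform[OF c z \<eta>] by metis
  then obtain d where d: "\<And>i. 0 < d i" "\<And>i s t. \<bar>s - t\<bar> < d i \<Longrightarrow> \<bar>g i s - g i t\<bar> < \<eta>" by metis
  define h where "h = min 1 (Min (range d) / 2)"
  have h: "0 < h" "h \<le> 1" using d(1) by (auto simp: h_def)
  have hd: "h < d i" for i
  proof -
    have "0 < Min (range d)" using d(1) by simp
    moreover have "Min (range d) \<le> d i" by simp
    ultimately show ?thesis unfolding h_def by linarith
  qed
  have shift: "\<bar>u i t - u i (t - k)\<bar> \<le> \<epsilon>" if k: "0 \<le> k" "k \<le> h" for i t k
  proof -
    have sol: "solves (\<lambda>i t. g i t - g i (t - k)) (\<lambda>i t. u i t - u i (t - k))"
      unfolding solves_def
    proof (intro allI)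
      fix i t
      show "u i t - u i (t - k) = (if t < 0 then 0 else g i t - g i (t - k) +
          avg i (\<lambda>e. u (tgt e) (t - len e) - u (tgt e) (t - len e - k)))"
      proof (cases "t < 0")
        case True
        then show ?thesis using solvesD_neg[OF u] k by simp
      next
        case False
        \<comment> \<open>For t - k < 0 the equation persists because all its terms vanish, the
          source by \<open>z\<close>. A source with a jump at 0 would break this.\<close>
        have eq: "u i (t - k) = g i (t - k) + avg i (\<lambda>e. u (tgt e) (t - k - len e))"
        proof (cases "t - k < 0")
          case True
          have "avg i (\<lambda>e. u (tgt e) (t - k - len e)) = 0"
          proof (intro sum.neutral ballI)
            fix e assume "e \<in> out i"
            then have "t - k - len e < 0" using True len_pos[OF out_E] by fastforce
            then show "wt e * u (tgt e) (t - k - len e) = 0" by (simp add: solvesD_neg[OF u])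
          qed
          then show ?thesis using True solvesD_neg[OF u True] z[of "t - k" i] by simp
        next
          case False
          then show ?thesis using solvesD[OF u] by simp
        qed
        show ?thesis using False solvesD[OF u, of t i] eq
          by (simp add: right_diff_distrib sum_subtractf algebra_simps)
      qed
    qed
    have "\<bar>u i t - u i (t - k)\<bar> \<le> \<eta> * ((B + 1) / gap + 1)"
    proof (rule solution_bound[OF sol])
      show "\<bar>g i t - g i (t - k)\<bar> \<le> \<eta>" for i t
        using d(2)[of t "t - k" i] hd[of i] k by auto
      show "g i t - g i (t - k) = 0" if "B + 1 < t" for i t
        using z[of t i] z[of "t - k" i] that k h by simp
    qed (use B in simp)
    then show ?thesis using den by (simp add: \<eta>_def)
  qed
  show ?thesis
  proof (rule that[OF h(1)])
    fix i s t assume "\<bar>s - t\<bar> \<le> h"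
    then show "\<bar>u i s - u i t\<bar> \<le> \<epsilon>"
      using shift[of "s - t" i s] shift[of "t - s" i t] by (cases "t \<le> s") (auto simp: abs_minus_commute)
  qed
qed

lemma solution_continuous:
  assumes u: "solves g u" and c: "\<And>i. continuous_on UNIV (g i)"
    and z: "\<And>i t. t \<le> 0 \<or> B \<le> t \<Longrightarrow> g i t = 0" and B: "0 \<le> B"
  shows "isCont (u i) t"
  unfolding continuous_at_eps_delta
proof (intro allI impI)
  fix \<epsilon> :: real assume "0 < \<epsilon>"
  then have e2: "0 < \<epsilon> / 2" by simp
  obtain h where h: "0 < h" "\<And>i s t. \<bar>s - t\<bar> \<le> h \<Longrightarrow> \<bar>u i s - u i t\<bar> \<le> \<epsilon> / 2"
    using solution_uniformly_continuous[OF u c z B e2] by metis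
  show "\<exists>d>0. \<forall>x'. dist x' t < d \<longrightarrow> dist (u i x') (u i t) < \<epsilon>"
  proof (intro exI[of _ h] conjI allI impI)
    fix x' assume "dist x' t < h"
    then show "dist (u i x') (u i t) < \<epsilon>"
      using h(2)[of x' t i] \<open>0 < \<epsilon>\<close> by (simp add: dist_real_def)
  qed (rule h)
qed

end

text \<open>\<open>0 < b\<close> excludes the empty walk: for b = 0 the multiples reduce to {0}, and
  every positive \<open>a\<close> would qualify.\<close>

locale nonlattice_renewal = markov_renewal E src tgt wt len
  for E :: "'e set" and src tgt :: "'e \<Rightarrow> 'n::finite" and wt len :: "'e \<Rightarrow> real" +
  assumes connected: "\<exists>x. walk_length E src tgt len i j x"
    and nonlattice: "\<exists>p q a b. walk_length E src tgt len p p a \<and> walk_length E src tgt len q q b \<and> 0 < b \<and> a \<notin> {b * x | x. x \<in> \<rat>}"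

section \<open>Conserved window integrals and propagation along walks\<close>

context markov_renewal begin

lemma walk_nonneg: "walk_length E src tgt len i j x \<Longrightarrow> 0 \<le> x"
proof (induction rule: walk_length.induct)
  case (walk_Cons e j x)
  then show ?case using len_pos[of e] by simp
qed simp

lemma antiderivative:
  fixes f :: "real \<Rightarrow> real"
  assumes "\<And>t. isCont f t"
  obtains F where "\<And>t. (F has_real_derivative f t) (at t)"
proof -
  have "\<exists>F. \<forall>x::real. -\<infinity> < ereal x \<longrightarrow> ereal x < \<infinity> \<longrightarrow> (F has_vector_derivative f x) (at x)"
    by (rule einterval_antiderivative) (use assms in auto)
  then show ?thesis using that by (auto simp: has_real_derivative_iff_has_vector_derivative)
qed

text \<open>\<open>v\<close> is a left eigenvector of the transition matrix for eigenvalue 1. No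
  sign is imposed on it, hence the absolute values in the error bounds.\<close>

definition stationary :: "('n \<Rightarrow> real) \<Rightarrow> bool" where
  "stationary v \<longleftrightarrow> (\<forall>j. (\<Sum>e | e \<in> E \<and> tgt e = j. v (src e) * wt e) = v j)"

text \<open>The mean edge length under \<open>v\<close>, which becomes the denominator of all
  limits; \<open>drift_eq\<close> identifies it with
  \<open>(v v* H_matrix \<Sigma>) \<bullet> 1\<close>.\<close>

definition drift :: "('n \<Rightarrow> real) \<Rightarrow> real" where
  "drift v = (\<Sum>e\<in>E. v (src e) * wt e * len e)"

text \<open>The weighted window integrals of a solution have derivative \<open>\<Sum>i. v i * g i t\<close>, hence
  are eventually constant.\<close>

lemma window_conserved:
  assumes u: "solves g u" and c: "\<And>i. continuous_on UNIV (g i)"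
    and z: "\<And>i t. t \<le> 0 \<or> B \<le> t \<Longrightarrow> g i t = 0" and B: "0 \<le> B"
    and v: "stationary v" and G: "\<And>i. (g i has_integral G i) {0..B}"
    and t: "B \<le> t" and close: "\<And>j s. t - longest \<le> s \<Longrightarrow> s \<le> t \<Longrightarrow> \<bar>u j s - a\<bar> \<le> \<epsilon>"
  shows "\<bar>(\<Sum>i\<in>UNIV. v i * G i) - a * drift v\<bar> \<le> \<epsilon> * (\<Sum>e\<in>E. \<bar>v (src e)\<bar> * wt e * len e)"
proof -
  have "\<exists>F. \<forall>t. (F has_real_derivative u j t) (at t)" for j
    using antiderivative[OF solution_continuous[OF u c z B]] by metis
  then obtain F where F: "\<And>j t. (F j has_real_derivative u j t) (at t)" by metis
  have cont_g: "isCont (g j) t" for j t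
    using c[of j] by (simp add: continuous_on_eq_continuous_at)
  then have "\<exists>H. \<forall>t. (H has_real_derivative g j t) (at t)" for j
    using antiderivative by metis
  then obtain H where H: "\<And>j t. (H j has_real_derivative g j t) (at t)" by metis
  \<comment> \<open>The window integrals of \<open>u\<close> over [t - len e, t], written with
    antiderivatives, minus the accumulated source.\<close>
  define D where "D t = (\<Sum>e\<in>E. v (src e) * wt e * (F (tgt e) t - F (tgt e) (t - len e))) - (\<Sum>i\<in>UNIV. v i * H i t)" for t
  have F_shift: "((\<lambda>t. F j (t - d)) has_real_derivative u j (t - d)) (at t)" for j t d
    using DERIV_shift[of "F j" "u j (t - d)" t "- d"] F by simp
  have deriv: "(D has_real_derivative
     (\<Sum>e\<in>E. v (src e) * wt e * (u (tgt e) t - u (tgt e) (t - len e))) - (\<Sum>i\<in>UNIV. v i * g i t)) (at t)" for t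
    unfolding D_def by (intro DERIV_diff DERIV_sum DERIV_cmult F F_shift H)
  have zero: "(\<Sum>e\<in>E. v (src e) * wt e * (u (tgt e) t - u (tgt e) (t - len e))) - (\<Sum>i\<in>UNIV. v i * g i t) = 0" for t
  proof -
    have 1: "(\<Sum>e\<in>E. v (src e) * wt e * u (tgt e) t) = (\<Sum>j\<in>UNIV. v j * u j t)"
    proof -
      have "(\<Sum>e\<in>E. v (src e) * wt e * u (tgt e) t) = (\<Sum>j\<in>UNIV. \<Sum>e | e \<in> E \<and> tgt e = j. v (src e) * wt e * u (tgt e) t)"
        by (rule sum.group[symmetric]) (use finite_E in auto)
      also have "\<dots> = (\<Sum>j\<in>UNIV. (\<Sum>e | e \<in> E \<and> tgt e = j. v (src e) * wt e) * u j t)"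
        by (simp add: sum_distrib_right)
      finally show ?thesis using v by (simp add: stationary_def)
    qed
    have 2: "(\<Sum>e\<in>E. v (src e) * wt e * u (tgt e) (t - len e)) = (\<Sum>i\<in>UNIV. v i * avg i (\<lambda>e. u (tgt e) (t - len e)))"
      unfolding sum_E_out by (simp add: sum_distrib_left out_src mult.assoc)
    have 3: "u i t = g i t + avg i (\<lambda>e. u (tgt e) (t - len e))" for i
    proof (cases "t < 0")
      case True
      have "avg i (\<lambda>e. u (tgt e) (t - len e)) = 0"
      proof (intro sum.neutral ballI)
        fix e assume "e \<in> out i"
        then have "t - len e < 0" using True len_pos[OF out_E] by fastforce
        then show "wt e * u (tgt e) (t - len e) = 0" by (simp add: solvesD_neg[OF u])
      qed
      then show ?thesis using True solvesD_neg[OF u True] z[of t i] by simp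
    qed (use solvesD[OF u] in simp)
    show ?thesis
      using 1 2 3 by (simp add: right_diff_distrib sum_subtractf distrib_left sum.distrib)
  qed
  \<comment> \<open>Time -1 is the reference point, since all window integrals vanish there.\<close>
  have D_const: "D t = D (-1)"
    by (rule DERIV_isconst_all[of D]) (use deriv zero in metis)
  have F_neg: "F j (-1) - F j (-1 - len e) = 0" if "e \<in> E" for j e
  proof -
    have "-1 - len e < -1" using len_pos[OF that] by simp
    from MVT2[OF this, of "F j" "u j"] F obtain s where "s < -1"
      "F j (-1) - F j (-1 - len e) = (-1 - (-1 - len e)) * u j s" by blast
    then show ?thesis using solvesD_neg[OF u, of s j] by simp
  qed
  have HG: "H i t - H i (-1) = G i" for i
  proof -
    have "(g i has_integral H i t - H i (-1)) {-1..t}"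
      by (rule fundamental_theorem_of_calculus)
         (use B t H in \<open>auto simp: has_real_derivative_iff_has_vector_derivative[symmetric] intro: has_field_derivative_at_within\<close>)
    moreover have "(g i has_integral G i) {-1..t}"
      by (rule has_integral_on_superset[OF G[of i]]) (use z t in auto)
    ultimately show ?thesis by (rule has_integral_unique)
  qed
  have eq: "(\<Sum>e\<in>E. v (src e) * wt e * (F (tgt e) t - F (tgt e) (t - len e))) = (\<Sum>i\<in>UNIV. v i * G i)"
  proof -
    have "(\<Sum>e\<in>E. v (src e) * wt e * (F (tgt e) (-1) - F (tgt e) (-1 - len e))) = 0"
      using F_neg by (intro sum.neutral) auto
    then show ?thesis
      using D_const unfolding D_def HG[symmetric] by (simp add: right_diff_distrib sum_subtractf)
  qed
  \<comment> \<open>By the mean value theorem the window integral is len e times a value of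
    \<open>u\<close> inside the window, where \<open>u\<close> is close to \<open>a\<close>.\<close>
  have near: "\<bar>F (tgt e) t - F (tgt e) (t - len e) - a * len e\<bar> \<le> \<epsilon> * len e" if "e \<in> E" for e
  proof -
    have "t - len e < t" using len_pos[OF that] by simp
    from MVT2[OF this, of "F (tgt e)" "u (tgt e)"] F obtain s where s: "t - len e < s" "s < t"
      "F (tgt e) t - F (tgt e) (t - len e) = len e * u (tgt e) s" by auto
    have "\<bar>u (tgt e) s - a\<bar> \<le> \<epsilon>" using close s le_longest[OF that] by simp
    moreover have "F (tgt e) t - F (tgt e) (t - len e) - a * len e = (u (tgt e) s - a) * len e"
      using s(3) by (simp add: algebra_simps)
    ultimately show ?thesis using len_pos[OF that] by (simp add: abs_mult mult_right_mono)
  qed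
  have "(\<Sum>i\<in>UNIV. v i * G i) - a * drift v = (\<Sum>e\<in>E. v (src e) * wt e * (F (tgt e) t - F (tgt e) (t - len e) - a * len e))"
    unfolding eq[symmetric] drift_def by (simp add: right_diff_distrib sum_subtractf sum_distrib_left mult_ac)
  also have "\<bar>\<dots>\<bar> \<le> (\<Sum>e\<in>E. \<bar>v (src e)\<bar> * wt e * (\<epsilon> * len e))"
  proof (rule order.trans[OF sum_abs], rule sum_mono)
    fix e assume e: "e \<in> E"
    have "\<bar>v (src e) * wt e * (F (tgt e) t - F (tgt e) (t - len e) - a * len e)\<bar> =
      \<bar>v (src e)\<bar> * wt e * \<bar>F (tgt e) t - F (tgt e) (t - len e) - a * len e\<bar>"
      using wt_pos[OF e] by (simp add: abs_mult)
    also have "\<dots> \<le> \<bar>v (src e)\<bar> * wt e * (\<epsilon> * len e)"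
      using near[OF e] wt_pos[OF e] by (intro mult_left_mono) auto
    finally show "\<bar>v (src e) * wt e * (F (tgt e) t - F (tgt e) (t - len e) - a * len e)\<bar> \<le> \<bar>v (src e)\<bar> * wt e * (\<epsilon> * len e)" .
  qed
  also have "\<dots> = \<epsilon> * (\<Sum>e\<in>E. \<bar>v (src e)\<bar> * wt e * len e)"
    by (simp add: sum_distrib_left mult_ac)
  finally show ?thesis .
qed

text \<open>Chosen so that wt e >= exp (- rate * len e): the positivity lost along a walk is then
  controlled by its length, whatever its number of edges.\<close>

definition rate :: real where "rate = Max ((\<lambda>e. \<bar>ln (wt e)\<bar> / len e) ` E)"

lemma rate_nonneg: "0 \<le> rate"
proof -
  obtain e where e: "e \<in> E" using E_nonempty by blast
  have "0 \<le> \<bar>ln (wt e)\<bar> / len e" using len_pos[OF e] by simp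
  also have "\<dots> \<le> rate" unfolding rate_def using finite_E e by (intro Max_ge) auto
  finally show ?thesis .
qed

lemma wt_ge_rate: assumes e: "e \<in> E" shows "1 \<le> exp (rate * len e) * wt e"
proof -
  have "\<bar>ln (wt e)\<bar> / len e \<le> rate" unfolding rate_def using finite_E e by (intro Max_ge) auto
  then have "- ln (wt e) \<le> rate * len e" using len_pos[OF e] by (simp add: divide_le_eq)
  then have "exp (- ln (wt e)) \<le> exp (rate * len e)" by simp
  then show ?thesis using wt_pos[OF e] by (simp add: exp_minus field_simps)
qed

text \<open>A quantitative maximum principle.\<close>

lemma harmonic_along_walk:
  assumes "walk_length E src tgt len i j x"
    and nonneg: "\<And>i s. T - longest \<le> s \<Longrightarrow> 0 \<le> D i s"
    and harm: "\<And>i s. T \<le> s \<Longrightarrow> D i s = avg i (\<lambda>e. D (tgt e) (s - len e))"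
    and "T \<le> t - x"
  shows "D j (t - x) \<le> exp (rate * x) * D i t"
  using assms(1,4)
proof (induction arbitrary: t rule: walk_length.induct)
  case (walk_Cons e j x)
  have x: "0 \<le> x" using walk_Cons walk_nonneg by blast
  have l: "0 < len e" "len e \<le> longest" using len_pos le_longest walk_Cons(1) by auto
  have T: "T \<le> t - len e - x" "T \<le> t" using walk_Cons.prems x l by auto
  have e: "e \<in> out (src e)" using walk_Cons(1) by (simp add: out_def)
  have "D j (t - len e - x) \<le> exp (rate * x) * D (tgt e) (t - len e)"
    by (rule walk_Cons.IH[OF T(1)])
  moreover have "D (tgt e) (t - len e) \<le> exp (rate * len e) * D (src e) t"
  proof -
    \<comment> \<open>One edge back from a time after \<open>T\<close> stays above T - longest,
      where \<open>D\<close> is nonnegative; so a single term of the average is at most the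
      average.\<close>
    have ge: "0 \<le> D (tgt e') (t - len e')" if "e' \<in> out (src e)" for e'
      using nonneg[of "t - len e'"] T le_longest[OF out_E[OF that]] by simp
    have "wt e * D (tgt e) (t - len e) \<le> avg (src e) (\<lambda>e. D (tgt e) (t - len e))"
      by (rule member_le_sum[OF e]) (use mult_nonneg_nonneg[OF less_imp_le[OF wt_pos[OF out_E]] ge] in auto)
    also have "\<dots> = D (src e) t" using harm[OF T(2)] by simp
    finally have "exp (rate * len e) * (wt e * D (tgt e) (t - len e)) \<le> exp (rate * len e) * D (src e) t"
      by (intro mult_left_mono) auto
    moreover have "1 * D (tgt e) (t - len e) \<le> (exp (rate * len e) * wt e) * D (tgt e) (t - len e)"
      using wt_ge_rate[OF walk_Cons(1)] ge[OF e] by (intro mult_right_mono) auto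
    ultimately show ?thesis unfolding mult_1 mult.assoc by linarith
  qed
  then have "exp (rate * x) * D (tgt e) (t - len e) \<le> exp (rate * x) * (exp (rate * len e) * D (src e) t)"
    by (intro mult_left_mono) auto
  ultimately have "D j (t - len e - x) \<le> exp (rate * x) * (exp (rate * len e) * D (src e) t)"
    by linarith
  also have "\<dots> = exp (rate * (len e + x)) * D (src e) t"
    by (simp add: exp_add distrib_left)
  finally show ?case by (simp add: diff_diff_eq)
qed simp

end

text \<open>Dirichlet approximation gives multiples of \<open>a\<close> and \<open>b\<close> less
  than \<epsilon> apart, and distinct since a / b is irrational. Among K copies of the smaller one,
  exchanging one for the larger raises the sum by d < \<epsilon>; for large K, K exchanges bridge
  the whole distance to K + 1 copies.\<close>

lemma eventually_dense_combinations:
  fixes a b :: real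
  assumes a: "0 \<le> a" and b: "0 < b" and irr: "a \<notin> {b * x | x. x \<in> \<rat>}" and e: "0 < \<epsilon>"
  obtains X where "\<And>x. X \<le> x \<Longrightarrow> \<exists>n m. x \<le> real n * a + real m * b \<and> real n * a + real m * b \<le> x + \<epsilon>"
proof -
  have a0: "0 < a" using a irr by (cases "a = 0") (auto simp: image_iff intro: exI[of _ 0])
  \<comment> \<open>Dirichlet's error 1 / N has to be below \<epsilon> / b.\<close>
  define N where "N = nat \<lceil>b / \<epsilon>\<rceil> + 1"
  have N: "b / real N < \<epsilon>" "0 < N"
  proof -
    have "b / \<epsilon> < real N" unfolding N_def by linarith
    then have "b < \<epsilon> * real N" using e by (simp add: pos_divide_less_eq mult.commute)
    then show "b / real N < \<epsilon>" by (subst pos_divide_less_eq) (simp_all add: N_def)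
  qed (simp add: N_def)
  obtain h k where hk: "0 < k" "k \<le> int N" "\<bar>of_int k * (a / b) - of_int h\<bar> < 1 / real N"
    using Dirichlet_approx[OF N(2), of "a / b"] by blast
  have close: "\<bar>of_int k * a - of_int h * b\<bar> < \<epsilon>"
  proof -
    have "\<bar>of_int k * a - of_int h * b\<bar> = b * \<bar>of_int k * (a / b) - of_int h\<bar>"
    proof -
      have "of_int k * a - of_int h * b = b * (of_int k * (a / b) - of_int h)"
        using b by (simp add: field_simps)
      then show ?thesis using b by (simp add: abs_mult)
    qed
    also have "\<dots> < b * (1 / real N)" using hk b by (intro mult_strict_left_mono) auto
    finally show ?thesis using N by simp
  qed
  have ne: "of_int k * a \<noteq> of_int h * b"
  proof
    assume "of_int k * a = of_int h * b"
    then have "a = b * (of_int h / of_int k)" using hk(1) by (simp add: field_simps)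
    moreover have "(of_int h / of_int k :: real) \<in> \<rat>" by simp
    ultimately show False using irr by blast
  qed
  show ?thesis
  proof (cases "h \<le> 0")
    case True
    text \<open>Then \<open>a\<close> itself is smaller than \<open>\<epsilon>\<close>.\<close>
    have "1 * a \<le> of_int k * a" using hk(1) a0 by (intro mult_right_mono) auto
    also have "\<dots> \<le> of_int k * a - of_int h * b"
      using True b by (simp add: mult_nonpos_nonneg)
    also have "\<dots> < \<epsilon>" using close by linarith
    finally have "a < \<epsilon>" by simp
    show ?thesis
    proof (rule that[of 0])
      fix x :: real assume x: "0 \<le> x"
      define n where "n = nat \<lceil>x / a\<rceil>"
      have "x / a \<le> real n" "real n \<le> x / a + 1" using x a0 by (auto simp: n_def)
      then have "x \<le> real n * a" "real n * a \<le> x + a" using a0 by (auto simp: field_simps)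
      then show "\<exists>n m. x \<le> real n * a + real m * b \<and> real n * a + real m * b \<le> x + \<epsilon>"
        using \<open>a < \<epsilon>\<close> by (intro exI[of _ n] exI[of _ 0]) auto
    qed
  next
    case False
    define P where "P = real (nat k) * a"
    define Q where "Q = real (nat h) * b"
    have PQ: "0 < P" "0 < Q" "P \<noteq> Q" "\<bar>P - Q\<bar> < \<epsilon>"
      using hk(1) False a0 b close ne by (auto simp: P_def Q_def)
    define lo where "lo = min P Q"
    define hi where "hi = max P Q"
    define d where "d = hi - lo"
    have d: "0 < d" "d < \<epsilon>" "0 < lo" using PQ by (auto simp: d_def lo_def hi_def)
    \<comment> \<open>With at least \<open>K0\<close> copies, exchanging all of them gains at least
      \<open>lo\<close>, the distance to the next rung.\<close>
    define K0 where "K0 = nat \<lceil>lo / d\<rceil>"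
    have K0: "lo \<le> real K0 * d"
    proof -
      have "lo / d \<le> real K0" unfolding K0_def by linarith
      then show ?thesis using d by (simp add: field_simps)
    qed
    show ?thesis
    proof (rule that[of "real K0 * lo"])
      fix x :: real assume x: "real K0 * lo \<le> x"
      define K where "K = nat \<lfloor>x / lo\<rfloor>"
      have x0: "0 \<le> x" using x d(3) by (meson mult_nonneg_nonneg of_nat_0_le_iff less_imp_le order_trans)
      have "real K0 \<le> x / lo" using x d(3) by (simp add: field_simps)
      then have KK: "K0 \<le> K" unfolding K_def by (simp add: le_nat_floor)
      have K: "real K \<le> x / lo" "x / lo < real K + 1" using x0 d(3) by (auto simp: K_def)
      then have K': "real K * lo \<le> x" "x < real K * lo + lo" using d(3) by (auto simp: field_simps)
      \<comment> \<open>\<open>k'\<close> exchanges overshoot \<open>x\<close> by at most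
        \<open>d\<close>; they are available because k' <= K.\<close>
      define k' where "k' = nat \<lceil>(x - real K * lo) / d\<rceil>"
      have "0 \<le> (x - real K * lo) / d" using K' d by simp
      then have k': "(x - real K * lo) / d \<le> real k'" "real k' < (x - real K * lo) / d + 1"
        unfolding k'_def by linarith+
      then have k'': "x \<le> real K * lo + real k' * d" "real K * lo + real k' * d \<le> x + d"
        using d by (auto simp: field_simps)
      have "(x - real K * lo) / d \<le> real K"
      proof -
        have "x - real K * lo \<le> real K0 * d" using K' K0 by linarith
        also have "\<dots> \<le> real K * d" using KK d by (intro mult_right_mono) auto
        finally show ?thesis using d by (simp add: field_simps)
      qed
      then have kK: "k' \<le> K" unfolding k'_def by linarith
      have "real K * lo + real k' * d = real (K - k') * lo + real k' * hi"
        using kK by (simp add: d_def of_nat_diff algebra_simps)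
      moreover have "\<exists>n m. real (K - k') * lo + real k' * hi = real n * a + real m * b"
      proof (cases "P \<le> Q")
        case True
        then show ?thesis
          by (intro exI[of _ "(K - k') * nat k"] exI[of _ "k' * nat h"]) (simp add: lo_def hi_def P_def Q_def min_def max_def mult.assoc)
      next
        case False
        then show ?thesis
          by (intro exI[of _ "k' * nat k"] exI[of _ "(K - k') * nat h"]) (simp add: lo_def hi_def P_def Q_def min_def max_def mult.assoc)
      qed
      ultimately show "\<exists>n m. x \<le> real n * a + real m * b \<and> real n * a + real m * b \<le> x + \<epsilon>"
        using k'' d by (metis add_left_mono less_imp_le order_trans)
    qed
  qed
qed

section \<open>Upper limits of solutions\<close>

context nonlattice_renewal begin

text \<open>A walk from \<open>i\<close> to \<open>j\<close> through \<open>p\<close> and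
  \<open>q\<close> can be lengthened by any combination of the two incommensurable loops. As there
  are finitely many pairs of types, one bound \<open>X\<close> serves them all.\<close>

lemma walks_eventually_dense:
  assumes e: "0 < \<epsilon>"
  obtains X where "\<And>i j x. X \<le> x \<Longrightarrow> \<exists>y. x \<le> y \<and> y \<le> x + \<epsilon> \<and> walk_length E src tgt len i j y"
proof -
  obtain p q a b where pq: "walk_length E src tgt len p p a" "walk_length E src tgt len q q b"
    and b: "0 < b" and irr: "a \<notin> {b * x | x. x \<in> \<rat>}"
    using nonlattice by blast
  obtain X where X: "\<And>x. X \<le> x \<Longrightarrow> \<exists>n m. x \<le> real n * a + real m * b \<and> real n * a + real m * b \<le> x + \<epsilon>"
    using eventually_dense_combinations[OF walk_nonneg[OF pq(1)] b irr e] by metis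
  have "\<exists>d. \<forall>x. X \<le> x \<longrightarrow> (\<exists>y. x + d \<le> y \<and> y \<le> x + d + \<epsilon> \<and> walk_length E src tgt len i j y)" for i j
  proof -
    obtain d1 d2 d3 where d: "walk_length E src tgt len i p d1" "walk_length E src tgt len p q d2" "walk_length E src tgt len q j d3"
      using connected by metis
    show ?thesis
    proof (rule exI[of _ "d1 + d2 + d3"], intro allI impI)
      fix x assume "X \<le> x"
      then obtain n m where nm: "x \<le> real n * a + real m * b" "real n * a + real m * b \<le> x + \<epsilon>" using X by blast
      have "walk_length E src tgt len i j (((d1 + real n * a) + d2 + real m * b) + d3)"
        by (intro walk_append[OF walk_append[OF walk_append[OF walk_append[OF d(1) walk_repeat[OF pq(1)]] d(2)] walk_repeat[OF pq(2)]] d(3)])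
      then show "\<exists>y. x + (d1 + d2 + d3) \<le> y \<and> y \<le> x + (d1 + d2 + d3) + \<epsilon> \<and> walk_length E src tgt len i j y"
        using nm by (intro exI[of _ "((d1 + real n * a) + d2 + real m * b) + d3"]) (auto simp: algebra_simps)
    qed
  qed
  then obtain d where d: "\<And>i j x. X \<le> x \<Longrightarrow> \<exists>y. x + d i j \<le> y \<and> y \<le> x + d i j + \<epsilon> \<and> walk_length E src tgt len i j y"
    by metis
  define M where "M = Max (range (\<lambda>(i, j). d i j))"
  have M: "d i j \<le> M" for i j
    unfolding M_def by (intro Max_ge finite_imageI finite) (auto intro!: image_eqI[of _ _ "(i, j)"])
  show ?thesis
  proof (rule that[of "X + M"])
    fix i j x assume "X + M \<le> x"
    then show "\<exists>y. x \<le> y \<and> y \<le> x + \<epsilon> \<and> walk_length E src tgt len i j y"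
      using d[of "x - d i j" i j] M[of i j] by auto
  qed
qed

text \<open>If \<open>\<alpha>\<close> is the upper limit of a solution, the solution is close to \<open>\<alpha>\<close> on
  arbitrarily long time windows, by the maximum principle along the dense set of walk lengths.
  The conserved window integral then determines \<open>\<alpha>\<close>.\<close>

lemma limsup_value:
  assumes u: "solves g u" and c: "\<And>i. continuous_on UNIV (g i)"
    and z: "\<And>i t. t \<le> 0 \<or> B \<le> t \<Longrightarrow> g i t = 0" and B: "0 \<le> B"
    and v: "stationary v" and G: "\<And>i. (g i has_integral G i) {0..B}"
    and upper: "\<And>\<eta>. 0 < \<eta> \<Longrightarrow> \<exists>T. \<forall>t\<ge>T. \<forall>i. u i t \<le> \<alpha> + \<eta>"
    and lower: "\<And>\<eta> T. 0 < \<eta> \<Longrightarrow> \<exists>t\<ge>T. \<exists>i. \<alpha> - \<eta> < u i t"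
  shows "(\<Sum>i\<in>UNIV. v i * G i) = \<alpha> * drift v"
proof -
  define C where "C = (\<Sum>e\<in>E. \<bar>v (src e)\<bar> * wt e * len e)"
  have bound: "\<bar>(\<Sum>i\<in>UNIV. v i * G i) - \<alpha> * drift v\<bar> \<le> \<epsilon> * C" if e: "0 < \<epsilon>" for \<epsilon>
  proof -
    have e2: "0 < \<epsilon> / 2" using e by simp
    obtain h where h: "0 < h" "\<And>i s t. \<bar>s - t\<bar> \<le> h \<Longrightarrow> \<bar>u i s - u i t\<bar> \<le> \<epsilon> / 2"
      using solution_uniformly_continuous[OF u c z B e2] by metis
    obtain X0 where X0: "\<And>i j x. X0 \<le> x \<Longrightarrow> \<exists>y. x \<le> y \<and> y \<le> x + h \<and> walk_length E src tgt len i j y"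
      using walks_eventually_dense[OF h(1)] by blast
    define X where "X = max X0 0"
    \<comment> \<open>The maximal length of a walk from the near-maximal point at time
      \<open>t\<close> into the window [t - X - longest, t - X].\<close>
    define Y where "Y = X + longest + h"
    have Y: "0 \<le> Y" using h longest_pos by (simp add: Y_def X_def)
    \<comment> \<open>The maximum principle multiplies the deficit 2 \<eta> by at most exp (rate *
      Y), and the product has to stay below \<epsilon> / 2.\<close>
    define \<eta> where "\<eta> = min \<epsilon> (\<epsilon> / (4 * exp (rate * Y)))"
    have \<eta>: "0 < \<eta>" "\<eta> \<le> \<epsilon>" using e by (auto simp: \<eta>_def)
    have \<eta>2: "exp (rate * Y) * (2 * \<eta>) \<le> \<epsilon> / 2"
    proof -
      have "\<eta> \<le> \<epsilon> / (4 * exp (rate * Y))" by (simp add: \<eta>_def)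
      then show ?thesis by (simp add: field_simps)
    qed
    obtain T0 where T0: "\<And>t i. T0 \<le> t \<Longrightarrow> u i t \<le> \<alpha> + \<eta>" using upper[OF \<eta>(1)] by blast
    define T where "T = max T0 B + longest + 1"
    obtain t i where t: "T + Y \<le> t" and i: "\<alpha> - \<eta> < u i t" using lower[OF \<eta>(1)] by blast
    have TB: "B < T" "0 \<le> T" "T0 \<le> T - longest" using B longest_pos by (auto simp: T_def)
    \<comment> \<open>The deficit below an eventual upper bound: nonnegative at late times, and
      harmonic because the source has died out and the weights sum to 1.\<close>
    define D where "D i s = \<alpha> + \<eta> - u i s" for i s
    have D_nonneg: "0 \<le> D j s" if "T - longest \<le> s" for j s
      using T0[of s j] that TB by (simp add: D_def)
    have D_harm: "D j s = avg j (\<lambda>e. D (tgt e) (s - len e))" if "T \<le> s" for j s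
    proof -
      have "u j s = avg j (\<lambda>e. u (tgt e) (s - len e))"
        using solvesD[OF u, of s j] z[of s j] that TB by simp
      then show ?thesis
        by (simp add: D_def right_diff_distrib sum_subtractf sum_distrib_right[symmetric] wt_out)
    qed
    have window: "\<bar>u j s - \<alpha>\<bar> \<le> \<epsilon>" if s: "t - X - longest \<le> s" "s \<le> t - X" for j s
    proof -
      \<comment> \<open>A walk length within \<open>h\<close> of t - s; uniform continuity absorbs
        the mismatch.\<close>
      obtain y where y: "t - s \<le> y" "y \<le> t - s + h" "walk_length E src tgt len i j y"
      proof -
        have "X0 \<le> t - s" using s by (simp add: X_def)
        then show ?thesis using X0 that by blast
      qed
      have yY: "y \<le> Y" using y s by (simp add: Y_def)
      have "D j (t - y) \<le> exp (rate * y) * D i t"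
        by (rule harmonic_along_walk[OF y(3), of T D]) (use D_nonneg D_harm yY t in auto)
      also have "\<dots> \<le> exp (rate * Y) * (2 * \<eta>)"
        using yY rate_nonneg i D_nonneg[of t i] t Y longest_pos by (intro mult_mono) (auto simp: D_def mult_left_mono)
      also have "\<dots> \<le> \<epsilon> / 2" by (rule \<eta>2)
      finally have "\<alpha> + \<eta> - \<epsilon> / 2 \<le> u j (t - y)" by (simp add: D_def)
      moreover have "\<bar>u j s - u j (t - y)\<bar> \<le> \<epsilon> / 2" using y by (intro h) auto
      moreover have "u j s \<le> \<alpha> + \<eta>" using s t TB h longest_pos by (intro T0) (simp add: Y_def)
      ultimately show ?thesis using \<eta> by linarith
    qed
    show ?thesis unfolding C_def
      by (rule window_conserved[OF u c z B v G _ window]) (use t TB Y h longest_pos in \<open>auto simp: Y_def\<close>)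
  qed
  have C: "0 \<le> C" unfolding C_def using wt_pos len_pos by (intro sum_nonneg) (simp add: less_imp_le)
  have "\<bar>(\<Sum>i\<in>UNIV. v i * G i) - \<alpha> * drift v\<bar> \<le> 0"
  proof (rule field_le_epsilon)
    fix \<delta> :: real assume d: "0 < \<delta>"
    have "\<delta> / (C + 1) * C \<le> \<delta>" using d C by (simp add: field_simps)
    moreover have "0 < \<delta> / (C + 1)" using d C by simp
    ultimately show "\<bar>(\<Sum>i\<in>UNIV. v i * G i) - \<alpha> * drift v\<bar> \<le> 0 + \<delta>"
      using bound[of "\<delta> / (C + 1)"] by linarith
  qed
  then show ?thesis by simp
qed

text \<open>\<alpha> is the upper limit of \<open>u\<close> over all types at once, obtained as the
  infimum of the eventual upper bounds. The lower limit will be covered by applying this to -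
  u.\<close>

lemma eventual_upper_bound:
  assumes u: "solves g u" and c: "\<And>i. continuous_on UNIV (g i)"
    and z: "\<And>i t. t \<le> 0 \<or> B \<le> t \<Longrightarrow> g i t = 0" and B: "0 \<le> B"
    and v: "stationary v" and G: "\<And>i. (g i has_integral G i) {0..B}"
  obtains \<alpha> where "(\<Sum>i\<in>UNIV. v i * G i) = \<alpha> * drift v"
    "\<And>\<eta>. 0 < \<eta> \<Longrightarrow> \<exists>T. \<forall>t\<ge>T. \<forall>i. u i t \<le> \<alpha> + \<eta>"
proof -
  have "\<exists>M. \<forall>t. \<bar>g i t\<bar> \<le> M" for i
  proof -
    obtain M where M: "\<forall>t. 0 \<le> t \<and> t \<le> B \<longrightarrow> \<bar>g i t\<bar> \<le> M"
      using continuous_interval_bounded[OF c] by blast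
    have "\<bar>g i t\<bar> \<le> max M 0" for t
      using M[rule_format, of t] z[of t i] by (cases "0 \<le> t \<and> t \<le> B") auto
    then show ?thesis by blast
  qed
  then obtain M where M: "\<And>i t. \<bar>g i t\<bar> \<le> M i" by metis
  have "\<bar>g i t\<bar> \<le> Max (range M)" for i t
  proof -
    have "M i \<le> Max (range M)" by (intro Max_ge) auto
    then show ?thesis using M[of i t] by linarith
  qed
  then have bnd: "\<bar>u i t\<bar> \<le> Max (range M) * (B / gap + 1)" for i t
    by (rule solution_bound[OF u]) (use z B in auto)
  define K where "K = Max (range M) * (B / gap + 1)"
  define S where "S = {a. \<exists>T. \<forall>t\<ge>T. \<forall>i. u i t \<le> a}"
  have S: "S \<noteq> {}" "bdd_below S"
  proof -
    have "K \<in> S" using bnd by (auto simp: S_def K_def abs_le_iff)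
    then show "S \<noteq> {}" by blast
    have "- K \<le> a" if aS: "a \<in> S" for a
    proof -
      obtain T where "\<forall>t\<ge>T. \<forall>i. u i t \<le> a" using aS by (auto simp: S_def)
      then have "u undefined T \<le> a" by blast
      then show ?thesis using bnd[of undefined T] by (simp add: K_def abs_le_iff)
    qed
    then show "bdd_below S" by (auto simp: bdd_below_def)
  qed
  have up: "\<exists>T. \<forall>t\<ge>T. \<forall>i. u i t \<le> Inf S + \<eta>" if \<eta>: "0 < \<eta>" for \<eta>
  proof -
    obtain a where "a \<in> S" "a < Inf S + \<eta>" using cInf_lessD[OF S(1), of "Inf S + \<eta>"] \<eta> by auto
    then obtain T where T: "\<And>t i. T \<le> t \<Longrightarrow> u i t \<le> a" by (auto simp: S_def)
    have "u i t \<le> Inf S + \<eta>" if "T \<le> t" for t i using T[OF that, of i] \<open>a < Inf S + \<eta>\<close> by linarith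
    then show ?thesis by blast
  qed
  have lo: "\<exists>t\<ge>T. \<exists>i. Inf S - \<eta> < u i t" if "0 < \<eta>" for \<eta> T
  proof (rule ccontr)
    assume "\<not> ?thesis"
    then have "Inf S - \<eta> \<in> S" unfolding S_def by (auto simp: not_less)
    then show False using cInf_lower[OF _ S(2), of "Inf S - \<eta>"] that by simp
  qed
  show ?thesis using that[OF limsup_value[OF u c z B v G up lo] up] by blast
qed

end

text \<open>A continuous stand-in for the indicator of [p, q], with ramps of width \<open>h\<close>
  outside the interval, as the renewal theorem is first proved for continuous sources.\<close>

definition trapezoid :: "real \<Rightarrow> real \<Rightarrow> real \<Rightarrow> real \<Rightarrow> real" where
  "trapezoid h p q x = max 0 (min 1 (min ((x - p) / h + 1) ((q - x) / h + 1)))"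

lemma continuous_trapezoid: "h > 0 \<Longrightarrow> continuous_on A (trapezoid h p q)"
  unfolding trapezoid_def by (intro continuous_intros) auto

lemma trapezoid_range: "0 \<le> trapezoid h p q x" "trapezoid h p q x \<le> 1"
  by (auto simp: trapezoid_def)

lemma trapezoid_eq_1: "h > 0 \<Longrightarrow> p \<le> x \<Longrightarrow> x \<le> q \<Longrightarrow> trapezoid h p q x = 1"
  by (auto simp: trapezoid_def max_def min_def)

lemma trapezoid_eq_0: assumes "h > 0" "x \<le> p - h \<or> q + h \<le> x" shows "trapezoid h p q x = 0"
proof -
  have "(x - p) / h + 1 \<le> 0 \<or> (q - x) / h + 1 \<le> 0"
    using assms by (auto simp: field_simps)
  then show ?thesis by (auto simp: trapezoid_def)
qed

lemma trapezoid_integral: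
  fixes a :: "real \<Rightarrow> real"
  assumes h: "0 < h" "h \<le> 1" and a: "continuous_on UNIV a" and l: "p \<le> q"
    and A: "\<And>x. p - 1 \<le> x \<Longrightarrow> x \<le> q + 1 \<Longrightarrow> \<bar>a x\<bar> \<le> A"
  shows "\<bar>integral {p - h..q + h} (\<lambda>x. a x * trapezoid h p q x) - integral {p..q} a\<bar> \<le> 2 * h * A"
proof -
  let ?f = "\<lambda>x. a x * trapezoid h p q x"
  have int: "?f integrable_on {x..y}" for x y
    by (intro integrable_continuous_interval continuous_intros continuous_on_subset[OF a] continuous_trapezoid h) auto
  have "integral {p - h..p} ?f + integral {p..q + h} ?f = integral {p - h..q + h} ?f"
    by (rule Henstock_Kurzweil_Integration.integral_combine) (use h l int in auto)
  moreover have "integral {p..q} ?f + integral {q..q + h} ?f = integral {p..q + h} ?f"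
    by (rule Henstock_Kurzweil_Integration.integral_combine) (use h l int in auto)
  moreover have "integral {p..q} ?f = integral {p..q} a"
    by (rule integral_cong) (use h in \<open>auto simp: trapezoid_eq_1\<close>)
  moreover have small: "\<bar>integral {x..x + h} ?f\<bar> \<le> A * (x + h - x)" if "p - 1 \<le> x" "x + h \<le> q + 1" for x
  proof -
    have "norm (integral {x..x + h} ?f) \<le> A * (x + h - x)"
    proof (rule integral_bound)
      fix t assume t: "t \<in> {x..x + h}"
      have "\<bar>a t\<bar> * trapezoid h p q t \<le> \<bar>a t\<bar>"
        using trapezoid_range[of h p q t] by (intro mult_left_le) auto
      also have "\<dots> \<le> A" using t that by (intro A) auto
      finally show "norm (?f t) \<le> A" using trapezoid_range[of h p q t] by (simp add: abs_mult)
    qed (use h in \<open>auto intro!: continuous_intros continuous_on_subset[OF a] continuous_trapezoid\<close>)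
    then show ?thesis by simp
  qed
  moreover have "\<bar>integral {p - h..p} ?f\<bar> \<le> A * h" using small[of "p - h"] h l by simp
  moreover have "\<bar>integral {q..q + h} ?f\<bar> \<le> A * h" using small[of q] h l by simp
  ultimately show ?thesis by (simp add: mult.commute)
qed

section \<open>The renewal theorem\<close>

context nonlattice_renewal begin

text \<open>With zero drift the conserved integral would force the weighted sum of the
  \<open>G i\<close> to vanish for every source; a bump placed at the single type \<open>j\<close>
  contradicts this.\<close>

lemma drift_nonzero:
  assumes v: "stationary v" and nz: "v j \<noteq> 0"
  shows "drift v \<noteq> 0"
proof
  assume d: "drift v = 0"
  let ?b = "trapezoid 1 1 2"
  define g where "g i t = (if i = j then ?b t else 0)" for i t
  define G where "G i = integral {0..3} (g i)" for i
  have c: "continuous_on UNIV (g i)" for i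
    unfolding g_def by (cases "i = j") (auto intro!: continuous_intros continuous_trapezoid)
  have z: "g i t = 0" if "t \<le> 0 \<or> 3 \<le> t" for i t
    using trapezoid_eq_0[of 1 t 1 2] that by (auto simp: g_def)
  have G: "(g i has_integral G i) {0..3}" for i
    unfolding G_def by (intro integrable_integral integrable_continuous_interval continuous_on_subset[OF c]) auto
  obtain a where "(\<Sum>i\<in>UNIV. v i * G i) = a * drift v"
    using eventual_upper_bound[OF solves_renewal[of g] c z zero_le_numeral v G] by metis
  then have "(\<Sum>i\<in>UNIV. v i * G i) = 0" using d by simp
  moreover have "(\<Sum>i\<in>UNIV. v i * G i) = v j * integral {0..3} ?b"
  proof -
    have Gi: "G i = (if i = j then integral {0..3} ?b else 0)" for i
    proof -
      have "g i = (if i = j then ?b else (\<lambda>_. 0))" by (auto simp: g_def)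
      then show ?thesis by (simp add: G_def)
    qed
    have "(\<Sum>i\<in>UNIV. v i * G i) = (\<Sum>i\<in>UNIV. if i = j then v j * integral {0..3} ?b else 0)"
      by (intro sum.cong) (auto simp: Gi)
    then show ?thesis by simp
  qed
  moreover have "0 < integral {0..3} ?b"
  proof -
    have "1 = integral {1..2} (\<lambda>x::real. 1::real)" by simp
    also have "\<dots> = integral {1..2} ?b"
      by (rule integral_cong) (simp add: trapezoid_eq_1)
    also have "\<dots> \<le> integral {0..3} ?b"
      by (intro integral_subset_le integrable_continuous_interval continuous_trapezoid)
         (auto simp: trapezoid_range)
    finally show ?thesis by simp
  qed
  ultimately show False using nz by simp
qed

text \<open>The upper limits of u and of - u satisfy the same linear equation up to sign, with the
  nonzero coefficient \<open>drift v\<close>. Hence the upper and the lower limit of u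
  agree.\<close>

lemma renewal_theorem_continuous:
  assumes u: "solves g u" and c: "\<And>i. continuous_on UNIV (g i)"
    and z: "\<And>i t. t \<le> 0 \<or> B \<le> t \<Longrightarrow> g i t = 0" and B: "0 \<le> B"
    and v: "stationary v" "v j \<noteq> 0" and G: "\<And>i. (g i has_integral G i) {0..B}" and e: "0 < \<epsilon>"
  shows "\<forall>\<^sub>F t in at_top. \<forall>i. \<bar>u i t - (\<Sum>i\<in>UNIV. v i * G i) / drift v\<bar> \<le> \<epsilon>"
proof -
  note d = drift_nonzero[OF v]
  obtain a where a: "(\<Sum>i\<in>UNIV. v i * G i) = a * drift v" "\<exists>T. \<forall>t\<ge>T. \<forall>i. u i t \<le> a + \<epsilon>"
    using eventual_upper_bound[OF u c z B v(1) G] e by metis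
  obtain b where b: "(\<Sum>i\<in>UNIV. v i * - G i) = b * drift v" "\<exists>T. \<forall>t\<ge>T. \<forall>i. - u i t \<le> b + \<epsilon>"
  proof -
    have "continuous_on UNIV (\<lambda>t. - g i t)" for i by (intro continuous_intros c)
    moreover have "((\<lambda>t. - g i t) has_integral - G i) {0..B}" for i by (rule has_integral_neg[OF G])
    ultimately show ?thesis
      using eventual_upper_bound[OF solves_uminus[OF u], of B v "\<lambda>i. - G i"] z B v e that by (metis neg_equal_0_iff_equal)
  qed
  have ab: "a = (\<Sum>i\<in>UNIV. v i * G i) / drift v" "b = - a"
  proof -
    show "a = (\<Sum>i\<in>UNIV. v i * G i) / drift v" using a(1) d by simp
    have "b * drift v = - a * drift v" using a(1) b(1) by (simp add: sum_negf)
    then have "(b + a) * drift v = 0" by (simp add: algebra_simps)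
    then show "b = - a" using d by simp
  qed
  obtain T1 T2 where T: "\<And>t i. T1 \<le> t \<Longrightarrow> u i t \<le> a + \<epsilon>" "\<And>t i. T2 \<le> t \<Longrightarrow> - u i t \<le> b + \<epsilon>"
    using a(2) b(2) by metis
  have near: "\<bar>u i t - a\<bar> \<le> \<epsilon>" if "max T1 T2 \<le> t" for i t
    using T(1)[of t i] T(2)[of t i] that ab(2) by (simp add: abs_le_iff)
  show ?thesis unfolding ab(1)[symmetric] eventually_at_top_linorder using near by blast
qed

text \<open>The source produced by stopping: an edge longer than the remaining time \<open>t\<close>
  ends the walk and pays \<open>a e t\<close>. It may jump at t = 0 and at t = len e.\<close>

definition jump :: "('e \<Rightarrow> real \<Rightarrow> real) \<Rightarrow> 'n \<Rightarrow> real \<Rightarrow> real" where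
  "jump a i t = (\<Sum>e\<in>out i. if 0 \<le> t \<and> t < len e then a e t else 0)"

text \<open>The jumps of the inhomogeneity are handled by sandwiching the indicators between
  trapezoids; the upper one needs a time shift since it has to vanish for negative times.\<close>

theorem renewal_theorem:
  assumes u: "solves (jump a) u" and a: "\<And>e. e \<in> E \<Longrightarrow> continuous_on UNIV (a e)"
    and a0: "\<And>e t. e \<in> E \<Longrightarrow> 0 \<le> a e t"
    and v: "stationary v" "v j \<noteq> 0" and eps: "0 < \<epsilon>"
  shows "\<forall>\<^sub>F t in at_top. \<forall>i. \<bar>u i t - (\<Sum>e\<in>E. v (src e) * integral {0..len e} (a e)) / drift v\<bar> \<le> \<epsilon>"
proof -
  note d = drift_nonzero[OF v]
  define Z where "Z = (\<Sum>e\<in>E. v (src e) * integral {0..len e} (a e))"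
  have "\<exists>A. \<forall>x. -1 \<le> x \<and> x \<le> longest + 1 \<longrightarrow> \<bar>a e x\<bar> \<le> A" if "e \<in> E" for e
    by (rule continuous_interval_bounded[OF a[OF that]])
  then obtain A where A: "\<And>e x. e \<in> E \<Longrightarrow> -1 \<le> x \<Longrightarrow> x \<le> longest + 1 \<Longrightarrow> \<bar>a e x\<bar> \<le> A e" by metis
  have A0: "0 \<le> A e" if "e \<in> E" for e using A[OF that, of 0] longest_pos by simp
  \<comment> \<open>Factor 4: the upper trapezoid errs on two ramps, the lower one on two ramps and
    two cut-off ends, each by at most h * A e.\<close>
  define C where "C = (\<Sum>e\<in>E. \<bar>v (src e)\<bar> * (4 * A e))"
  have C: "0 \<le> C" unfolding C_def using A0 by (intro sum_nonneg) auto
  \<comment> \<open>h <= gap / 4 keeps the shrunk intervals [h, len e - h] nonempty; the last term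
    makes the error of the limits at most \<epsilon> / 2.\<close>
  define h where "h = min (min 1 (gap / 4)) (\<epsilon> / 2 * \<bar>drift v\<bar> / (C + 1))"
  have h: "0 < h" "h \<le> 1" "h \<le> gap / 4" "h \<le> \<epsilon> / 2 * \<bar>drift v\<bar> / (C + 1)"
  proof -
    have "0 < \<epsilon> / 2 * \<bar>drift v\<bar> / (C + 1)" using eps d C by (intro divide_pos_pos mult_pos_pos) auto
    then show "0 < h" using gap_pos by (simp add: h_def)
  qed (unfold h_def, linarith+)
  have hC: "h * C / \<bar>drift v\<bar> \<le> \<epsilon> / 2"
  proof -
    have "h * (C + 1) \<le> \<epsilon> / 2 * \<bar>drift v\<bar>" using h(4) C by (subst (asm) pos_le_divide_eq) auto
    then have "h * C \<le> \<epsilon> / 2 * \<bar>drift v\<bar>" using h(1) by (simp add: distrib_left)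
    then show ?thesis using d by (simp add: divide_le_eq)
  qed
  define B where "B = longest + 2"
  have B: "0 \<le> B" using longest_pos by (simp add: B_def)
  define gu where "gu i t = (\<Sum>e\<in>out i. a e (t - h) * trapezoid h 0 (len e) (t - h))" for i t
  define gl where "gl i t = (\<Sum>e\<in>out i. a e t * trapezoid h h (len e - h) t)" for i t
  have cu: "continuous_on UNIV (gu i)" for i
    unfolding gu_def
    by (intro continuous_intros continuous_on_compose2[OF a, of _ UNIV] continuous_on_compose2[OF continuous_trapezoid[OF h(1)], of UNIV] out_E) auto
  have cl: "continuous_on UNIV (gl i)" for i
    unfolding gl_def by (intro continuous_intros a out_E continuous_trapezoid h) auto
  have hl: "2 * h < len e" if "e \<in> E" for e using gap_le[OF that] h gap_pos by linarith
  have zu: "gu i t = 0" if "t \<le> 0 \<or> B \<le> t" for i t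
    unfolding gu_def
  proof (intro sum.neutral ballI)
    fix e assume e: "e \<in> out i"
    have "trapezoid h 0 (len e) (t - h) = 0"
      using that le_longest[OF out_E[OF e]] h by (intro trapezoid_eq_0) (auto simp: B_def)
    then show "a e (t - h) * trapezoid h 0 (len e) (t - h) = 0" by simp
  qed
  have zl: "gl i t = 0" if "t \<le> 0 \<or> B \<le> t" for i t
    unfolding gl_def
  proof (intro sum.neutral ballI)
    fix e assume e: "e \<in> out i"
    have "trapezoid h h (len e - h) t = 0"
      using that le_longest[OF out_E[OF e]] h by (intro trapezoid_eq_0) (auto simp: B_def)
    then show "a e t * trapezoid h h (len e - h) t = 0" by simp
  qed
  define Gu where "Gu e = integral {0 - h..len e + h} (\<lambda>x. a e x * trapezoid h 0 (len e) x)" for e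
  define Gl where "Gl e = integral {h - h..len e - h + h} (\<lambda>x. a e x * trapezoid h h (len e - h) x)" for e
  have int: "(\<lambda>x. a e x * trapezoid h p q x) integrable_on {x..y}" if "e \<in> E" for e p q x y
    by (intro integrable_continuous_interval continuous_intros continuous_on_subset[OF a[OF that]] continuous_trapezoid h) auto
  have Gu: "(gu i has_integral (\<Sum>e\<in>out i. Gu e)) {0..B}" for i
    unfolding gu_def
  proof (intro has_integral_sum finite_out)
    fix e assume e: "e \<in> out i"
    have "((\<lambda>x. a e x * trapezoid h 0 (len e) x) has_integral Gu e) {-h..B - h}"
      by (rule has_integral_on_superset[of _ _ "{0 - h..len e + h}"], unfold Gu_def, rule integrable_integral[OF int])
         (use out_E[OF e] le_longest[OF out_E[OF e]] h in \<open>auto simp: B_def trapezoid_eq_0\<close>)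
    from has_integral_affinity[OF this[folded cbox_interval], of 1 "- h"]
    show "((\<lambda>t. a e (t - h) * trapezoid h 0 (len e) (t - h)) has_integral Gu e) {0..B}" by simp
  qed
  have Gl: "(gl i has_integral (\<Sum>e\<in>out i. Gl e)) {0..B}" for i
    unfolding gl_def
  proof (intro has_integral_sum finite_out)
    fix e assume e: "e \<in> out i"
    show "((\<lambda>x. a e x * trapezoid h h (len e - h) x) has_integral Gl e) {0..B}"
      by (rule has_integral_on_superset[of _ _ "{h - h..len e - h + h}"], unfold Gl_def, rule integrable_integral[OF int])
         (use out_E[OF e] le_longest[OF out_E[OF e]] h in \<open>auto simp: B_def trapezoid_eq_0\<close>)
  qed
  have Gu_close: "\<bar>Gu e - integral {0..len e} (a e)\<bar> \<le> h * (4 * A e)" if e: "e \<in> E" for e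
  proof -
    have "\<bar>Gu e - integral {0..len e} (a e)\<bar> \<le> 2 * h * A e"
      unfolding Gu_def by (rule trapezoid_integral[OF h(1,2) a[OF e]]) (use A[OF e] len_pos[OF e] le_longest[OF e] in auto)
    also have "\<dots> \<le> h * (4 * A e)" using h A0[OF e] by simp
    finally show ?thesis .
  qed
  have Gl_close: "\<bar>Gl e - integral {0..len e} (a e)\<bar> \<le> h * (4 * A e)" if e: "e \<in> E" for e
  proof -
    have ai: "a e integrable_on {x..y}" for x y
      by (intro integrable_continuous_interval continuous_on_subset[OF a[OF e]]) auto
    have 1: "\<bar>Gl e - integral {h..len e - h} (a e)\<bar> \<le> 2 * h * A e"
      unfolding Gl_def by (rule trapezoid_integral[OF h(1,2) a[OF e]])
        (use A[OF e] hl[OF e] le_longest[OF e] h in auto)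
    have "integral {0..h} (a e) + integral {h..len e} (a e) = integral {0..len e} (a e)"
      by (rule Henstock_Kurzweil_Integration.integral_combine) (use h hl[OF e] ai in auto)
    moreover have "integral {h..len e - h} (a e) + integral {len e - h..len e} (a e) = integral {h..len e} (a e)"
      by (rule Henstock_Kurzweil_Integration.integral_combine) (use h hl[OF e] ai in auto)
    moreover have small: "\<bar>integral {x..y} (a e)\<bar> \<le> A e * (y - x)" if "0 \<le> x" "x \<le> y" "y \<le> len e" for x y
    proof -
      have "norm (integral {x..y} (a e)) \<le> A e * (y - x)"
        by (rule integral_bound) (use that A[OF e] le_longest[OF e] in \<open>auto intro: continuous_on_subset[OF a[OF e]]\<close>)
      then show ?thesis by simp
    qed
    moreover have "\<bar>integral {0..h} (a e)\<bar> \<le> A e * h" using small[of 0 h] h hl[OF e] by simp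
    moreover have "\<bar>integral {len e - h..len e} (a e)\<bar> \<le> A e * h" using small[of "len e - h" "len e"] h hl[OF e] by simp
    ultimately have "\<bar>Gl e - integral {0..len e} (a e)\<bar> \<le> 2 * h * A e + A e * h + A e * h"
      using 1 by linarith
    then show ?thesis by (simp add: algebra_simps)
  qed
  have close: "\<bar>(\<Sum>i\<in>UNIV. v i * (\<Sum>e\<in>out i. G e)) / drift v - Z / drift v\<bar> \<le> \<epsilon> / 2"
    if G: "\<And>e. e \<in> E \<Longrightarrow> \<bar>G e - integral {0..len e} (a e)\<bar> \<le> h * (4 * A e)" for G
  proof -
    have eq: "(\<Sum>i\<in>UNIV. v i * (\<Sum>e\<in>out i. G e)) = (\<Sum>e\<in>E. v (src e) * G e)"
      unfolding sum_E_out by (simp add: sum_distrib_left out_src)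
    have "\<bar>(\<Sum>e\<in>E. v (src e) * G e) - Z\<bar> = \<bar>\<Sum>e\<in>E. v (src e) * (G e - integral {0..len e} (a e))\<bar>"
      by (simp add: Z_def right_diff_distrib sum_subtractf)
    also have "\<dots> \<le> (\<Sum>e\<in>E. \<bar>v (src e)\<bar> * (h * (4 * A e)))"
      by (rule order.trans[OF sum_abs], rule sum_mono) (auto simp: abs_mult intro!: mult_left_mono G)
    also have "\<dots> = h * C" by (simp add: C_def sum_distrib_left mult_ac)
    finally have "\<bar>(\<Sum>e\<in>E. v (src e) * G e) - Z\<bar> / \<bar>drift v\<bar> \<le> h * C / \<bar>drift v\<bar>"
      by (rule divide_right_mono) simp
    then have "\<bar>(\<Sum>e\<in>E. v (src e) * G e) - Z\<bar> / \<bar>drift v\<bar> \<le> \<epsilon> / 2" using hC by linarith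
    then show ?thesis unfolding eq by (simp add: diff_divide_distrib[symmetric] abs_divide del: divide_le_eq_numeral1 le_divide_eq_numeral1)
  qed
  have e2: "0 < \<epsilon> / 2" using eps by simp
  have lower: "renewal gl i t \<le> u i t" for i t
  proof -
    have "0 \<le> u i t - renewal gl i t"
    proof (rule nonneg_if_superharmonic[where w = "\<lambda>i t. u i t - renewal gl i t"])
      fix i t assume t: "(0::real) \<le> t"
      have "gl i t \<le> jump a i t"
        unfolding gl_def jump_def
      proof (rule sum_mono)
        fix e assume e: "e \<in> out i"
        show "a e t * trapezoid h h (len e - h) t \<le> (if 0 \<le> t \<and> t < len e then a e t else 0)"
          using t trapezoid_eq_0[of h t h "len e - h"] h trapezoid_range[of h h "len e - h" t] a0[OF out_E[OF e]]
          by (auto intro: mult_left_le)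
      qed
      then show "avg i (\<lambda>e. u (tgt e) (t - len e) - renewal gl (tgt e) (t - len e)) \<le> u i t - renewal gl i t"
        using solvesD[OF u t, of i] solvesD[OF solves_renewal t, of gl i]
        by (simp add: right_diff_distrib sum_subtractf)
    qed (simp add: solvesD_neg[OF u] solvesD_neg[OF solves_renewal])
    then show ?thesis by simp
  qed
  \<comment> \<open>The upper source runs \<open>h\<close> late, so times t + h and t are compared.
    For t < 0 the claim is the nonnegativity of the upper solution.\<close>
  have upper: "u i t \<le> renewal gu i (t + h)" for i t
  proof -
    have nn: "0 \<le> renewal gu i t" for i t
    proof (rule nonneg_if_superharmonic[where w = "renewal gu"])
      fix i t assume t: "(0::real) \<le> t"
      have "0 \<le> gu i t" unfolding gu_def using a0[OF out_E] trapezoid_range by (intro sum_nonneg) auto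
      then show "avg i (\<lambda>e. renewal gu (tgt e) (t - len e)) \<le> renewal gu i t"
        using solvesD[OF solves_renewal t, of gu i] by simp
    qed (simp add: solvesD_neg[OF solves_renewal])
    have "0 \<le> renewal gu i (t + h) - u i t"
    proof (rule nonneg_if_superharmonic[where w = "\<lambda>i t. renewal gu i (t + h) - u i t"])
      fix i t assume t: "(0::real) \<le> t"
      have th: "0 \<le> t + h" using t h by simp
      have "jump a i t \<le> gu i (t + h)"
        unfolding gu_def jump_def
      proof (rule sum_mono)
        fix e assume e: "e \<in> out i"
        show "(if 0 \<le> t \<and> t < len e then a e t else 0) \<le> a e (t + h - h) * trapezoid h 0 (len e) (t + h - h)"
          using trapezoid_eq_1[of h 0 t "len e"] h trapezoid_range[of h 0 "len e" t] a0[OF out_E[OF e]]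
          by auto
      qed
      then show "avg i (\<lambda>e. renewal gu (tgt e) (t - len e + h) - u (tgt e) (t - len e)) \<le> renewal gu i (t + h) - u i t"
        using solvesD[OF u t, of i] solvesD[OF solves_renewal th, of gu i]
        by (simp add: right_diff_distrib sum_subtractf algebra_simps)
    qed (simp add: solvesD_neg[OF u] nn)
    then show ?thesis by simp
  qed
  have lim_l: "\<forall>\<^sub>F t in at_top. \<forall>i. \<bar>renewal gl i t - (\<Sum>i\<in>UNIV. v i * (\<Sum>e\<in>out i. Gl e)) / drift v\<bar> \<le> \<epsilon> / 2"
    by (rule renewal_theorem_continuous[OF solves_renewal cl zl B v Gl e2])
  have "\<forall>\<^sub>F t in at_top. \<forall>i. \<bar>renewal gu i t - (\<Sum>i\<in>UNIV. v i * (\<Sum>e\<in>out i. Gu e)) / drift v\<bar> \<le> \<epsilon> / 2"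
    by (rule renewal_theorem_continuous[OF solves_renewal cu zu B v Gu e2])
  then obtain T where T: "\<And>t i. T \<le> t \<Longrightarrow> \<bar>renewal gu i t - (\<Sum>i\<in>UNIV. v i * (\<Sum>e\<in>out i. Gu e)) / drift v\<bar> \<le> \<epsilon> / 2"
    unfolding eventually_at_top_linorder by blast
  have "\<forall>\<^sub>F t in at_top. \<forall>i. \<bar>u i t - Z / drift v\<bar> \<le> \<epsilon>"
    using lim_l eventually_ge_at_top[of T]
  proof eventually_elim
    case (elim t)
    show ?case
    proof
      fix i
      have "\<bar>renewal gl i t - (\<Sum>i\<in>UNIV. v i * (\<Sum>e\<in>out i. Gl e)) / drift v\<bar> \<le> \<epsilon> / 2" using elim by blast
      moreover have "\<bar>renewal gu i (t + h) - (\<Sum>i\<in>UNIV. v i * (\<Sum>e\<in>out i. Gu e)) / drift v\<bar> \<le> \<epsilon> / 2"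
        using T[of "t + h"] elim h by simp
      ultimately show "\<bar>u i t - Z / drift v\<bar> \<le> \<epsilon>"
        using close[OF Gu_close] close[OF Gl_close] lower[of i t] upper[of i t] by linarith
    qed
  qed
  then show ?thesis unfolding Z_def .
qed

end

section \<open>Branching populations\<close>

lemma exp_le_quadratic:
  assumes "\<bar>x\<bar> \<le> (a::real)"
  shows "exp x \<le> 1 + x + x\<^sup>2 * exp a"
proof -
  obtain t where t: "\<bar>t\<bar> \<le> \<bar>x\<bar>" "exp x = (\<Sum>m<2. x ^ m / fact m) + exp t / fact 2 * x ^ 2"
    using Maclaurin_exp_le[of x 2] by blast
  have "exp t / fact 2 * x ^ 2 \<le> x\<^sup>2 * exp a"
  proof -
    have "exp t \<le> exp a" using t(1) assms by simp
    then have "exp t / 2 \<le> exp a" using exp_gt_zero[of t] by linarith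
    then have "exp t / 2 * x\<^sup>2 \<le> exp a * x\<^sup>2" by (rule mult_right_mono) simp
    then show ?thesis by (simp add: mult.commute)
  qed
  then show ?thesis using t(2) by (simp add: numeral_2_eq_2)
qed

lemma prod_list_mono:
  assumes "\<And>x. x \<in> set xs \<Longrightarrow> 0 \<le> f x" "\<And>x. x \<in> set xs \<Longrightarrow> f x \<le> (g x :: real)"
  shows "prod_list (map f xs) \<le> prod_list (map g xs)"
  using assms
proof (induction xs)
  case (Cons a xs)
  have "0 \<le> prod_list (map f xs)" using Cons.prems by (intro prod_list_nonneg) auto
  moreover have "0 \<le> g a" using Cons.prems order_trans[of 0 "f a" "g a"] by auto
  ultimately show ?case using Cons by (auto intro!: mult_mono)
qed simp

lemma prod_list_exp: "prod_list (map (\<lambda>x. exp (f x :: real)) xs) = exp (sum_list (map f xs))"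
  by (induction xs) (auto simp: exp_add)

text \<open>An element (l, j) of a rule is a child of type \<open>j\<close> born \<open>l\<close>
  time units after its parent. \<open>R_sum\<close> is conservation of volume, with exp (- l) the
  volume fraction of the child; it holds for every single rule, not just on average.\<close>

locale branching =
  fixes R :: "'n::finite \<Rightarrow> (real \<times> 'n) list list" and pr :: "'n \<Rightarrow> nat pmf"
  assumes pr_set: "set_pmf (pr i) = {..<length (R i)}"
    and R_pos: "\<rho> \<in> set (R i) \<Longrightarrow> x \<in> set \<rho> \<Longrightarrow> 0 < fst x"
    and R_sum: "\<rho> \<in> set (R i) \<Longrightarrow> (\<Sum>x\<leftarrow>\<rho>. exp (- fst x)) = 1"
begin

definition edges :: "('n \<times> nat \<times> nat) set" where
  "edges = {(i, k, q). k < length (R i) \<and> q < length (R i ! k)}"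

definition edge :: "'n \<times> nat \<times> nat \<Rightarrow> real \<times> 'n" where
  "edge e = R (fst e) ! fst (snd e) ! snd (snd e)"

text \<open>Probability of the rule times volume fraction of the child. This size bias replaces the
  branching population by a random walk on types, with total weight 1 at each vertex.\<close>

definition edge_wt :: "'n \<times> nat \<times> nat \<Rightarrow> real" where
  "edge_wt e = pmf (pr (fst e)) (fst (snd e)) * exp (- fst (edge e))"

lemma edges_from:
  "{e \<in> edges. fst e = i} = (\<lambda>(k, q). (i, k, q)) ` (SIGMA k:{..<length (R i)}. {..<length (R i ! k)})"
  by (auto simp: edges_def)

lemma finite_edges: "finite edges"
proof -
  have "edges = (\<Union>i. {e \<in> edges. fst e = i})" by auto
  also have "finite \<dots>" unfolding edges_from by (intro finite_UN_I) auto
  finally show ?thesis .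
qed

lemma sum_edges_from:
  "(\<Sum>e | e \<in> edges \<and> fst e = i. F e) = (\<Sum>k<length (R i). \<Sum>q<length (R i ! k). F (i, k, q))"
  unfolding edges_from by (subst sum.reindex) (auto simp: inj_on_def sum.Sigma case_prod_beta)

lemma sum_edges_from_list:
  "(\<Sum>e | e \<in> edges \<and> fst e = i. pmf (pr i) (fst (snd e)) * F (edge e)) =
     (\<Sum>k<length (R i). pmf (pr i) k * (\<Sum>x\<leftarrow>R i ! k. F x))"
  unfolding sum_edges_from edge_def
  by (simp add: sum_list_sum_nth atLeast0LessThan sum_distrib_left)

lemma sum_pr: "(\<Sum>k<length (R i). pmf (pr i) k) = 1"
  using sum_pmf_eq_1[of "{..<length (R i)}" "pr i"] by (simp add: pr_set)

lemma edge_in: "e \<in> edges \<Longrightarrow> \<exists>\<rho>\<in>set (R (fst e)). edge e \<in> set \<rho>"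
  by (intro bexI[of _ "R (fst e) ! fst (snd e)"]) (auto simp: edges_def edge_def)

sublocale markov_renewal edges fst "\<lambda>e. snd (edge e)" edge_wt "\<lambda>e. fst (edge e)"
proof
  show "finite edges" by (rule finite_edges)
  fix e assume e: "e \<in> edges"
  then show "0 < fst (edge e)" using edge_in R_pos by blast
  have "fst (snd e) \<in> set_pmf (pr (fst e))" using e by (auto simp: pr_set edges_def)
  then show "0 < edge_wt e" unfolding edge_wt_def by (simp add: pmf_positive)
next
  fix i
  have "(\<Sum>e | e \<in> edges \<and> fst e = i. edge_wt e) =
    (\<Sum>e | e \<in> edges \<and> fst e = i. pmf (pr i) (fst (snd e)) * exp (- fst (edge e)))"
    by (intro sum.cong) (auto simp: edge_wt_def)
  also have "\<dots> = (\<Sum>k<length (R i). pmf (pr i) k)"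
    unfolding sum_edges_from_list[where F = "\<lambda>x. exp (- fst x)"] by (intro sum.cong) (auto simp: R_sum[OF nth_mem])
  finally show "(\<Sum>e | e \<in> edges \<and> fst e = i. edge_wt e) = 1" by (simp add: sum_pr)
qed

lemma R_edge:
  assumes "k < length (R i)" "x \<in> set (R i ! k)"
  obtains e where "e \<in> out i" "x = edge e"
proof -
  obtain q where "q < length (R i ! k)" "x = R i ! k ! q" using assms(2) by (auto simp: in_set_conv_nth)
  moreover from this have "(i, k, q) \<in> edges" using assms(1) by (simp add: edges_def)
  ultimately show ?thesis using that[of "(i, k, q)"] by (simp add: out_def edge_def)
qed

lemma R_gap: "k < length (R i) \<Longrightarrow> x \<in> set (R i ! k) \<Longrightarrow> gap \<le> fst x"
  by (metis R_edge gap_le out_E)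

lemma R_longest: "k < length (R i) \<Longrightarrow> x \<in> set (R i ! k) \<Longrightarrow> fst x \<le> longest"
  by (metis R_edge le_longest out_E)

text \<open>For the population stopped at time \<open>t\<close>, started from one individual of type \<open>i\<close>:
  \<open>mean f i t\<close> is the expected sum of \<open>f j s\<close> over its members, where \<open>j\<close> is the type of a member
  and \<open>s < 0\<close> is \<open>t\<close> minus its birth time, and \<open>mgf h i t\<close> is the expected product of \<open>h j s\<close>.\<close>

function mean :: "('n \<Rightarrow> real \<Rightarrow> real) \<Rightarrow> 'n \<Rightarrow> real \<Rightarrow> real" where
  "mean f i t = (if t < 0 then f i t else
     (\<Sum>k<length (R i). pmf (pr i) k * (\<Sum>x\<leftarrow>R i ! k. mean f (snd x) (t - fst x))))"
  by auto
termination
proof (relation "Wellfounded.measure (\<lambda>(f, i, t). nat (\<lfloor>t / gap\<rfloor> + 1))", goal_cases)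
  case (2 f i t k x)
  then have "nat (\<lfloor>(t - fst x) / gap\<rfloor> + 1) < nat (\<lfloor>t / gap\<rfloor> + 1)"
    by (intro floor_decreases R_gap[of k i]) auto
  then show ?case by simp
qed simp

function mgf :: "('n \<Rightarrow> real \<Rightarrow> real) \<Rightarrow> 'n \<Rightarrow> real \<Rightarrow> real" where
  "mgf h i t = (if t < 0 then h i t else
     (\<Sum>k<length (R i). pmf (pr i) k * (\<Prod>x\<leftarrow>R i ! k. mgf h (snd x) (t - fst x))))"
  by auto
termination
proof (relation "Wellfounded.measure (\<lambda>(f, i, t). nat (\<lfloor>t / gap\<rfloor> + 1))", goal_cases)
  case (2 f i t k x)
  then have "nat (\<lfloor>(t - fst x) / gap\<rfloor> + 1) < nat (\<lfloor>t / gap\<rfloor> + 1)"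
    by (intro floor_decreases R_gap[of k i]) auto
  then show ?case by simp
qed simp

declare mean.simps [simp del] mgf.simps [simp del]

lemma mean_neg: "t < 0 \<Longrightarrow> mean f i t = f i t"
  and mgf_neg: "t < 0 \<Longrightarrow> mgf h i t = h i t"
  by (simp_all add: mean.simps mgf.simps)

lemma mean_nonneg_time: "0 \<le> t \<Longrightarrow> mean f i t =
     (\<Sum>k<length (R i). pmf (pr i) k * (\<Sum>x\<leftarrow>R i ! k. mean f (snd x) (t - fst x)))"
  and mgf_nonneg_time: "0 \<le> t \<Longrightarrow> mgf h i t =
     (\<Sum>k<length (R i). pmf (pr i) k * (\<Prod>x\<leftarrow>R i ! k. mgf h (snd x) (t - fst x)))"
  by (simp_all add: mean.simps[of _ _ t] mgf.simps[of _ _ t])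

lemma branch_induct:
  assumes neg: "\<And>i t. t < 0 \<Longrightarrow> P i t"
    and step: "\<And>i t. 0 \<le> t \<Longrightarrow> (\<And>k x. k < length (R i) \<Longrightarrow> x \<in> set (R i ! k) \<Longrightarrow> P (snd x) (t - fst x)) \<Longrightarrow> P i t"
  shows "P i t"
proof (induction i t rule: time_induct)
  case (2 i t)
  show ?case
  proof (rule step[OF 2(1)])
    fix k x assume "k < length (R i)" "x \<in> set (R i ! k)"
    then show "P (snd x) (t - fst x)" using R_edge 2(2) by metis
  qed
qed (rule neg)

lemma mgf_nonneg:
  assumes "\<And>i t. 0 \<le> h i t"
  shows "0 \<le> mgf h i t"
proof (induction i t rule: branch_induct)
  case (2 i t)
  show ?case unfolding mgf_nonneg_time[OF 2(1)]
    using 2(2) by (intro sum_nonneg mult_nonneg_nonneg prod_list_nonneg) auto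
qed (simp add: mgf_neg assms)

lemma mean_uminus: "mean (\<lambda>i t. - f i t) i t = - mean f i t"
proof (induction i t rule: branch_induct)
  case (2 i t)
  have "(\<Sum>x\<leftarrow>R i ! k. mean (\<lambda>i t. - f i t) (snd x) (t - fst x)) = - (\<Sum>x\<leftarrow>R i ! k. mean f (snd x) (t - fst x))"
    if "k < length (R i)" for k
    unfolding uminus_sum_list_map using 2(2)[OF that] by (simp add: comp_def cong: map_cong)
  then show ?case unfolding mean_nonneg_time[OF 2(1)] by (simp add: sum_negf)
qed (simp add: mean_neg)

text \<open>On a bounded time interval ln \<open>mgf\<close> is at most \<theta> * mean + K *
  \<theta>^2 with \<open>K\<close> independent of \<theta>; for small \<theta> the quadratic term is
  below \<theta> * \<epsilon>.\<close>

lemma mgf_le_mean: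
  assumes f: "\<And>i t. t < 0 \<Longrightarrow> \<bar>f i t\<bar> \<le> 1" and e: "0 < \<epsilon>"
  shows "\<exists>\<theta>>0. \<forall>i t. t < T \<longrightarrow> mgf (\<lambda>i t. exp (\<theta> * f i t)) i t \<le> exp (\<theta> * (mean f i t + \<epsilon>))"
proof -
  define N where "N = real (Max (insert 1 (length ` (\<Union>i. set (R i)))))"
  have N1: "1 \<le> N" unfolding N_def by (simp add: Max_ge)
  have N: "real (length (R i ! k)) \<le> N" if "k < length (R i)" for i k
  proof -
    have "length (R i ! k) \<in> insert 1 (length ` (\<Union>i. set (R i)))"
      using nth_mem[OF that] by blast
    then show ?thesis unfolding N_def of_nat_le_iff by (intro Max_ge) auto
  qed
  \<comment> \<open>\<open>K\<close> is the constant of the quadratic term and \<open>B\<close> a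
    bound for the means at times below n * \<open>gap\<close>; both may grow with
    \<open>n\<close>.\<close>
  define Q where "Q n K B \<longleftrightarrow> (\<forall>i t. t < real n * gap \<longrightarrow> \<bar>mean f i t\<bar> \<le> B \<and>
      (\<forall>\<theta>. 0 \<le> \<theta> \<and> \<theta> \<le> 1 \<longrightarrow> mgf (\<lambda>i t. exp (\<theta> * f i t)) i t \<le> exp (\<theta> * mean f i t + \<theta>\<^sup>2 * K)))" for n K B
  have Q: "\<exists>K B. 0 \<le> K \<and> 0 \<le> B \<and> Q n K B" for n
  proof (induction n)
    case 0
    show ?case by (intro exI[of _ 0] exI[of _ 1]) (use f in \<open>auto simp: Q_def mean_neg mgf_neg\<close>)
  next
    case (Suc n)
    then obtain K B where KB0: "0 \<le> K" "0 \<le> B" and Qn: "Q n K B" by blast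
    have KB: "0 \<le> K" "0 \<le> B" "\<And>i t. t < real n * gap \<Longrightarrow> \<bar>mean f i t\<bar> \<le> B"
      "\<And>i t \<theta>. t < real n * gap \<Longrightarrow> 0 \<le> \<theta> \<Longrightarrow> \<theta> \<le> 1 \<Longrightarrow> mgf (\<lambda>i t. exp (\<theta> * f i t)) i t \<le> exp (\<theta> * mean f i t + \<theta>\<^sup>2 * K)"
      using KB0 Qn unfolding Q_def by blast+
    \<comment> \<open>For \<theta> <= 1 the exponent of a product over children is at most \<theta>
      * A in absolute value. In \<open>K'\<close> the term N * K collects the quadratic terms of the
      children, and A^2 * exp A is the Taylor remainder.\<close>
    define A where "A = N * B + N * K"
    define K' where "K' = N * K + A\<^sup>2 * exp A"
    define B' where "B' = N * B + 1"
    have A: "0 \<le> A" unfolding A_def using N1 KB by simp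
    show ?case
      unfolding Q_def
    proof (rule exI[of _ K'], rule exI[of _ B'], intro conjI allI impI)
      show "0 \<le> K'" "0 \<le> B'" unfolding K'_def B'_def using N1 KB by auto
      fix i t assume t: "t < real (Suc n) * gap"
      define a where "a k = (\<Sum>x\<leftarrow>R i ! k. mean f (snd x) (t - fst x))" for k
      have sub: "t - fst x < real n * gap" if "k < length (R i)" "x \<in> set (R i ! k)" for k x
        using R_gap[OF that] t by (simp add: algebra_simps)
      have a: "\<bar>a k\<bar> \<le> N * B" if k: "k < length (R i)" for k
      proof -
        have "\<bar>a k\<bar> \<le> (\<Sum>x\<leftarrow>R i ! k. \<bar>mean f (snd x) (t - fst x)\<bar>)"
          unfolding a_def using sum_list_abs[of "map (\<lambda>x. mean f (snd x) (t - fst x)) (R i ! k)"] by (simp add: comp_def)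
        also have "\<dots> \<le> (\<Sum>x\<leftarrow>R i ! k. B)"
          by (intro sum_list_mono KB(3) sub[OF k])
        also have "\<dots> = real (length (R i ! k)) * B" by (simp add: sum_list_triv)
        also have "\<dots> \<le> N * B" using N[OF k] KB(2) by (rule mult_right_mono)
        finally show ?thesis .
      qed
      show "\<bar>mean f i t\<bar> \<le> B'"
      proof (cases "t < 0")
        case True
        then show ?thesis using f[OF True, of i] N1 KB by (simp add: mean_neg B'_def add.commute add_increasing2)
      next
        case False
        have "\<bar>mean f i t\<bar> = \<bar>\<Sum>k<length (R i). pmf (pr i) k * a k\<bar>"
          using False by (simp add: mean_nonneg_time a_def)
        also have "\<dots> \<le> (\<Sum>k<length (R i). pmf (pr i) k * (N * B))"
          by (rule order.trans[OF sum_abs], rule sum_mono) (auto simp: abs_mult a intro!: mult_left_mono)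
        also have "\<dots> = N * B" by (simp only: sum_distrib_right[symmetric] sum_pr)
        finally show ?thesis by (simp add: B'_def)
      qed
      fix \<theta> :: real assume \<theta>: "0 \<le> \<theta> \<and> \<theta> \<le> 1"
      let ?h = "\<lambda>i t. exp (\<theta> * f i t)"
      show "mgf ?h i t \<le> exp (\<theta> * mean f i t + \<theta>\<^sup>2 * K')"
      proof (cases "t < 0")
        case True
        have "0 \<le> \<theta>\<^sup>2 * K'" unfolding K'_def using N1 KB by simp
        then show ?thesis using True by (simp add: mgf_neg mean_neg)
      next
        case False
        have \<theta>2: "\<theta>\<^sup>2 \<le> \<theta>" using \<theta> by (simp add: power2_eq_square mult_left_le)
        have prod: "(\<Prod>x\<leftarrow>R i ! k. mgf ?h (snd x) (t - fst x)) \<le> 1 + \<theta> * a k + \<theta>\<^sup>2 * K'" if k: "k < length (R i)" for k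
        proof -
          have "\<bar>\<theta> * a k + \<theta>\<^sup>2 * (N * K)\<bar> \<le> \<theta> * \<bar>a k\<bar> + \<theta>\<^sup>2 * (N * K)"
            using \<theta> N1 KB(1) abs_triangle_ineq[of "\<theta> * a k" "\<theta>\<^sup>2 * (N * K)"] by (simp add: abs_mult)
          also have "\<dots> \<le> \<theta> * (N * B) + \<theta> * (N * K)"
            using a[OF k] \<theta> \<theta>2 N1 KB(1) by (intro add_mono mult_left_mono mult_right_mono) auto
          finally have exponent: "\<bar>\<theta> * a k + \<theta>\<^sup>2 * (N * K)\<bar> \<le> \<theta> * A" by (simp add: A_def distrib_left)
          have "(\<Prod>x\<leftarrow>R i ! k. mgf ?h (snd x) (t - fst x)) \<le> (\<Prod>x\<leftarrow>R i ! k. exp (\<theta> * mean f (snd x) (t - fst x) + \<theta>\<^sup>2 * K))"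
            using KB(4)[OF sub[OF k]] \<theta> by (intro prod_list_mono mgf_nonneg) auto
          also have "\<dots> = exp (\<theta> * a k + \<theta>\<^sup>2 * (real (length (R i ! k)) * K))"
            unfolding prod_list_exp a_def
            by (simp add: sum_list_addf sum_list_const_mult sum_list_triv mult_ac)
          also have "\<dots> \<le> exp (\<theta> * a k + \<theta>\<^sup>2 * (N * K))"
            using N[OF k] KB(1) by (simp add: mult_left_mono mult_right_mono)
          also have "\<dots> \<le> 1 + (\<theta> * a k + \<theta>\<^sup>2 * (N * K)) + (\<theta> * a k + \<theta>\<^sup>2 * (N * K))\<^sup>2 * exp A"
          proof (rule exp_le_quadratic)
            show "\<bar>\<theta> * a k + \<theta>\<^sup>2 * (N * K)\<bar> \<le> A"
              using exponent mult_right_mono[of \<theta> 1 A] \<theta> A by linarith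
          qed
          also have "\<dots> \<le> 1 + \<theta> * a k + \<theta>\<^sup>2 * K'"
          proof -
            have "(\<theta> * a k + \<theta>\<^sup>2 * (N * K))\<^sup>2 \<le> (\<theta> * A)\<^sup>2"
              using exponent A \<theta> by (simp add: abs_le_square_iff[symmetric] abs_mult)
            then have "(\<theta> * a k + \<theta>\<^sup>2 * (N * K))\<^sup>2 * exp A \<le> (\<theta> * A)\<^sup>2 * exp A"
              by (rule mult_right_mono) simp
            then show ?thesis by (simp add: K'_def power_mult_distrib algebra_simps)
          qed
          finally show ?thesis .
        qed
        have "mgf ?h i t \<le> (\<Sum>k<length (R i). pmf (pr i) k * (1 + \<theta> * a k + \<theta>\<^sup>2 * K'))"
          using False prod by (auto simp: mgf_nonneg_time intro!: sum_mono mult_left_mono)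
        also have "\<dots> = (\<Sum>k<length (R i). pmf (pr i) k) * (1 + \<theta>\<^sup>2 * K') + \<theta> * (\<Sum>k<length (R i). pmf (pr i) k * a k)"
          by (simp add: sum_distrib_left sum_distrib_right sum.distrib algebra_simps)
        also have "\<dots> = 1 + (\<theta> * mean f i t + \<theta>\<^sup>2 * K')"
          using False by (simp add: sum_pr mean_nonneg_time a_def)
        also have "\<dots> \<le> exp (\<theta> * mean f i t + \<theta>\<^sup>2 * K')" by (rule exp_ge_add_one_self)
        finally show ?thesis .
      qed
    qed
  qed
  obtain K B where K0: "0 \<le> K" and QK: "Q (nat \<lceil>T / gap\<rceil>) K B" using Q by blast
  have K: "0 \<le> K" "\<And>i t \<theta>. t < real (nat \<lceil>T / gap\<rceil>) * gap \<Longrightarrow> 0 \<le> \<theta> \<Longrightarrow> \<theta> \<le> 1 \<Longrightarrow>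
      mgf (\<lambda>i t. exp (\<theta> * f i t)) i t \<le> exp (\<theta> * mean f i t + \<theta>\<^sup>2 * K)"
    using K0 QK unfolding Q_def by blast+
  have T: "T \<le> real (nat \<lceil>T / gap\<rceil>) * gap"
  proof -
    have "T / gap \<le> real (nat \<lceil>T / gap\<rceil>)" by linarith
    then show ?thesis using gap_pos by (simp add: pos_divide_le_eq)
  qed
  \<comment> \<open>Then \<theta>^2 * K <= \<theta> * \<epsilon>, and \<theta> <= 1 as
    \<open>Q\<close> requires.\<close>
  define \<theta> where "\<theta> = min 1 (\<epsilon> / (K + 1))"
  have \<theta>: "0 < \<theta>" "\<theta> \<le> 1" "\<theta> \<le> \<epsilon> / (K + 1)" using e K(1) by (auto simp: \<theta>_def)
  have "\<theta> * (K + 1) \<le> \<epsilon>" using \<theta>(3) K(1) by (subst (asm) pos_le_divide_eq) auto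
  then have "\<theta> * K \<le> \<epsilon>" using \<theta>(1) by (simp add: distrib_left)
  show ?thesis
  proof (intro exI[of _ \<theta>] conjI allI impI \<theta>(1))
    fix i t assume "t < T"
    then have "mgf (\<lambda>i t. exp (\<theta> * f i t)) i t \<le> exp (\<theta> * mean f i t + \<theta>\<^sup>2 * K)"
      using T \<theta> by (intro K) auto
    also have "\<dots> \<le> exp (\<theta> * (mean f i t + \<epsilon>))"
      using mult_left_mono[OF \<open>\<theta> * K \<le> \<epsilon>\<close>, of \<theta>] \<theta>(1) by (simp add: power2_eq_square distrib_left mult.assoc)
    finally show "mgf (\<lambda>i t. exp (\<theta> * f i t)) i t \<le> exp (\<theta> * (mean f i t + \<epsilon>))" .
  qed
qed

text \<open>The bound propagates from a compact time interval to all later times without any loss, since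
  the factors \<open>exp (- l)\<close> of every rule sum to one.\<close>

lemma mgf_exponential_bound:
  assumes f: "\<And>i t. t < 0 \<Longrightarrow> \<bar>f i t\<bar> \<le> 1" and e: "0 < \<epsilon>"
    and lim: "\<forall>\<^sub>F t in at_top. \<forall>i. exp (- t) * mean f i t \<le> z + \<epsilon> / 2"
  shows "\<exists>\<theta>>0. \<exists>T. \<forall>i t. T \<le> t \<longrightarrow> mgf (\<lambda>i t. exp (\<theta> * f i t)) i t \<le> exp (\<theta> * (exp t * (z + \<epsilon>)))"
proof -
  obtain T0 where T0: "\<And>t i. T0 \<le> t \<Longrightarrow> exp (- t) * mean f i t \<le> z + \<epsilon> / 2"
    using lim unfolding eventually_at_top_linorder by blast
  define T where "T = max 0 T0"
  have e2: "0 < \<epsilon> / 2" using e by simp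
  \<comment> \<open>The base interval reaches more than \<open>longest\<close> beyond
    \<open>T\<close>, so children of individuals past it are still at times at least
    \<open>T\<close>. One \<epsilon> / 2 pays for the mean, the other for the exponential
    moment.\<close>
  have "\<exists>\<theta>>0. \<forall>i t. t < T + longest + 1 \<longrightarrow> mgf (\<lambda>i t. exp (\<theta> * f i t)) i t \<le> exp (\<theta> * (mean f i t + \<epsilon> / 2))"
    by (rule mgf_le_mean[OF f e2])
  then obtain \<theta> where \<theta>: "0 < \<theta>" "\<And>i t. t < T + longest + 1 \<Longrightarrow> mgf (\<lambda>i t. exp (\<theta> * f i t)) i t \<le> exp (\<theta> * (mean f i t + \<epsilon> / 2))"
    by blast
  have "T \<le> t \<longrightarrow> mgf (\<lambda>i t. exp (\<theta> * f i t)) i t \<le> exp (\<theta> * (exp t * (z + \<epsilon>)))" for i t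
  proof (induction i t rule: branch_induct)
    case (2 i t)
    show ?case
    proof
      assume t: "T \<le> t"
      show "mgf (\<lambda>i t. exp (\<theta> * f i t)) i t \<le> exp (\<theta> * (exp t * (z + \<epsilon>)))"
      proof (cases "t < T + longest + 1")
        case True
        have "mean f i t \<le> exp t * (z + \<epsilon> / 2)"
        proof -
          have "exp t * (exp (- t) * mean f i t) \<le> exp t * (z + \<epsilon> / 2)"
            using T0[of t i] t by (intro mult_left_mono) (auto simp: T_def)
          then show ?thesis by (simp add: mult.assoc[symmetric] exp_add[symmetric])
        qed
        moreover have "1 * (\<epsilon> / 2) \<le> exp t * (\<epsilon> / 2)"
          using t e2 by (intro mult_right_mono) (auto simp: T_def)
        ultimately have "mean f i t + \<epsilon> / 2 \<le> exp t * (z + \<epsilon>)" by (simp add: distrib_left)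
        then have "\<theta> * (mean f i t + \<epsilon> / 2) \<le> \<theta> * (exp t * (z + \<epsilon>))" using \<theta>(1) by (intro mult_left_mono) auto
        then show ?thesis using \<theta>(2)[OF True, of i] by (meson exp_le_cancel_iff order_trans)
      next
        case False
        have "mgf (\<lambda>i t. exp (\<theta> * f i t)) i t \<le> (\<Sum>k<length (R i). pmf (pr i) k * exp (\<theta> * (exp t * (z + \<epsilon>))))"
          unfolding mgf_nonneg_time[OF 2(1)]
        proof (intro sum_mono mult_left_mono)
          fix k assume "k \<in> {..<length (R i)}"
          then have k: "k < length (R i)" by simp
          have "(\<Prod>x\<leftarrow>R i ! k. mgf (\<lambda>i t. exp (\<theta> * f i t)) (snd x) (t - fst x)) \<le>
             (\<Prod>x\<leftarrow>R i ! k. exp (exp (- fst x) * (\<theta> * (exp t * (z + \<epsilon>)))))"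
          proof (intro prod_list_mono mgf_nonneg)
            fix x assume x: "x \<in> set (R i ! k)"
            have "T \<le> t - fst x" using R_longest[OF k x] False by simp
            then show "mgf (\<lambda>i t. exp (\<theta> * f i t)) (snd x) (t - fst x) \<le> exp (exp (- fst x) * (\<theta> * (exp t * (z + \<epsilon>))))"
              using 2(2)[OF k x] by (simp add: exp_diff exp_minus field_simps)
          qed simp
          also have "\<dots> = exp ((\<Sum>x\<leftarrow>R i ! k. exp (- fst x)) * (\<theta> * (exp t * (z + \<epsilon>))))"
            unfolding prod_list_exp by (simp add: sum_list_mult_const)
          also have "\<dots> = exp (\<theta> * (exp t * (z + \<epsilon>)))" using R_sum[of "R i ! k" i] k by simp
          finally show "(\<Prod>x\<leftarrow>R i ! k. mgf (\<lambda>i t. exp (\<theta> * f i t)) (snd x) (t - fst x)) \<le> exp (\<theta> * (exp t * (z + \<epsilon>)))" .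
        qed simp
        also have "\<dots> = exp (\<theta> * (exp t * (z + \<epsilon>)))" by (simp only: sum_distrib_right[symmetric] sum_pr)
        finally show ?thesis by simp
      qed
    qed
  qed (simp add: T_def)
  then show ?thesis using \<theta>(1) by blast
qed

end

section \<open>Sparsity of the possible tile lengths\<close>

lemma list_sum_weight:
  fixes \<kappa> :: real
  assumes L: "finite L" and half: "(\<Sum>l\<in>L. exp (- \<kappa> * l)) \<le> 1 / 2"
  shows "(\<Sum>xs | set xs \<subseteq> L \<and> length xs = n. exp (- \<kappa> * sum_list xs)) \<le> (1 / 2) ^ n"
proof (induction n)
  case (Suc n)
  have "(\<Sum>xs | set xs \<subseteq> L \<and> length xs = Suc n. exp (- \<kappa> * sum_list xs)) =
    (\<Sum>(xs, l)\<in>{xs. set xs \<subseteq> L \<and> length xs = n} \<times> L. exp (- \<kappa> * sum_list xs) * exp (- \<kappa> * l))"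
    unfolding lists_length_Suc_eq
    by (subst sum.reindex) (auto simp: inj_on_def case_prod_beta exp_add[symmetric] algebra_simps)
  also have "\<dots> = (\<Sum>xs | set xs \<subseteq> L \<and> length xs = n. exp (- \<kappa> * sum_list xs)) * (\<Sum>l\<in>L. exp (- \<kappa> * l))"
    by (simp add: sum.cartesian_product[symmetric] sum_product)
  also have "\<dots> \<le> (1 / 2) ^ n * (1 / 2)"
    by (intro mult_mono Suc half sum_nonneg) auto
  finally show ?case by simp
next
  case 0
  have "{xs. set xs \<subseteq> L \<and> length xs = 0} = {[]}" by auto
  then show ?case by simp
qed

locale length_semigroup =
  fixes L :: "real set" and g :: real
  assumes finite_L: "finite L" and g: "0 < g" "\<And>l. l \<in> L \<Longrightarrow> g \<le> l"
begin

text \<open>With L the finite set of piece lengths, these are the possible tile lengths: sums along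
  a line of descent.\<close>

definition list_sums :: "real set" where "list_sums = sum_list ` {xs. set xs \<subseteq> L}"

text \<open>For large \<kappa> the lists of length n have total weight at most 2^-n, and each sum in
  \<open>F\<close> is represented by a list of its own.\<close>

lemma exponential_sum:
  obtains \<kappa> where "0 < \<kappa>" "\<And>F. finite F \<Longrightarrow> F \<subseteq> list_sums \<Longrightarrow> (\<Sum>t\<in>F. exp (- \<kappa> * t)) \<le> 2"
proof -
  \<comment> \<open>Solves exp (- \<kappa> * g) = 1 / (2 * (card L + 1)), so that the weights of the
    single letters sum to at most 1 / 2.\<close>
  define \<kappa> where "\<kappa> = ln (2 * (real (card L) + 1)) / g"
  have k: "0 < \<kappa>" using g by (simp add: \<kappa>_def)
  have "(\<Sum>l\<in>L. exp (- \<kappa> * l)) \<le> (\<Sum>l\<in>L. exp (- \<kappa> * g))"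
    using g k by (intro sum_mono) simp
  also have "\<dots> = real (card L) * (1 / (2 * (real (card L) + 1)))"
    using g by (simp add: \<kappa>_def exp_minus inverse_eq_divide)
  also have "\<dots> \<le> 1 / 2" by (simp add: field_simps)
  finally have half: "(\<Sum>l\<in>L. exp (- \<kappa> * l)) \<le> 1 / 2" .
  have "(\<Sum>t\<in>F. exp (- \<kappa> * t)) \<le> 2" if F: "finite F" "F \<subseteq> list_sums" for F
  proof -
    have "\<forall>t\<in>F. \<exists>xs. set xs \<subseteq> L \<and> sum_list xs = t" using F(2) by (auto simp: list_sums_def)
    then obtain h where h: "\<And>t. t \<in> F \<Longrightarrow> set (h t) \<subseteq> L" "\<And>t. t \<in> F \<Longrightarrow> sum_list (h t) = t" by metis
    define N where "N = Max (insert 0 (length ` h ` F))"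
    have fin: "finite {xs. set xs \<subseteq> L \<and> length xs = n}" for n
      using finite_lists_length_eq[OF finite_L] by simp
    have inj: "inj_on h F" using h(2) by (metis inj_onI)
    have "(\<Sum>t\<in>F. exp (- \<kappa> * t)) = (\<Sum>xs\<in>h ` F. exp (- \<kappa> * sum_list xs))"
      by (subst sum.reindex[OF inj]) (simp add: h(2))
    also have "\<dots> = (\<Sum>n\<in>{..N}. \<Sum>xs | xs \<in> h ` F \<and> length xs = n. exp (- \<kappa> * sum_list xs))"
      by (rule sum.group[symmetric]) (use F(1) in \<open>auto simp: N_def\<close>)
    also have "\<dots> \<le> (\<Sum>n\<in>{..N}. (1 / 2) ^ n)"
    proof (rule sum_mono)
      fix n
      have "(\<Sum>xs | xs \<in> h ` F \<and> length xs = n. exp (- \<kappa> * sum_list xs)) \<le>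
        (\<Sum>xs | set xs \<subseteq> L \<and> length xs = n. exp (- \<kappa> * sum_list xs))"
        by (rule sum_mono2[OF fin]) (use h in auto)
      also have "\<dots> \<le> (1 / 2) ^ n" by (rule list_sum_weight[OF finite_L half])
      finally show "(\<Sum>xs | xs \<in> h ` F \<and> length xs = n. exp (- \<kappa> * sum_list xs)) \<le> (1 / 2) ^ n" .
    qed
    also have "\<dots> \<le> (\<Sum>n. (1 / 2 :: real) ^ n)" by (rule sum_le_suminf) (auto simp: summable_geometric)
    also have "\<dots> = 2" by (simp add: suminf_geometric)
    finally show ?thesis .
  qed
  then show ?thesis using that k by blast
qed

text \<open>At most 2 * exp (\<kappa> * X) sums lie below \<open>X\<close>. As thresholds strictly
  increase, this drives them to infinity uniformly over all random choices.\<close>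

lemma card_bounded: "\<exists>N. \<forall>F. finite F \<and> F \<subseteq> list_sums \<and> (\<forall>t\<in>F. t \<le> X) \<longrightarrow> card F \<le> N"
proof -
  obtain \<kappa> where k: "0 < \<kappa>" "\<And>F. finite F \<Longrightarrow> F \<subseteq> list_sums \<Longrightarrow> (\<Sum>t\<in>F. exp (- \<kappa> * t)) \<le> 2"
    using exponential_sum by blast
  show ?thesis
  proof (intro exI[of _ "nat \<lceil>2 * exp (\<kappa> * X)\<rceil>"] allI impI)
    fix F assume F: "finite F \<and> F \<subseteq> list_sums \<and> (\<forall>t\<in>F. t \<le> X)"
    have "real (card F) * exp (- \<kappa> * X) = (\<Sum>t\<in>F. exp (- \<kappa> * X))" by simp
    also have "\<dots> \<le> (\<Sum>t\<in>F. exp (- \<kappa> * t))" using F k(1) by (intro sum_mono) auto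
    also have "\<dots> \<le> 2" using k(2) F by simp
    finally have "real (card F) \<le> 2 * exp (\<kappa> * X)" by (simp add: exp_minus field_simps)
    then show "card F \<le> nat \<lceil>2 * exp (\<kappa> * X)\<rceil>" by linarith
  qed
qed

text \<open>For the union bound over thresholds: exp t is the weight of a bad event and exp (- c *
  exp t) the bound for its probability, which outweighs the exponential number of
  thresholds.\<close>

lemma double_exponential_sum:
  assumes c: "0 < c" and e: "0 < \<epsilon>"
  shows "\<exists>X. \<forall>F. finite F \<and> F \<subseteq> list_sums \<and> (\<forall>t\<in>F. X \<le> t) \<longrightarrow> (\<Sum>t\<in>F. exp (t - c * exp t)) \<le> \<epsilon>"
proof -
  obtain \<kappa> where k: "0 < \<kappa>" "\<And>F. finite F \<Longrightarrow> F \<subseteq> list_sums \<Longrightarrow> (\<Sum>t\<in>F. exp (- \<kappa> * t)) \<le> 2"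
    using exponential_sum by blast
  \<comment> \<open>The first bound gives c * exp t >= c * t^2 / 2 >= (\<kappa> + 2) * t, the last
    one exp (- t) <= \<epsilon> / 2.\<close>
  define X where "X = max (2 * (\<kappa> + 2) / c) (max 0 (ln (2 / \<epsilon>)))"
  show ?thesis
  proof (intro exI[of _ X] allI impI)
    fix F assume F: "finite F \<and> F \<subseteq> list_sums \<and> (\<forall>t\<in>F. X \<le> t)"
    have le: "exp (t - c * exp t) \<le> exp (- \<kappa> * t) * (\<epsilon> / 2)" if t: "t \<in> F" for t
    proof -
      have tX: "2 * (\<kappa> + 2) / c \<le> t" "0 \<le> t" "ln (2 / \<epsilon>) \<le> t" using F t by (auto simp: X_def)
      have "t * (2 * (\<kappa> + 2)) \<le> t * (c * t)"
        using tX c by (intro mult_left_mono) (auto simp: pos_divide_le_eq mult.commute)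
      also have "\<dots> \<le> c * (2 * exp t)"
      proof -
        have "t\<^sup>2 \<le> 2 * exp t" using exp_lower_Taylor_quadratic[OF tX(2)] tX(2) by simp
        then show ?thesis using c by (simp add: power2_eq_square mult.left_commute)
      qed
      finally have "t - c * exp t \<le> - \<kappa> * t - t" by (simp add: algebra_simps)
      also have "\<dots> \<le> - \<kappa> * t - ln (2 / \<epsilon>)" using tX by simp
      finally have "exp (t - c * exp t) \<le> exp (- \<kappa> * t - ln (2 / \<epsilon>))" by simp
      also have "\<dots> = exp (- \<kappa> * t) * (\<epsilon> / 2)" using e by (simp add: exp_diff)
      finally show ?thesis .
    qed
    have "(\<Sum>t\<in>F. exp (t - c * exp t)) \<le> (\<Sum>t\<in>F. exp (- \<kappa> * t)) * (\<epsilon> / 2)"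
      unfolding sum_distrib_right by (intro sum_mono le)
    also have "\<dots> \<le> 2 * (\<epsilon> / 2)" using k(2)[of F] F e by (intro mult_right_mono) auto
    finally show "(\<Sum>t\<in>F. exp (t - c * exp t)) \<le> \<epsilon>" by simp
  qed
qed

end

section \<open>Renewal limits of mean population statistics\<close>

locale nonlattice_branching = branching R pr
  for R :: "'n::finite \<Rightarrow> (real \<times> 'n) list list" and pr :: "'n \<Rightarrow> nat pmf" +
  assumes connected: "\<exists>x. walk_length edges fst (\<lambda>e. snd (edge e)) (\<lambda>e. fst (edge e)) i j x"
    and nonlattice: "\<exists>p q a b. walk_length edges fst (\<lambda>e. snd (edge e)) (\<lambda>e. fst (edge e)) p p a \<and>
       walk_length edges fst (\<lambda>e. snd (edge e)) (\<lambda>e. fst (edge e)) q q b \<and> 0 < b \<and> a \<notin> {b * x | x. x \<in> \<rat>}"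
begin

sublocale nonlattice_renewal edges fst "\<lambda>e. snd (edge e)" edge_wt "\<lambda>e. fst (edge e)"
  by unfold_locales (fact connected, fact nonlattice)

definition source :: "('n \<Rightarrow> real \<Rightarrow> real) \<Rightarrow> 'n \<times> nat \<times> nat \<Rightarrow> real \<Rightarrow> real" where
  "source f e t = pmf (pr (fst e)) (fst (snd e)) * (exp (- t) * f (snd (edge e)) (t - fst (edge e)))"

text \<open>Decompose by the children of the root: those born after time \<open>t\<close> are
  counted at once and form the source, the others restart the process. The identity exp (- t) = exp
  (- l) * exp (- (t - l)) turns rule probabilities into \<open>edge_wt\<close>.\<close>

lemma mean_solves: "solves (jump (source f)) (\<lambda>i t. if t < 0 then 0 else exp (- t) * mean f i t)"
  unfolding solves_def
proof (intro allI)
  fix i t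
  let ?u = "\<lambda>i t. if t < 0 then 0 else exp (- t) * mean f i t"
  show "?u i t = (if t < 0 then 0 else jump (source f) i t + avg i (\<lambda>e. ?u (snd (edge e)) (t - fst (edge e))))"
  proof (cases "t < 0")
    case False
    have "exp (- t) * mean f i t = (\<Sum>e\<in>out i. exp (- t) * (pmf (pr i) (fst (snd e)) * mean f (snd (edge e)) (t - fst (edge e))))"
      using False unfolding out_def sum_distrib_left[symmetric]
      by (simp add: mean_nonneg_time sum_edges_from_list[where F = "\<lambda>x. mean f (snd x) (t - fst x)"])
    also have "\<dots> = (\<Sum>e\<in>out i. (if 0 \<le> t \<and> t < fst (edge e) then source f e t else 0) +
        edge_wt e * ?u (snd (edge e)) (t - fst (edge e)))"
    proof (rule sum.cong[OF refl])
      fix e assume "e \<in> out i"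
      then have i: "fst e = i" by (rule out_src)
      show "exp (- t) * (pmf (pr i) (fst (snd e)) * mean f (snd (edge e)) (t - fst (edge e))) =
        (if 0 \<le> t \<and> t < fst (edge e) then source f e t else 0) + edge_wt e * ?u (snd (edge e)) (t - fst (edge e))"
      proof (cases "t < fst (edge e)")
        case True
        then show ?thesis using False i by (simp add: source_def mean_neg)
      next
        case le: False
        have "exp (- fst (edge e)) * exp (- (t - fst (edge e))) = exp (- t)" by (simp add: exp_add[symmetric])
        then show ?thesis using le False i by (simp add: edge_wt_def mult_ac)
      qed
    qed
    finally show ?thesis using False by (simp add: jump_def sum.distrib)
  qed simp
qed

lemma mean_limit:
  assumes f: "\<And>i. continuous_on UNIV (f i)" "\<And>i t. 0 \<le> f i t"
    and v: "stationary v" "v j \<noteq> 0" and e: "0 < \<epsilon>"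
  shows "\<forall>\<^sub>F t in at_top. \<forall>i. \<bar>exp (- t) * mean f i t -
    (\<Sum>e\<in>edges. v (fst e) * integral {0..fst (edge e)} (source f e)) / drift v\<bar> \<le> \<epsilon>"
proof -
  have c: "continuous_on UNIV (source f e)" for e
    unfolding source_def by (intro continuous_intros continuous_on_compose2[OF f(1)]) auto
  have nn: "0 \<le> source f e t" for e t unfolding source_def by (simp add: f(2))
  have "\<forall>\<^sub>F t in at_top. \<forall>i. \<bar>(if t < 0 then 0 else exp (- t) * mean f i t) -
    (\<Sum>e\<in>edges. v (fst e) * integral {0..fst (edge e)} (source f e)) / drift v\<bar> \<le> \<epsilon>"
    by (rule renewal_theorem[OF mean_solves c nn v e])
  with eventually_ge_at_top[of 0] show ?thesis by eventually_elim auto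
qed

end

section \<open>Volumes of similar sets\<close>

definition similarity :: "('a::euclidean_space \<Rightarrow> 'a) \<Rightarrow> real \<Rightarrow> bool" where
  "similarity f c \<longleftrightarrow> 0 < c \<and> (\<forall>x y. dist (f x) (f y) = c * dist x y)"

lemma negligible_similarity_image:
  assumes f: "similarity f c" and S: "negligible S"
  shows "negligible (f ` S)"
proof (rule negligible_locally_Lipschitz_image[OF _ S])
  fix x :: 'a
  show "\<exists>T B. open T \<and> x \<in> T \<and> (\<forall>y\<in>S \<inter> T. norm (f y - f x) \<le> B * norm (y - x))"
    using f by (intro exI[of _ UNIV] exI[of _ c]) (auto simp: similarity_def dist_norm[symmetric])
qed simp

lemma isometry_similarity: "is_isometry f \<Longrightarrow> similarity f 1"
  by (simp add: is_isometry_def similarity_def)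

text \<open>Up to a null set an open set is a disjoint union of balls (Vitali), and an orthogonal
  map sends a ball to a translate of it. The null set stays null because the map is
  Lipschitz.\<close>

lemma emeasure_orthogonal_open:
  fixes g :: "'a::euclidean_space \<Rightarrow> 'a"
  assumes g: "orthogonal_transformation g" and S: "open S"
  shows "emeasure lebesgue (g ` S) = emeasure lebesgue S"
proof -
  have iso: "is_isometry g" using g by (simp add: is_isometry_def orthogonal_transformation_isometry)
  define K where "K = {(x, r). 0 < r \<and> ball x r \<subseteq> S}"
  have cov: "\<exists>i. i \<in> K \<and> x \<in> ball (fst i) (snd i) \<and> snd i < d" if "x \<in> S" "0 < d" for x d
  proof -
    obtain e where "0 < e" "ball x e \<subseteq> S" using S \<open>x \<in> S\<close> by (auto simp: open_contains_ball)
    moreover have "ball x (min e (d / 2)) \<subseteq> ball x e" by auto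
    ultimately show ?thesis
      using that by (intro exI[of _ "(x, min e (d / 2))"]) (auto simp: K_def)
  qed
  have "\<exists>C. countable C \<and> C \<subseteq> K
     \<and> pairwise (\<lambda>i j. disjnt (ball (fst i) (snd i)) (ball (fst j) (snd j))) C
     \<and> negligible (S - (\<Union>i\<in>C. ball (fst i) (snd i)))"
    by (rule Vitali_covering_theorem_balls[of S K fst snd, OF cov]) blast+
  then obtain C where C: "countable C" "C \<subseteq> K"
     "pairwise (\<lambda>i j. disjnt (ball (fst i) (snd i)) (ball (fst j) (snd j))) C"
     "negligible (S - (\<Union>i\<in>C. ball (fst i) (snd i)))"
    by blast
  define N where "N = S - (\<Union>i\<in>C. ball (fst i) (snd i))"
  have S_eq: "S = (\<Union>i\<in>C. ball (fst i) (snd i)) \<union> N"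
  proof -
    have "ball (fst i) (snd i) \<subseteq> S" if "i \<in> C" for i
    proof -
      have "i \<in> K" using C(2) that by blast
      then show ?thesis unfolding K_def by (simp add: case_prod_beta)
    qed
    then show ?thesis unfolding N_def by blast
  qed
  have gb: "g ` ball x r = ball (g x) r" for x r
    by (rule image_orthogonal_transformation_ball[OF g])
  have "g ` S = g ` ((\<Union>i\<in>C. ball (fst i) (snd i)) \<union> N)" using S_eq by simp
  then have gS: "g ` S = (\<Union>i\<in>C. ball (g (fst i)) (snd i)) \<union> g ` N"
    by (simp add: image_Un image_UN gb)
  have inj: "inj g" using orthogonal_transformation_inj[OF g] .
  have disj: "disjoint_family_on (\<lambda>i. ball (fst i) (snd i)) C"
    using C(3) by (auto simp: disjoint_family_on_def pairwise_def disjnt_def)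
  have disj': "disjoint_family_on (\<lambda>i. ball (g (fst i)) (snd i)) C"
    unfolding disjoint_family_on_def gb[symmetric]
    using disj by (simp add: disjoint_family_on_def image_Int[OF inj, symmetric])
  have ball: "emeasure lebesgue (ball (g x) r) = emeasure lebesgue (ball x r)" for x r
  proof -
    have "ball (g x) r = (\<lambda>y. 1 *\<^sub>R y + (g x - x)) ` ball x r"
      using ball_translation[of "g x - x" x r] by (simp add: add.commute)
    then show ?thesis using emeasure_lebesgue_affine[of 1 "g x - x" "ball x r"] by simp
  qed
  have "emeasure lebesgue (g ` S) = emeasure lebesgue (\<Union>i\<in>C. ball (g (fst i)) (snd i))"
    unfolding gS using negligible_similarity_image[OF isometry_similarity[OF iso] C(4)]
    by (intro emeasure_Un_null_set) (auto simp: negligible_iff_null_sets N_def intro!: sets.countable_UN'' C)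
  also have "\<dots> = (\<integral>\<^sup>+i. emeasure lebesgue (ball (g (fst i)) (snd i)) \<partial>count_space C)"
    by (rule emeasure_UN_countable) (use C disj' in auto)
  also have "\<dots> = (\<integral>\<^sup>+i. emeasure lebesgue (ball (fst i) (snd i)) \<partial>count_space C)"
    by (simp add: ball)
  also have "\<dots> = emeasure lebesgue (\<Union>i\<in>C. ball (fst i) (snd i))"
    by (rule emeasure_UN_countable[symmetric]) (use C disj in auto)
  also have "\<dots> = emeasure lebesgue ((\<Union>i\<in>C. ball (fst i) (snd i)) \<union> N)"
    using C(4) by (intro emeasure_Un_null_set[symmetric]) (auto simp: negligible_iff_null_sets N_def intro!: sets.countable_UN'' C)
  finally show ?thesis using S_eq by simp
qed

text \<open>Lebesgue measure is determined by its values on boxes, which are open; by the previous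
  lemma it therefore equals its image under the inverse of \<open>g\<close>.\<close>

lemma emeasure_orthogonal_borel:
  fixes g :: "'a::euclidean_space \<Rightarrow> 'a"
  assumes g: "orthogonal_transformation g" and S: "S \<in> sets borel"
  shows "g ` S \<in> sets borel" "emeasure lborel (g ` S) = emeasure lborel S"
proof -
  have bij: "bij g" using orthogonal_transformation_bij[OF g] .
  have img: "g ` A = inv g -` A" for A 
    using bij_vimage_eq_inv_image[OF bij_imp_bij_inv[OF bij], of A] by (simp add: inv_inv_eq[OF bij])
  have "linear (inv g)"
    by (intro orthogonal_transformation_linear orthogonal_transformation_inv g)
  then have meas: "inv g \<in> borel_measurable borel"
    by (intro borel_measurable_continuous_onI linear_continuous_on) (simp add: linear_conv_bounded_linear)
  have "lborel = distr lborel borel (inv g)"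
  proof (rule lborel_eqI)
    fix l u :: 'a assume lu: "\<And>b. b \<in> Basis \<Longrightarrow> l \<bullet> b \<le> u \<bullet> b"
    have "emeasure (distr lborel borel (inv g)) (box l u) = emeasure lborel (g ` box l u)"
      using meas by (simp add: emeasure_distr img)
    also have "\<dots> = emeasure lebesgue (g ` box l u)"
    proof -
      have "inv g -` box l u \<in> sets borel" using measurable_sets[OF meas, of "box l u"] by simp
      then show ?thesis by (simp add: img)
    qed
    also have "\<dots> = emeasure lborel (box l u)" 
      using emeasure_orthogonal_open[OF g open_box, of l u] by simp
    finally show "emeasure (distr lborel borel (inv g)) (box l u) = (\<Prod>b\<in>Basis. (u - l) \<bullet> b)"
      using lu by (simp add: emeasure_lborel_box_eq)
  qed simp
  then have "emeasure lborel S = emeasure (distr lborel borel (inv g)) S" by simp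
  then show "emeasure lborel (g ` S) = emeasure lborel S"
    using meas S by (simp add: emeasure_distr img)
  show "g ` S \<in> sets borel" using measurable_sets[OF meas S] by (simp add: img)
qed

lemma measure_orthogonal:
  fixes g :: "'a::euclidean_space \<Rightarrow> 'a"
  assumes g: "orthogonal_transformation g" and S: "S \<in> sets lebesgue"
  shows "g ` S \<in> sets lebesgue" "emeasure lebesgue (g ` S) = emeasure lebesgue S"
proof -
  have iso: "is_isometry g" using g by (simp add: is_isometry_def orthogonal_transformation_isometry)
  obtain B N N' where BN: "S = B \<union> N" "N \<subseteq> N'" "N' \<in> null_sets lborel" "B \<in> sets lborel"
    using sets_completionE[OF S] by metis
  have N: "negligible N" "negligible (g ` N)"
  proof -
    show "negligible N" using BN null_sets_completion_iff2[of N lborel] by (auto simp: negligible_iff_null_sets)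
    then show "negligible (g ` N)" by (rule negligible_similarity_image[OF isometry_similarity[OF iso]])
  qed
  have B: "g ` B \<in> sets borel" "emeasure lborel (g ` B) = emeasure lborel B"
    using emeasure_orthogonal_borel[OF g] BN(4) by auto
  show "g ` S \<in> sets lebesgue"
    unfolding BN(1) image_Un using B N by (auto simp: negligible_iff_null_sets)
  have "emeasure lebesgue (g ` S) = emeasure lebesgue (g ` B)"
    unfolding BN(1) image_Un using B N by (intro emeasure_Un_null_set) (auto simp: negligible_iff_null_sets)
  also have "\<dots> = emeasure lebesgue B" using B BN(4) by simp
  also have "\<dots> = emeasure lebesgue S"
    unfolding BN(1) using BN(4) N by (intro emeasure_Un_null_set[symmetric]) (auto simp: negligible_iff_null_sets)
  finally show "emeasure lebesgue (g ` S) = emeasure lebesgue S" .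
qed

lemma isometry_measure:
  fixes f :: "'a::euclidean_space \<Rightarrow> 'a"
  assumes f: "is_isometry f" and S: "S \<in> lmeasurable"
  shows "f ` S \<in> lmeasurable" "measure lebesgue (f ` S) = measure lebesgue S"
proof -
  \<comment> \<open>An isometry is a translation after an isometry fixing 0, and the latter is
    orthogonal.\<close>
  define g where "g x = f x - f 0" for x
  have g: "orthogonal_transformation g"
    using f by (simp add: orthogonal_transformation_isometry is_isometry_def g_def dist_norm)
  have eq: "f ` S = (+) (f 0) ` (g ` S)" by (simp add: image_image g_def)
  have S': "S \<in> sets lebesgue" "emeasure lebesgue S < \<infinity>" using S by (auto simp: fmeasurable_def)
  have "g ` S \<in> lmeasurable"
    using measure_orthogonal[OF g S'(1)] S'(2) by (auto simp: fmeasurable_def)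
  then show "f ` S \<in> lmeasurable" unfolding eq by (rule measurable_translation)
  show "measure lebesgue (f ` S) = measure lebesgue S"
    unfolding eq measure_translation using measure_orthogonal[OF g S'(1)] by (simp add: measure_def)
qed

lemma similarity_measure:
  fixes f :: "'a::euclidean_space \<Rightarrow> 'a"
  assumes f: "similarity f c" and S: "S \<in> lmeasurable"
  shows "f ` S \<in> lmeasurable" "measure lebesgue (f ` S) = c ^ DIM('a) * measure lebesgue S"
proof -
  have c: "0 < c" using f by (simp add: similarity_def)
  define h where "h x = f ((1 / c) *\<^sub>R x)" for x
  have h: "is_isometry h"
    unfolding is_isometry_def
  proof (intro allI)
    fix x y
    have "dist (h x) (h y) = c * dist ((1 / c) *\<^sub>R x) ((1 / c) *\<^sub>R y)"
      using f by (simp add: similarity_def h_def)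
    also have "dist ((1 / c) *\<^sub>R x) ((1 / c) *\<^sub>R y) = dist x y / c"
      using c by (simp add: dist_norm scaleR_diff_right[symmetric] del: scaleR_diff_right)
    finally show "dist (h x) (h y) = dist x y" using c by simp
  qed
  have eq: "f ` S = h ` ((\<lambda>x. c *\<^sub>R x + 0) ` S)"
    using c by (simp add: image_image h_def)
  have "(\<lambda>x. c *\<^sub>R x + 0) ` S \<in> lmeasurable"
  proof -
    have "(\<lambda>x. c *\<^sub>R x + 0) ` S = (*\<^sub>R) (1 / c) -` S"
    proof (intro equalityI subsetI)
      fix x assume "x \<in> (*\<^sub>R) (1 / c) -` S"
      then have "(1 / c) *\<^sub>R x \<in> S" "x = c *\<^sub>R ((1 / c) *\<^sub>R x) + 0" using c by auto
      then show "x \<in> (\<lambda>x. c *\<^sub>R x + 0) ` S" by blast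
    qed (use c in auto)
    moreover have "(*\<^sub>R) (1 / c) -` S \<in> sets lebesgue"
      using measurable_sets[OF lebesgue_measurable_scaling, of S "1 / c"] S by (simp add: fmeasurable_def)
    moreover have "emeasure lebesgue ((\<lambda>x. c *\<^sub>R x + 0) ` S) < \<infinity>"
      unfolding emeasure_lebesgue_affine using S by (simp add: fmeasurable_def ennreal_mult_less_top del: emeasure_completion)
    ultimately show ?thesis by (simp add: fmeasurable_def)
  qed
  from isometry_measure[OF h this]
  show "f ` S \<in> lmeasurable" "measure lebesgue (f ` S) = c ^ DIM('a) * measure lebesgue S"
    unfolding eq measure_lebesgue_affine using c by auto
qed

section \<open>Kakutani sequences\<close>

lemma measure_Union_list:
  fixes Ts :: "'a::euclidean_space set list"
  assumes m: "\<And>T. T \<in> set Ts \<Longrightarrow> T \<in> lmeasurable"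
    and d: "\<And>a b. a < length Ts \<Longrightarrow> b < length Ts \<Longrightarrow> a \<noteq> b \<Longrightarrow> negligible (Ts ! a \<inter> Ts ! b)"
  shows "measure lebesgue (\<Union>(set Ts)) = (\<Sum>T\<leftarrow>Ts. measure lebesgue T)"
proof -
  have "\<Union>(set Ts) = \<Union>((!) Ts ` {..<length Ts})" by (auto simp: set_conv_nth)
  also have "measure lebesgue \<dots> = (\<Sum>a<length Ts. measure lebesgue (Ts ! a))"
    by (rule measure_negligible_finite_Union_image) (use m d in \<open>auto simp: pairwise_def\<close>)
  finally show ?thesis by (simp add: sum_list_sum_nth atLeast0LessThan)
qed

section \<open>Tiles, rules and single steps\<close>

locale kakutani_system =
  fixes \<Sigma> :: "('a::euclidean_space, 'n::finite) subst_system"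
  assumes sys: "random_substitution_system \<Sigma>" and norm: "normalized \<Sigma>"
begin

definition piece_len :: "('a, 'n) piece \<Rightarrow> real" where
  "piece_len p = - ln (subst_vol \<Sigma> p)"

definition similar_tile :: "('a, 'n) tile \<Rightarrow> bool" where
  "similar_tile t \<longleftrightarrow> (\<exists>c. similarity (fst t) c)"

definition tile_len :: "('a, 'n) tile \<Rightarrow> real" where
  "tile_len t = - ln (tile_vol \<Sigma> t)"

lemma prototile_measurable: "prototile \<Sigma> i \<in> lmeasurable"
  using sys by (auto simp: random_substitution_system_def is_tile_def)

lemma prototile_measure: "measure lebesgue (prototile \<Sigma> i) = 1"
  using norm by (simp add: normalized_def)

lemma rule_partition:
  "\<rho> \<in> set (rules \<Sigma> i) \<Longrightarrow> is_partition (prototile \<Sigma> i) (map (\<lambda>p. piece_iso p ` subst_tile \<Sigma> p) \<rho>)"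
  using sys by (auto simp: random_substitution_system_def)

lemma piece_facts:
  assumes "\<rho> \<in> set (rules \<Sigma> i)" "p \<in> set \<rho>"
  shows "is_isometry (piece_iso p)" "0 < piece_scale p" "piece_scale p < 1"
  using sys assms by (auto simp: random_substitution_system_def)

lemma scaling_similarity: "0 < c \<Longrightarrow> similarity (\<lambda>x::'a. c *\<^sub>R x) c"
  by (simp add: similarity_def dist_norm scaleR_diff_right[symmetric] del: scaleR_diff_right)

lemma subst_tile_measure:
  assumes "\<rho> \<in> set (rules \<Sigma> i)" "p \<in> set \<rho>"
  shows "subst_tile \<Sigma> p \<in> lmeasurable" "subst_vol \<Sigma> p = piece_scale p ^ DIM('a)"
  using similarity_measure[OF scaling_similarity[OF piece_facts(2)[OF assms]] prototile_measurable]
  by (simp_all add: subst_vol_def subst_tile_def prototile_measure)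

lemma subst_vol_range:
  assumes "\<rho> \<in> set (rules \<Sigma> i)" "p \<in> set \<rho>"
  shows "0 < subst_vol \<Sigma> p" "subst_vol \<Sigma> p < 1"
  using piece_facts[OF assms] by (auto simp: subst_tile_measure(2)[OF assms] power_less_one_iff)

lemma exp_piece_len:
  assumes "\<rho> \<in> set (rules \<Sigma> i)" "p \<in> set \<rho>"
  shows "exp (- piece_len p) = subst_vol \<Sigma> p"
  using subst_vol_range[OF assms] by (simp add: piece_len_def)

lemma subst_vol_sum:
  assumes r: "\<rho> \<in> set (rules \<Sigma> i)"
  shows "(\<Sum>p\<leftarrow>\<rho>. subst_vol \<Sigma> p) = 1"
proof -
  let ?Ts = "map (\<lambda>p. piece_iso p ` subst_tile \<Sigma> p) \<rho>"
  note part = rule_partition[OF r, unfolded is_partition_def]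
  have piece: "piece_iso p ` subst_tile \<Sigma> p \<in> lmeasurable"
    "measure lebesgue (piece_iso p ` subst_tile \<Sigma> p) = subst_vol \<Sigma> p" if "p \<in> set \<rho>" for p
    using isometry_measure[OF piece_facts(1)[OF r that] subst_tile_measure(1)[OF r that]]
    by (simp_all add: subst_vol_def)
  have "(\<Sum>T\<leftarrow>?Ts. measure lebesgue T) = measure lebesgue (\<Union>(set ?Ts))"
    by (rule measure_Union_list[symmetric]) (use part piece in auto)
  also have "\<dots> = measure lebesgue (prototile \<Sigma> i)"
    by (rule measure_negligible_symdiff[OF prototile_measurable]) (use part in blast)
  finally have "(\<Sum>p\<leftarrow>\<rho>. measure lebesgue (piece_iso p ` subst_tile \<Sigma> p)) = 1"
    by (simp add: prototile_measure comp_def)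
  moreover have "map (\<lambda>p. measure lebesgue (piece_iso p ` subst_tile \<Sigma> p)) \<rho> = map (subst_vol \<Sigma>) \<rho>"
    using piece(2) by (intro map_cong) auto
  ultimately show ?thesis by simp
qed

definition shape :: "('a, 'n) piece \<Rightarrow> real \<times> 'n" where
  "shape p = (piece_len p, piece_type p)"

sublocale branching "\<lambda>i. map (map shape) (rules \<Sigma> i)" "rule_pmf \<Sigma>"
proof
  fix i \<rho> x
  show "set_pmf (rule_pmf \<Sigma> i) = {..<length (map (map shape) (rules \<Sigma> i))}"
    using sys by (simp add: random_substitution_system_def)
  assume "\<rho> \<in> set (map (map shape) (rules \<Sigma> i))"
  then obtain \<rho>' where r: "\<rho>' \<in> set (rules \<Sigma> i)" "\<rho> = map shape \<rho>'" by auto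
  have "map (\<lambda>p. exp (- piece_len p)) \<rho>' = map (subst_vol \<Sigma>) \<rho>'"
    using exp_piece_len[OF r(1)] by (intro map_cong) auto
  then have "(\<Sum>p\<leftarrow>\<rho>'. exp (- piece_len p)) = 1"
    using subst_vol_sum[OF r(1)] by (simp only:)
  then show "(\<Sum>x\<leftarrow>\<rho>. exp (- fst x)) = 1"
    by (simp add: r(2) comp_def shape_def)
  assume "x \<in> set \<rho>"
  then obtain p where "p \<in> set \<rho>'" "x = shape p" using r by auto
  then show "0 < fst x" using subst_vol_range[OF r(1)] by (simp add: shape_def piece_len_def)
qed

definition lengths :: "real set" where "lengths = (\<lambda>e. fst (edge e)) ` edges"

sublocale length_semigroup lengths gap
  by unfold_locales (use finite_edges gap_pos gap_le in \<open>auto simp: lengths_def\<close>)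

lemma shape_length: "k < length (rules \<Sigma> i) \<Longrightarrow> p \<in> set (rules \<Sigma> i ! k) \<Longrightarrow> piece_len p \<in> lengths"
proof -
  assume "k < length (rules \<Sigma> i)" "p \<in> set (rules \<Sigma> i ! k)"
  then have "k < length (map (map shape) (rules \<Sigma> i))" "shape p \<in> set (map (map shape) (rules \<Sigma> i) ! k)" by auto
  then obtain e where e: "e \<in> out i" "shape p = edge e" by (rule R_edge)
  have "piece_len p = fst (edge e)" unfolding e(2)[symmetric] by (simp add: shape_def)
  then show ?thesis unfolding lengths_def using out_E[OF e(1)] by blast
qed

lemma shape_bounds:
  assumes "k < length (rules \<Sigma> i)" "p \<in> set (rules \<Sigma> i ! k)"
  shows "0 < piece_len p" "piece_len p \<le> longest"
proof -
  have *: "k < length (map (map shape) (rules \<Sigma> i))" "shape p \<in> set (map (map shape) (rules \<Sigma> i) ! k)"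
    using assms by auto
  show "0 < piece_len p" using R_gap[OF *] gap_pos by (simp add: shape_def)
  show "piece_len p \<le> longest" using R_longest[OF *] by (simp add: shape_def)
qed

lemma tile_measure:
  assumes "similarity (fst t) c"
  shows "tile_set \<Sigma> t \<in> lmeasurable" "tile_vol \<Sigma> t = c ^ DIM('a)"
  using similarity_measure[OF assms prototile_measurable] by (simp_all add: tile_set_def tile_vol_def prototile_measure)

lemma tile_vol_pos: "similar_tile t \<Longrightarrow> 0 < tile_vol \<Sigma> t"
proof -
  assume "similar_tile t"
  then obtain c where c: "similarity (fst t) c" by (auto simp: similar_tile_def)
  then show ?thesis unfolding tile_measure(2)[OF c] by (simp add: similarity_def)
qed

lemma exp_tile_len: "similar_tile t \<Longrightarrow> exp (- tile_len t) = tile_vol \<Sigma> t"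
  using tile_vol_pos by (simp add: tile_len_def)

lemma subst_piece:
  assumes t: "similar_tile t" and p: "\<rho> \<in> set (rules \<Sigma> i)" "p \<in> set \<rho>"
  defines "x \<equiv> (\<lambda>x. fst t (piece_iso p (piece_scale p *\<^sub>R x)), piece_type p)"
  shows "similar_tile x" "tile_len x = tile_len t + piece_len p"
proof -
  obtain c where c: "similarity (fst t) c" using t by (auto simp: similar_tile_def)
  have s: "similarity (fst x) (c * piece_scale p)"
    using c piece_facts[OF p] scaling_similarity[OF piece_facts(2)[OF p]]
    by (simp add: x_def similarity_def is_isometry_def)
  then show "similar_tile x" by (auto simp: similar_tile_def)
  have "tile_vol \<Sigma> x = tile_vol \<Sigma> t * subst_vol \<Sigma> p"
    using tile_measure(2)[OF s] tile_measure(2)[OF c] subst_tile_measure(2)[OF p] by (simp add: power_mult_distrib)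
  then show "tile_len x = tile_len t + piece_len p"
    using tile_vol_pos[OF t] subst_vol_range[OF p] by (simp add: tile_len_def piece_len_def ln_mult)
qed

lemma substitute_tile:
  assumes t: "similar_tile t" and k: "k < length (rules \<Sigma> (snd t))" and x: "x \<in> set (substitute \<Sigma> k t)"
  obtains p where "p \<in> set (rules \<Sigma> (snd t) ! k)" "similar_tile x" "tile_len x = tile_len t + piece_len p"
proof -
  obtain p where p: "p \<in> set (rules \<Sigma> (snd t) ! k)"
    "x = (\<lambda>x. fst t (piece_iso p (piece_scale p *\<^sub>R x)), piece_type p)"
    using x unfolding substitute_def by auto
  show ?thesis
    by (rule that[OF p(1)]) (use subst_piece[OF t nth_mem[OF k] p(1)] in \<open>simp_all add: p(2)\<close>)
qed

text \<open>The bridge from geometry to branching: a statistic of type and length sees a substituted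
  tile only as offspring born after the length of the tile.\<close>

lemma substitute_map:
  assumes t: "similar_tile t" and k: "k < length (rules \<Sigma> (snd t))"
  shows "map (\<lambda>x. F (snd x) (tile_len x)) (substitute \<Sigma> k t) =
    map (\<lambda>x. F (snd x) (tile_len t + fst x)) (map (map shape) (rules \<Sigma> (snd t)) ! k)"
  using subst_piece(2)[OF t nth_mem[OF k]] k by (simp add: substitute_def shape_def)

lemma substitute_covers:
  assumes t: "similar_tile t" and k: "k < length (rules \<Sigma> (snd t))"
  shows "negligible (tile_set \<Sigma> t - \<Union>(tile_set \<Sigma> ` set (substitute \<Sigma> k t)))"
proof -
  obtain c where c: "similarity (fst t) c" using t by (auto simp: similar_tile_def)
  let ?U = "\<Union>(set (map (\<lambda>p. piece_iso p ` subst_tile \<Sigma> p) (rules \<Sigma> (snd t) ! k)))"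
  have "negligible (prototile \<Sigma> (snd t) - ?U)"
    using rule_partition[OF nth_mem[OF k]] by (rule_tac negligible_subset) (auto simp: is_partition_def)
  then have "negligible (fst t ` (prototile \<Sigma> (snd t) - ?U))"
    by (rule negligible_similarity_image[OF c])
  moreover have "\<Union>(tile_set \<Sigma> ` set (substitute \<Sigma> k t)) = fst t ` ?U"
    by (simp add: tile_set_def substitute_def subst_tile_def image_UN image_image)
  ultimately show ?thesis
    by (rule_tac negligible_subset) (auto simp: tile_set_def)
qed

text \<open>The length of the largest tiles, which are substituted next. For the partition after the
  step it is the threshold at which the population was stopped.\<close>

definition birth :: "('a, 'n) tile list \<Rightarrow> real" where
  "birth P = Min (tile_len ` set P)"

lemma birth_le: "x \<in> set P \<Longrightarrow> birth P \<le> tile_len x"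
  by (simp add: birth_def)

lemma birth_attained: "P \<noteq> [] \<Longrightarrow> \<exists>x\<in>set P. tile_len x = birth P"
proof -
  assume "P \<noteq> []"
  then have "birth P \<in> tile_len ` set P" unfolding birth_def by (intro Min_in) auto
  then show ?thesis by force
qed

lemma maximal_iff:
  assumes P: "P \<noteq> []" "\<And>x. x \<in> set P \<Longrightarrow> similar_tile x"
  shows "q \<in> maximal_indices \<Sigma> P \<longleftrightarrow> q < length P \<and> tile_len (P ! q) = birth P"
proof -
  have le: "tile_vol \<Sigma> x \<le> tile_vol \<Sigma> y \<longleftrightarrow> tile_len y \<le> tile_len x" if "x \<in> set P" "y \<in> set P" for x y
    using that tile_vol_pos P(2) by (simp add: tile_len_def)
  obtain x where x: "x \<in> set P" "tile_len x = birth P" using birth_attained[OF P(1)] by blast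
  show ?thesis
  proof
    assume q: "q \<in> maximal_indices \<Sigma> P"
    then have "q < length P" "tile_len (P ! q) \<le> tile_len x"
      using le[OF x(1), of "P ! q"] x(1) by (auto simp: maximal_indices_def)
    then show "q < length P \<and> tile_len (P ! q) = birth P"
      using x(2) birth_le[of "P ! q" P] by simp
  next
    assume q: "q < length P \<and> tile_len (P ! q) = birth P"
    then show "q \<in> maximal_indices \<Sigma> P"
      using le[of _ "P ! q"] birth_le[of _ P] by (auto simp: maximal_indices_def)
  qed
qed

definition refine :: "(nat \<Rightarrow> nat) \<Rightarrow> ('a, 'n) tile list \<Rightarrow> ('a, 'n) tile list" where
  "refine \<kappa> P = concat (map (\<lambda>q. if q \<in> maximal_indices \<Sigma> P then substitute \<Sigma> (\<kappa> q) (P ! q) else [P ! q]) [0..<length P])"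

lemma finite_maximal [simp]: "finite (maximal_indices \<Sigma> P)"
  by (simp add: maximal_indices_def)

lemma step_support:
  assumes "P' \<in> set_pmf (kakutani_step \<Sigma> P)"
  obtains \<kappa> where "P' = refine \<kappa> P" "\<And>q. q \<in> maximal_indices \<Sigma> P \<Longrightarrow> \<kappa> q < length (rules \<Sigma> (snd (P ! q)))"
proof -
  obtain \<kappa> where k: "\<kappa> \<in> set_pmf (Pi_pmf (maximal_indices \<Sigma> P) 0 (\<lambda>q. rule_pmf \<Sigma> (snd (P ! q))))" "P' = refine \<kappa> P"
    using assms unfolding kakutani_step_def set_map_pmf refine_def by blast
  have "\<kappa> q < length (rules \<Sigma> (snd (P ! q)))" if "q \<in> maximal_indices \<Sigma> P" for q
  proof -
    have "\<kappa> q \<in> set_pmf (rule_pmf \<Sigma> (snd (P ! q)))"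
      using k(1) that by (auto simp: set_Pi_pmf PiE_dflt_def)
    then show ?thesis using pr_set by simp
  qed
  then show ?thesis using that k(2) by blast
qed

lemma finite_step: "finite (set_pmf (kakutani_step \<Sigma> P))"
proof -
  have "finite (set_pmf (Pi_pmf (maximal_indices \<Sigma> P) 0 (\<lambda>q. rule_pmf \<Sigma> (snd (P ! q)))))"
    by (simp add: set_Pi_pmf pr_set finite_PiE_dflt)
  then show ?thesis by (simp add: kakutani_step_def)
qed

text \<open>The rules of different maximal tiles are chosen independently, so the expectation
  factorizes; all other tiles contribute constants.\<close>

lemma expectation_step_prod:
  fixes w :: "('a, 'n) tile \<Rightarrow> real"
  assumes w: "\<And>x. 0 \<le> w x"
  shows "measure_pmf.expectation (kakutani_step \<Sigma> P) (\<lambda>P'. \<Prod>x\<leftarrow>P'. w x) =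
    (\<Prod>q<length P. if q \<in> maximal_indices \<Sigma> P then
       (\<Sum>k<length (rules \<Sigma> (snd (P ! q))). pmf (rule_pmf \<Sigma> (snd (P ! q))) k * (\<Prod>x\<leftarrow>substitute \<Sigma> k (P ! q). w x)) else w (P ! q))"
proof -
  let ?M = "maximal_indices \<Sigma> P"
  let ?C = "\<Prod>q\<in>{..<length P} - ?M. w (P ! q)"
  have sub: "?M \<subseteq> {..<length P}" by (auto simp: maximal_indices_def)
  have split: "(\<Prod>q<length P. if q \<in> ?M then f q else w (P ! q)) = (\<Prod>q\<in>?M. f q) * ?C" for f :: "nat \<Rightarrow> real"
    by (subst prod.subset_diff[OF sub]) (auto intro: prod.cong)
  have list: "(\<Prod>x\<leftarrow>refine \<kappa> P. w x) = (\<Prod>q\<in>?M. \<Prod>x\<leftarrow>substitute \<Sigma> (\<kappa> q) (P ! q). w x) * ?C" for \<kappa>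
  proof -
    have concat: "(\<Prod>x\<leftarrow>concat xss. w x) = (\<Prod>xs\<leftarrow>xss. \<Prod>x\<leftarrow>xs. w x)" for xss
      by (induction xss) auto
    have "(\<Prod>x\<leftarrow>refine \<kappa> P. w x) = (\<Prod>q\<leftarrow>[0..<length P]. if q \<in> ?M then \<Prod>x\<leftarrow>substitute \<Sigma> (\<kappa> q) (P ! q). w x else w (P ! q))"
      unfolding refine_def concat by (simp add: comp_def if_distrib cong: if_cong)
    also have "\<dots> = (\<Prod>q<length P. if q \<in> ?M then \<Prod>x\<leftarrow>substitute \<Sigma> (\<kappa> q) (P ! q). w x else w (P ! q))"
      by (simp add: prod.distinct_set_conv_list[symmetric] atLeast0LessThan)
    finally show ?thesis unfolding split .
  qed
  have "measure_pmf.expectation (kakutani_step \<Sigma> P) (\<lambda>P'. \<Prod>x\<leftarrow>P'. w x) =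
     measure_pmf.expectation (Pi_pmf ?M 0 (\<lambda>q. rule_pmf \<Sigma> (snd (P ! q)))) (\<lambda>\<kappa>. (\<Prod>q\<in>?M. \<Prod>x\<leftarrow>substitute \<Sigma> (\<kappa> q) (P ! q). w x) * ?C)"
    unfolding kakutani_step_def integral_map_pmf refine_def[symmetric] list ..
  also have "\<dots> = measure_pmf.expectation (Pi_pmf ?M 0 (\<lambda>q. rule_pmf \<Sigma> (snd (P ! q)))) (\<lambda>\<kappa>. \<Prod>q\<in>?M. \<Prod>x\<leftarrow>substitute \<Sigma> (\<kappa> q) (P ! q). w x) * ?C"
    by simp
  also have "measure_pmf.expectation (Pi_pmf ?M 0 (\<lambda>q. rule_pmf \<Sigma> (snd (P ! q)))) (\<lambda>\<kappa>. \<Prod>q\<in>?M. \<Prod>x\<leftarrow>substitute \<Sigma> (\<kappa> q) (P ! q). w x) =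
     (\<Prod>q\<in>?M. measure_pmf.expectation (rule_pmf \<Sigma> (snd (P ! q))) (\<lambda>k. \<Prod>x\<leftarrow>substitute \<Sigma> k (P ! q). w x))"
    by (rule expectation_prod_Pi_pmf) (auto intro!: integrable_measure_pmf_finite prod_list_nonneg w simp: pr_set)
  also have "\<dots> = (\<Prod>q\<in>?M. \<Sum>k<length (rules \<Sigma> (snd (P ! q))). pmf (rule_pmf \<Sigma> (snd (P ! q))) k * (\<Prod>x\<leftarrow>substitute \<Sigma> k (P ! q). w x))"
  proof (rule prod.cong[OF refl])
    fix q
    show "measure_pmf.expectation (rule_pmf \<Sigma> (snd (P ! q))) (\<lambda>k. \<Prod>x\<leftarrow>substitute \<Sigma> k (P ! q). w x) =
      (\<Sum>k<length (rules \<Sigma> (snd (P ! q))). pmf (rule_pmf \<Sigma> (snd (P ! q))) k * (\<Prod>x\<leftarrow>substitute \<Sigma> k (P ! q). w x))"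
      by (subst integral_measure_pmf_real[of "{..<length (rules \<Sigma> (snd (P ! q)))}"]) (auto simp: pr_set mult.commute)
  qed
  finally show ?thesis unfolding split .
qed

end

lemma expectation_bind_finite:
  fixes h :: "'b \<Rightarrow> real"
  assumes "finite (set_pmf p)" "\<And>x. x \<in> set_pmf p \<Longrightarrow> finite (set_pmf (f x))"
  shows "measure_pmf.expectation (bind_pmf p f) h = measure_pmf.expectation p (\<lambda>x. measure_pmf.expectation (f x) h)"
  using pmf_expectation_bind[of "set_pmf p" f p h] assms
  by (simp add: integral_measure_pmf_real[of "set_pmf p"] mult.commute)

lemma expectation_mono_finite:
  fixes f g :: "'a \<Rightarrow> real"
  assumes "finite (set_pmf p)" "\<And>x. x \<in> set_pmf p \<Longrightarrow> f x \<le> g x"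
  shows "measure_pmf.expectation p f \<le> measure_pmf.expectation p g"
  by (intro integral_mono_AE integrable_measure_pmf_finite AE_pmfI assms)

lemma expectation_cong:
  fixes f g :: "'a \<Rightarrow> real"
  assumes "\<And>x. x \<in> set_pmf p \<Longrightarrow> f x = g x"
  shows "measure_pmf.expectation p f = measure_pmf.expectation p g"
  by (intro integral_cong_AE AE_pmfI assms) auto

section \<open>Reachable partitions and their law\<close>

context kakutani_system begin

text \<open>The invariant of reachable partitions. Lengths in \<open>list_sums\<close> make
  thresholds sparse; lengths within \<open>longest\<close> of \<open>birth P\<close> make the number
  of tiles comparable to exp (birth P); total volume 1 and the covering determine the volumes in
  \<open>type_vol_eq\<close>.\<close>

definition admissible :: "'n \<Rightarrow> ('a, 'n) tile list \<Rightarrow> bool" where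
  "admissible i P \<longleftrightarrow> P \<noteq> [] \<and>
     (\<forall>x\<in>set P. similar_tile x \<and> tile_len x \<in> list_sums \<and> tile_len x \<le> birth P + longest) \<and>
     (\<Sum>x\<leftarrow>P. exp (- tile_len x)) = 1 \<and>
     negligible (prototile \<Sigma> i - \<Union>(tile_set \<Sigma> ` set P))"

lemma initial_similar: "similar_tile (id, i)"
  unfolding similar_tile_def by (intro exI[of _ 1]) (simp add: similarity_def)

lemma initial_len: "tile_len (id, i) = 0"
  by (simp add: tile_len_def tile_vol_def tile_set_def prototile_measure)

lemma admissible_initial: "admissible i [(id, i)]" "birth [(id, i)] = 0"
proof -
  have "0 \<in> list_sums" unfolding list_sums_def by (intro image_eqI[of _ _ "[]"]) auto
  then show "admissible i [(id, i)]" "birth [(id, i)] = 0"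
    using longest_pos by (simp_all add: admissible_def initial_similar initial_len birth_def tile_set_def)
qed

lemma list_sums_add: "s \<in> list_sums \<Longrightarrow> l \<in> lengths \<Longrightarrow> s + l \<in> list_sums"
proof -
  assume "s \<in> list_sums" "l \<in> lengths"
  then obtain xs where "set xs \<subseteq> lengths" "s = sum_list xs" by (auto simp: list_sums_def)
  then show "s + l \<in> list_sums" using \<open>l \<in> lengths\<close> unfolding list_sums_def
    by (intro image_eqI[of _ _ "l # xs"]) auto
qed

lemma sum_refine:
  "(\<Sum>x\<leftarrow>refine \<kappa> P. F x :: real) = (\<Sum>q<length P. if q \<in> maximal_indices \<Sigma> P
     then \<Sum>x\<leftarrow>substitute \<Sigma> (\<kappa> q) (P ! q). F x else F (P ! q))"
proof -
  have concat: "(\<Sum>x\<leftarrow>concat xss. F x) = (\<Sum>xs\<leftarrow>xss. \<Sum>x\<leftarrow>xs. F x)" for xss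
    by (induction xss) auto
  have "(\<Sum>x\<leftarrow>refine \<kappa> P. F x) = (\<Sum>q\<leftarrow>[0..<length P]. if q \<in> maximal_indices \<Sigma> P
     then \<Sum>x\<leftarrow>substitute \<Sigma> (\<kappa> q) (P ! q). F x else F (P ! q))"
    unfolding refine_def concat by (simp add: comp_def if_distrib cong: if_cong)
  then show ?thesis by (simp add: sum.distinct_set_conv_list[symmetric] atLeast0LessThan)
qed

lemma set_refine:
  "set (refine \<kappa> P) = (\<Union>q<length P. if q \<in> maximal_indices \<Sigma> P then set (substitute \<Sigma> (\<kappa> q) (P ! q)) else {P ! q})"
  unfolding refine_def by (auto split: if_splits simp: atLeast0LessThan)

text \<open>Substituted tiles gain a positive length of at most \<open>longest\<close>, and the
  other tiles were already beyond the minimum; so the threshold strictly increases.\<close>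

lemma admissible_step:
  assumes P: "admissible i P" and P': "P' \<in> set_pmf (kakutani_step \<Sigma> P)"
  shows "admissible i P'" "\<And>x. x \<in> set P' \<Longrightarrow> birth P < tile_len x \<and> tile_len x \<le> birth P + longest"
    "birth P < birth P'"
proof -
  obtain \<kappa> where k: "P' = refine \<kappa> P" "\<And>q. q \<in> maximal_indices \<Sigma> P \<Longrightarrow> \<kappa> q < length (rules \<Sigma> (snd (P ! q)))"
    using step_support[OF P'] by blast
  have ne: "P \<noteq> []" and sim: "\<And>x. x \<in> set P \<Longrightarrow> similar_tile x"
    and sums: "\<And>x. x \<in> set P \<Longrightarrow> tile_len x \<in> list_sums"
    and le: "\<And>x. x \<in> set P \<Longrightarrow> tile_len x \<le> birth P + longest"
    and total: "(\<Sum>x\<leftarrow>P. exp (- tile_len x)) = 1"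
    and cover: "negligible (prototile \<Sigma> i - \<Union>(tile_set \<Sigma> ` set P))"
    using P by (auto simp: admissible_def)
  note max = maximal_iff[OF ne sim]
  have tiles: "similar_tile x \<and> tile_len x \<in> list_sums \<and> birth P < tile_len x \<and> tile_len x \<le> birth P + longest"
    if x: "x \<in> set P'" for x
  proof -
    obtain q where q: "q < length P" "x \<in> (if q \<in> maximal_indices \<Sigma> P then set (substitute \<Sigma> (\<kappa> q) (P ! q)) else {P ! q})"
      using x unfolding k(1) set_refine by blast
    have Pq: "P ! q \<in> set P" using q(1) by simp
    show ?thesis
    proof (cases "q \<in> maximal_indices \<Sigma> P")
      case True
      then have "x \<in> set (substitute \<Sigma> (\<kappa> q) (P ! q))" using q(2) by simp
      from substitute_tile[OF sim[OF Pq] k(2)[OF True] this]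
      obtain p where p: "p \<in> set (rules \<Sigma> (snd (P ! q)) ! \<kappa> q)" "similar_tile x" "tile_len x = tile_len (P ! q) + piece_len p"
        by blast
      show ?thesis
        using p max[of q] True list_sums_add[OF sums[OF Pq] shape_length[OF k(2)[OF True] p(1)]]
          shape_bounds[OF k(2)[OF True] p(1)] by simp
    next
      case False
      then have "x = P ! q" using q(2) by simp
      moreover have "tile_len (P ! q) \<noteq> birth P" using False q(1) max[of q] by simp
      ultimately show ?thesis using sim[OF Pq] sums[OF Pq] le[OF Pq] birth_le[OF Pq] by simp
    qed
  qed
  then show "\<And>x. x \<in> set P' \<Longrightarrow> birth P < tile_len x \<and> tile_len x \<le> birth P + longest" by blast
  have total': "(\<Sum>x\<leftarrow>P'. exp (- tile_len x)) = 1"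
  proof -
    have "(\<Sum>x\<leftarrow>P'. exp (- tile_len x)) = (\<Sum>q<length P. exp (- tile_len (P ! q)))"
      unfolding k(1) sum_refine
    proof (intro sum.cong refl)
      fix q assume "q \<in> {..<length P}"
      then have Pq: "P ! q \<in> set P" by simp
      have "(\<Sum>x\<leftarrow>substitute \<Sigma> (\<kappa> q) (P ! q). exp (- tile_len x)) = exp (- tile_len (P ! q))"
        if q: "q \<in> maximal_indices \<Sigma> P"
      proof -
        have "(\<Sum>x\<leftarrow>substitute \<Sigma> (\<kappa> q) (P ! q). exp (- tile_len x)) =
          (\<Sum>x\<leftarrow>map (map shape) (rules \<Sigma> (snd (P ! q))) ! \<kappa> q. exp (- (tile_len (P ! q) + fst x)))"
          unfolding substitute_map[OF sim[OF Pq] k(2)[OF q], of "\<lambda>j l. exp (- l)"] ..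
        also have "\<dots> = exp (- tile_len (P ! q)) * (\<Sum>x\<leftarrow>map (map shape) (rules \<Sigma> (snd (P ! q))) ! \<kappa> q. exp (- fst x))"
          by (simp only: minus_add_distrib exp_add sum_list_const_mult)
        also have "(\<Sum>x\<leftarrow>map (map shape) (rules \<Sigma> (snd (P ! q))) ! \<kappa> q. exp (- fst x)) = 1"
          by (rule R_sum[where i = "snd (P ! q)"]) (use k(2)[OF q] in simp)
        finally show ?thesis by simp
      qed
      then show "(if q \<in> maximal_indices \<Sigma> P then \<Sum>x\<leftarrow>substitute \<Sigma> (\<kappa> q) (P ! q). exp (- tile_len x)
          else exp (- tile_len (P ! q))) = exp (- tile_len (P ! q))" by simp
    qed
    also have "\<dots> = 1" using total by (simp add: sum_list_sum_nth atLeast0LessThan)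
    finally show ?thesis .
  qed
  then have ne': "P' \<noteq> []" by auto
  show bb: "birth P < birth P'" using birth_attained[OF ne'] tiles by fastforce
  have "negligible (prototile \<Sigma> i - \<Union>(tile_set \<Sigma> ` set P'))"
  proof -
    let ?N = "\<lambda>x. tile_set \<Sigma> x - \<Union>(tile_set \<Sigma> ` set P')"
    have "negligible (?N x)" if x: "x \<in> set P" for x
    proof -
      obtain q where q: "q < length P" "x = P ! q" using x by (auto simp: in_set_conv_nth)
      show ?thesis
      proof (cases "q \<in> maximal_indices \<Sigma> P")
        case True
        have "set (substitute \<Sigma> (\<kappa> q) (P ! q)) \<subseteq> set P'"
          unfolding k(1) set_refine using q(1) True by auto
        then have "?N x \<subseteq> tile_set \<Sigma> (P ! q) - \<Union>(tile_set \<Sigma> ` set (substitute \<Sigma> (\<kappa> q) (P ! q)))"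
          unfolding q(2) by blast
        with substitute_covers[OF sim[OF x, unfolded q(2)] k(2)[OF True]] show ?thesis
          by (rule negligible_subset)
      next
        case False
        then have "x \<in> set P'" unfolding k(1) set_refine using q by auto
        then have "?N x = {}" by blast
        then show ?thesis by simp
      qed
    qed
    then have "negligible (\<Union>(?N ` set P))" by (intro negligible_Union) auto
    with cover have "negligible ((prototile \<Sigma> i - \<Union>(tile_set \<Sigma> ` set P)) \<union> \<Union>(?N ` set P))"
      by (rule negligible_Un)
    then show ?thesis by (rule negligible_subset) blast
  qed
  then show "admissible i P'"
    unfolding admissible_def using ne' tiles total' bb by force
qed

text \<open>Unfolds the first step, as the martingale argument in \<open>stopped_bound\<close>
  needs; \<open>law_Suc\<close> unfolds the last one, as the Markov property needs.\<close>

primrec law :: "nat \<Rightarrow> ('a, 'n) tile list \<Rightarrow> ('a, 'n) tile list pmf" where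
  "law 0 P = return_pmf P"
| "law (Suc n) P = kakutani_step \<Sigma> P \<bind> law n"

lemma law_Suc: "law (Suc n) P = law n P \<bind> kakutani_step \<Sigma>"
proof (induction n arbitrary: P)
  case 0
  then show ?case by (simp add: bind_return_pmf bind_return_pmf' fun_eq_iff cong: bind_pmf_cong)
next
  case (Suc n)
  have "law (Suc (Suc n)) P = kakutani_step \<Sigma> P \<bind> law (Suc n)" by simp
  also have "\<dots> = kakutani_step \<Sigma> P \<bind> (\<lambda>x. law n x \<bind> kakutani_step \<Sigma>)"
    using Suc by (intro bind_pmf_cong) auto
  finally show ?case by (simp add: bind_assoc_pmf)
qed

lemma finite_law: "finite (set_pmf (law n P))"
  by (induction n arbitrary: P) (auto simp: finite_step)

lemma law_admissible:
  "admissible i P \<Longrightarrow> Q \<in> set_pmf (law n P) \<Longrightarrow> admissible i Q \<and> birth P \<le> birth Q"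
proof (induction n arbitrary: P)
  case (Suc n)
  then obtain P' where P': "P' \<in> set_pmf (kakutani_step \<Sigma> P)" "Q \<in> set_pmf (law n P')" by auto
  then show ?case using Suc.IH[OF admissible_step(1)[OF Suc.prems(1) P'(1)] P'(2)]
    admissible_step(3)[OF Suc.prems(1) P'(1)] by simp
qed simp

lemma birth_in_list_sums: "admissible i P \<Longrightarrow> birth P \<in> list_sums"
  using birth_attained[of P] unfolding admissible_def by metis

text \<open>The thresholds passed on the way are distinct, so n steps use up n + 1 elements of
  \<open>list_sums\<close>; with \<open>card_bounded\<close> this makes \<open>birth\<close>
  diverge.\<close>

lemma law_birth_history:
  "admissible i P \<Longrightarrow> Q \<in> set_pmf (law n P) \<Longrightarrow>
     \<exists>F. finite F \<and> F \<subseteq> list_sums \<and> (\<forall>t\<in>F. t \<le> birth Q) \<and> card F = Suc n"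
proof (induction n arbitrary: Q)
  case 0
  then show ?case using birth_in_list_sums by (intro exI[of _ "{birth P}"]) auto
next
  case (Suc n)
  then obtain Q' where Q': "Q' \<in> set_pmf (law n P)" "Q \<in> set_pmf (kakutani_step \<Sigma> Q')"
    unfolding law_Suc by auto
  obtain F where F: "finite F" "F \<subseteq> list_sums" "\<forall>t\<in>F. t \<le> birth Q'" "card F = Suc n"
    using Suc.IH[OF Suc.prems(1) Q'(1)] by blast
  have ad: "admissible i Q'" using law_admissible[OF Suc.prems(1) Q'(1)] by simp
  have lt: "birth Q' < birth Q" by (rule admissible_step(3)[OF ad Q'(2)])
  have "birth Q \<notin> F" using F(3) lt by force
  moreover have "birth Q \<in> list_sums" by (rule birth_in_list_sums[OF admissible_step(1)[OF ad Q'(2)]])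
  ultimately show ?case using F lt by (intro exI[of _ "insert (birth Q) F"]) force
qed

lemma birth_diverges:
  assumes "admissible i P"
  shows "\<exists>N. \<forall>n\<ge>N. \<forall>Q\<in>set_pmf (law n P). X < birth Q"
proof -
  obtain N where N: "\<forall>F. finite F \<and> F \<subseteq> list_sums \<and> (\<forall>t\<in>F. t \<le> X) \<longrightarrow> card F \<le> N"
    using card_bounded[of X] ..
  have "X < birth Q" if n: "N \<le> n" and Q: "Q \<in> set_pmf (law n P)" for n Q
  proof (rule ccontr)
    assume le: "\<not> X < birth Q"
    obtain F where F: "finite F" "F \<subseteq> list_sums" "\<forall>t\<in>F. t \<le> birth Q" "card F = Suc n"
      using law_birth_history[OF assms Q] by blast
    have "\<forall>t\<in>F. t \<le> X" using F(3) le by auto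
    then have "card F \<le> N" using N F(1,2) by blast
    then show False using F(4) n by simp
  qed
  then show ?thesis by blast
qed

text \<open>Averages over consecutive pairs of partitions. \<open>F\<close> must see both, since the
  threshold of the second is \<open>birth\<close> of the first.\<close>

definition transition :: "nat \<Rightarrow> ('a, 'n) tile list \<Rightarrow> (('a, 'n) tile list \<Rightarrow> ('a, 'n) tile list \<Rightarrow> real) \<Rightarrow> real" where
  "transition n P F = measure_pmf.expectation (law n P) (\<lambda>Q. measure_pmf.expectation (kakutani_step \<Sigma> Q) (F Q))"

lemma transition_0: "transition 0 P F = measure_pmf.expectation (kakutani_step \<Sigma> P) (F P)"
  by (simp add: transition_def)

lemma transition_Suc: "transition (Suc n) P F = measure_pmf.expectation (kakutani_step \<Sigma> P) (\<lambda>P'. transition n P' F)"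
  unfolding transition_def law.simps by (rule expectation_bind_finite) (auto simp: finite_step finite_law)

lemma transition_mono:
  assumes "\<And>Q P'. Q \<in> set_pmf (law n P) \<Longrightarrow> P' \<in> set_pmf (kakutani_step \<Sigma> Q) \<Longrightarrow> F Q P' \<le> G Q P'"
  shows "transition n P F \<le> transition n P G"
  unfolding transition_def by (intro expectation_mono_finite finite_law finite_step assms)

lemma transition_add: "transition n P (\<lambda>Q P'. F Q P' + G Q P') = transition n P F + transition n P G"
  unfolding transition_def
  by (simp add: Bochner_Integration.integral_add integrable_measure_pmf_finite finite_law finite_step)

lemma transition_cmult: "transition n P (\<lambda>Q P'. c * F Q P') = c * transition n P F"
  unfolding transition_def by simp

lemma transition_sum:
  "finite A \<Longrightarrow> transition n P (\<lambda>Q P'. \<Sum>a\<in>A. F a Q P') = (\<Sum>a\<in>A. transition n P (F a))"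
  by (induction A rule: finite_induct) (simp_all add: transition_add, simp add: transition_def)

lemma transition_const: "transition n P (\<lambda>Q P'. c) = c"
  unfolding transition_def by simp

text \<open>While \<open>t\<close> is not yet passed, this is the conditional expectation of the
  product of \<open>h\<close> over the population stopped at \<open>t\<close>: the current tiles
  evolve independently, each contributing its \<open>mgf\<close>.\<close>

definition potential :: "('n \<Rightarrow> real \<Rightarrow> real) \<Rightarrow> real \<Rightarrow> ('a, 'n) tile list \<Rightarrow> real" where
  "potential h t P = (\<Prod>x\<leftarrow>P. mgf h (snd x) (t - tile_len x))"

text \<open>A step unfolds the recursion of \<open>mgf\<close> at exactly the tiles it substitutes, so the potential is a
  martingale until the threshold \<open>t\<close> is passed.\<close>

lemma potential_step:
  assumes h: "\<And>i t. 0 \<le> h i t" and P: "admissible i P" and t: "birth P \<le> t"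
  shows "measure_pmf.expectation (kakutani_step \<Sigma> P) (potential h t) = potential h t P"
proof -
  have ne: "P \<noteq> []" and sim: "\<And>x. x \<in> set P \<Longrightarrow> similar_tile x" using P by (auto simp: admissible_def)
  let ?w = "\<lambda>x. mgf h (snd x) (t - tile_len x)"
  have "measure_pmf.expectation (kakutani_step \<Sigma> P) (potential h t) = (\<Prod>q<length P. ?w (P ! q))"
    unfolding potential_def expectation_step_prod[where w = ?w, OF mgf_nonneg[OF h]]
  proof (intro prod.cong refl)
    fix q assume "q \<in> {..<length P}"
    then have Pq: "P ! q \<in> set P" by simp
    have "(\<Sum>k<length (rules \<Sigma> (snd (P ! q))). pmf (rule_pmf \<Sigma> (snd (P ! q))) k * (\<Prod>x\<leftarrow>substitute \<Sigma> k (P ! q). ?w x)) = ?w (P ! q)"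
      if q: "q \<in> maximal_indices \<Sigma> P"
    proof -
      have "0 \<le> t - tile_len (P ! q)" using maximal_iff[OF ne sim, of q] q t by simp
      then have "?w (P ! q) = (\<Sum>k<length (rules \<Sigma> (snd (P ! q))). pmf (rule_pmf \<Sigma> (snd (P ! q))) k *
          (\<Prod>x\<leftarrow>map (map shape) (rules \<Sigma> (snd (P ! q))) ! k. mgf h (snd x) (t - tile_len (P ! q) - fst x)))"
        by (subst mgf_nonneg_time) simp_all
      also have "\<dots> = (\<Sum>k<length (rules \<Sigma> (snd (P ! q))). pmf (rule_pmf \<Sigma> (snd (P ! q))) k * (\<Prod>x\<leftarrow>substitute \<Sigma> k (P ! q). ?w x))"
      proof (intro sum.cong refl)
        fix k assume "k \<in> {..<length (rules \<Sigma> (snd (P ! q)))}"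
        then have k: "k < length (rules \<Sigma> (snd (P ! q)))" by simp
        show "pmf (rule_pmf \<Sigma> (snd (P ! q))) k * (\<Prod>x\<leftarrow>map (map shape) (rules \<Sigma> (snd (P ! q))) ! k. mgf h (snd x) (t - tile_len (P ! q) - fst x)) =
          pmf (rule_pmf \<Sigma> (snd (P ! q))) k * (\<Prod>x\<leftarrow>substitute \<Sigma> k (P ! q). ?w x)"
          unfolding substitute_map[OF sim[OF Pq] k, of "\<lambda>j l. mgf h j (t - l)"] by (simp only: diff_diff_eq)
      qed
      finally show ?thesis by simp
    qed
    then show "(if q \<in> maximal_indices \<Sigma> P then \<Sum>k<length (rules \<Sigma> (snd (P ! q))). pmf (rule_pmf \<Sigma> (snd (P ! q))) k *
        (\<Prod>x\<leftarrow>substitute \<Sigma> k (P ! q). ?w x) else ?w (P ! q)) = ?w (P ! q)" by simp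
  qed
  also have "\<dots> = (\<Prod>q\<leftarrow>[0..<length P]. ?w (P ! q))"
    by (simp add: prod.distinct_set_conv_list[symmetric] atLeast0LessThan)
  also have "\<dots> = (\<Prod>x\<leftarrow>map ((!) P) [0..<length P]. ?w x)" by (simp add: comp_def)
  finally show ?thesis unfolding potential_def map_nth .
qed

lemma potential_nonneg: "(\<And>i t. 0 \<le> h i t) \<Longrightarrow> 0 \<le> potential h t P"
  unfolding potential_def by (intro prod_list_nonneg) (auto intro: mgf_nonneg)

definition terminal :: "('n \<Rightarrow> real \<Rightarrow> real) \<Rightarrow> real \<Rightarrow> ('a, 'n) tile list \<Rightarrow> real" where
  "terminal h t P = (\<Prod>x\<leftarrow>P. h (snd x) (t - tile_len x))"

text \<open>If \<open>birth Q = t\<close>, every tile of \<open>P'\<close> has passed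
  \<open>t\<close>, so the product of \<open>h\<close> is the potential itself. Dropping the
  nonnegative rest leaves a bound at the fixed value \<open>t\<close>, although it is random whether
  and when \<open>t\<close> occurs as a threshold.\<close>

lemma stopped_bound:
  assumes h: "\<And>i t. 0 \<le> h i t"
  shows "admissible i P \<Longrightarrow> transition n P (\<lambda>Q P'. if birth Q = t then terminal h t P' else 0) \<le> potential h t P"
proof (induction n arbitrary: P)
  case 0
  show ?case
  proof (cases "birth P = t")
    case True
    have "terminal h t P' = potential h t P'" if "P' \<in> set_pmf (kakutani_step \<Sigma> P)" for P'
    proof -
      have "map (\<lambda>x. h (snd x) (t - tile_len x)) P' = map (\<lambda>x. mgf h (snd x) (t - tile_len x)) P'"
        using admissible_step(2)[OF 0 that] True by (intro map_cong refl) (simp add: mgf_neg)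
      then show ?thesis unfolding terminal_def potential_def by (simp only:)
    qed
    then have "measure_pmf.expectation (kakutani_step \<Sigma> P) (terminal h t) = measure_pmf.expectation (kakutani_step \<Sigma> P) (potential h t)"
      by (rule expectation_cong)
    then show ?thesis using potential_step[OF h 0] True by (simp add: transition_0)
  qed (simp add: transition_0 potential_nonneg h)
next
  case (Suc n)
  show ?case
  proof (cases "birth P \<le> t")
    case True
    have "transition (Suc n) P (\<lambda>Q P'. if birth Q = t then terminal h t P' else 0) \<le> measure_pmf.expectation (kakutani_step \<Sigma> P) (potential h t)"
      unfolding transition_Suc by (intro expectation_mono_finite finite_step Suc.IH admissible_step(1)[OF Suc.prems])
    then show ?thesis using potential_step[OF h Suc.prems True] by simp
  next
    case False
    \<comment> \<open>Thresholds never decrease, so \<open>t\<close> can no longer occur.\<close>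
    have "transition (Suc n) P (\<lambda>Q P'. if birth Q = t then terminal h t P' else 0) \<le> transition (Suc n) P (\<lambda>Q P'. 0)"
    proof (rule transition_mono)
      fix Q P' assume "Q \<in> set_pmf (law (Suc n) P)"
      then have "birth P \<le> birth Q" using law_admissible[OF Suc.prems] by blast
      then show "(if birth Q = t then terminal h t P' else 0) \<le> 0" using False by auto
    qed
    then show ?thesis using potential_nonneg[where h = h and t = t and P = P, OF h] by (simp only: transition_const)
  qed
qed

section \<open>Concentration of tile statistics\<close>

definition tally :: "('n \<Rightarrow> real \<Rightarrow> real) \<Rightarrow> real \<Rightarrow> ('a, 'n) tile list \<Rightarrow> real" where
  "tally f t P = (\<Sum>x\<leftarrow>P. f (snd x) (t - tile_len x))"

text \<open>A Chernoff bound for each possible threshold \<open>t\<close>, weighted with exp t,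
  followed by a union bound. The margin between z + \<epsilon> and z + 2 \<epsilon> yields the
  factor exp (- \<theta> * \<epsilon> * exp t).\<close>

lemma upper_deviation:
  assumes f: "\<And>i t. t < 0 \<Longrightarrow> \<bar>f i t\<bar> \<le> 1" and e: "0 < \<epsilon>" and d: "0 < \<delta>"
    and lim: "\<forall>\<^sub>F t in at_top. \<forall>i. exp (- t) * mean f i t \<le> z + \<epsilon> / 2"
  shows "\<exists>N. \<forall>n\<ge>N. transition n [(id, i)] (\<lambda>Q P'. if exp (birth Q) * (z + 2 * \<epsilon>) < tally f (birth Q) P'
    then exp (birth Q) else 0) \<le> \<delta>"
proof -
  obtain \<theta> T where \<theta>: "0 < \<theta>" and T: "\<And>i t. T \<le> t \<Longrightarrow> mgf (\<lambda>i t. exp (\<theta> * f i t)) i t \<le> exp (\<theta> * (exp t * (z + \<epsilon>)))"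
    using mgf_exponential_bound[OF f e lim] by blast
  have te: "0 < \<theta> * \<epsilon>" using \<theta> e by simp
  obtain X where X: "\<forall>F. finite F \<and> F \<subseteq> list_sums \<and> (\<forall>t\<in>F. X \<le> t) \<longrightarrow> (\<Sum>t\<in>F. exp (t - (\<theta> * \<epsilon>) * exp t)) \<le> \<delta>"
    using double_exponential_sum[OF te d] ..
  obtain N where N: "\<forall>n\<ge>N. \<forall>Q\<in>set_pmf (law n [(id, i)]). max X T < birth Q"
    using birth_diverges[OF admissible_initial(1)[of i], of "max X T"] ..
  let ?h = "\<lambda>i t. exp (\<theta> * f i t)"
  show ?thesis
  proof (intro exI[of _ N] allI impI)
    fix n assume n: "N \<le> n"
    \<comment> \<open>The thresholds possible at step \<open>n\<close>: a finite set, lying far out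
      since \<open>n\<close> is large.\<close>
    define A where "A = birth ` set_pmf (law n [(id, i)])"
    have "finite A" by (simp add: A_def finite_law)
    moreover have "A \<subseteq> list_sums"
      unfolding A_def using law_admissible[OF admissible_initial(1)] birth_in_list_sums by blast
    moreover have "\<forall>t\<in>A. X \<le> t" "\<forall>t\<in>A. T \<le> t"
      unfolding A_def using N n by (auto simp: less_imp_le)
    ultimately have A: "finite A" "A \<subseteq> list_sums" "\<forall>t\<in>A. X \<le> t" "\<forall>t\<in>A. T \<le> t" by blast+
    \<comment> \<open>The weight exp t times the Chernoff normalization: on the bad event c t *
      \<open>terminal\<close> is at least exp t.\<close>
    define c where "c t = exp (t - \<theta> * (exp t * (z + 2 * \<epsilon>)))" for t
    have "transition n [(id, i)] (\<lambda>Q P'. if exp (birth Q) * (z + 2 * \<epsilon>) < tally f (birth Q) P' then exp (birth Q) else 0)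
      \<le> transition n [(id, i)] (\<lambda>Q P'. \<Sum>t\<in>A. c t * (if birth Q = t then terminal ?h t P' else 0))"
    proof (rule transition_mono)
      fix Q P' assume "Q \<in> set_pmf (law n [(id, i)])"
      then have "birth Q \<in> A" by (simp add: A_def)
      then have "(\<Sum>t\<in>A. c t * (if birth Q = t then terminal ?h t P' else 0)) = c (birth Q) * terminal ?h (birth Q) P'"
        using A(1) by (subst sum.remove[of _ "birth Q"]) (auto intro!: sum.neutral)
      also have "\<dots> = exp (birth Q + \<theta> * (tally f (birth Q) P' - exp (birth Q) * (z + 2 * \<epsilon>)))"
        unfolding terminal_def prod_list_exp c_def exp_add[symmetric] tally_def
        by (simp add: sum_list_const_mult algebra_simps)
      finally have eq: "(\<Sum>t\<in>A. c t * (if birth Q = t then terminal ?h t P' else 0)) = \<dots>" .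
      show "(if exp (birth Q) * (z + 2 * \<epsilon>) < tally f (birth Q) P' then exp (birth Q) else 0)
        \<le> (\<Sum>t\<in>A. c t * (if birth Q = t then terminal ?h t P' else 0))"
        unfolding eq using \<theta> by auto
    qed
    also have "\<dots> = (\<Sum>t\<in>A. c t * transition n [(id, i)] (\<lambda>Q P'. if birth Q = t then terminal ?h t P' else 0))"
      by (simp only: transition_sum[OF A(1)] transition_cmult)
    also have "\<dots> \<le> (\<Sum>t\<in>A. exp (t - (\<theta> * \<epsilon>) * exp t))"
    proof (rule sum_mono)
      fix t assume t: "t \<in> A"
      have "transition n [(id, i)] (\<lambda>Q P'. if birth Q = t then terminal ?h t P' else 0) \<le> potential ?h t [(id, i)]"
        by (rule stopped_bound[OF _ admissible_initial(1)]) simp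
      also have "\<dots> = mgf ?h i t" by (simp add: potential_def initial_len)
      also have "\<dots> \<le> exp (\<theta> * (exp t * (z + \<epsilon>)))" using T A(4) t by blast
      finally have "c t * transition n [(id, i)] (\<lambda>Q P'. if birth Q = t then terminal ?h t P' else 0)
        \<le> c t * exp (\<theta> * (exp t * (z + \<epsilon>)))" by (intro mult_left_mono) (auto simp: c_def)
      also have "\<dots> = exp (t - (\<theta> * \<epsilon>) * exp t)"
        unfolding c_def exp_add[symmetric] by (simp add: algebra_simps)
      finally show "c t * transition n [(id, i)] (\<lambda>Q P'. if birth Q = t then terminal ?h t P' else 0) \<le> exp (t - (\<theta> * \<epsilon>) * exp t)" .
    qed
    also have "\<dots> \<le> \<delta>" using X A by simp
    finally show "transition n [(id, i)] (\<lambda>Q P'. if exp (birth Q) * (z + 2 * \<epsilon>) < tally f (birth Q) P' then exp (birth Q) else 0) \<le> \<delta>" .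
  qed
qed

text \<open>The total volume is 1 and each tile has volume at least exp (- longest - birth P), so
  there are at most exp (longest + birth P) tiles. This worst-case bound is used on bad
  events.\<close>

lemma tally_bound:
  assumes P: "admissible i P" and P': "P' \<in> set_pmf (kakutani_step \<Sigma> P)"
    and f: "\<And>i t. t < 0 \<Longrightarrow> \<bar>f i t\<bar> \<le> 1"
  shows "\<bar>tally f (birth P) P'\<bar> \<le> exp longest * exp (birth P)"
proof -
  note st = admissible_step(2)[OF P P']
  have "\<bar>tally f (birth P) P'\<bar> \<le> (\<Sum>x\<leftarrow>P'. \<bar>f (snd x) (birth P - tile_len x)\<bar>)"
    unfolding tally_def using sum_list_abs[of "map (\<lambda>x. f (snd x) (birth P - tile_len x)) P'"] by (simp add: comp_def)
  also have "\<dots> \<le> (\<Sum>x\<leftarrow>P'. exp longest * exp (birth P) * exp (- tile_len x))"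
  proof (rule sum_list_mono)
    fix x assume x: "x \<in> set P'"
    have "\<bar>f (snd x) (birth P - tile_len x)\<bar> \<le> 1" using st[OF x] by (intro f) simp
    also have "1 \<le> exp (longest + birth P + - tile_len x)" using st[OF x] by simp
    also have "\<dots> = exp longest * exp (birth P) * exp (- tile_len x)" by (simp only: exp_add)
    finally show "\<bar>f (snd x) (birth P - tile_len x)\<bar> \<le> exp longest * exp (birth P) * exp (- tile_len x)" .
  qed
  also have "\<dots> = exp longest * exp (birth P) * (\<Sum>x\<leftarrow>P'. exp (- tile_len x))"
    by (rule sum_list_const_mult)
  also have "(\<Sum>x\<leftarrow>P'. exp (- tile_len x)) = 1"
    using admissible_step(1)[OF P P'] by (simp add: admissible_def)
  finally show ?thesis by simp
qed

lemma birth_nonneg: "Q \<in> set_pmf (law n [(id, i)]) \<Longrightarrow> 0 \<le> birth Q"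
  using law_admissible[OF admissible_initial(1)[of i]] admissible_initial(2)[of i] by fastforce

lemma tally_uminus: "tally (\<lambda>i t. - f i t) t P = - tally f t P"
  unfolding tally_def uminus_sum_list_map by (simp add: comp_def)

text \<open>Off the bad events the deviation is at most 2 \<eta> * exp (birth Q); on them
  \<open>tally_bound\<close> gives K * exp (birth Q), a weight that \<open>upper_deviation\<close>
  already includes. Counts need the first estimate, relative to the expected exp (birth Q); volumes
  need the second, normalized path by path.\<close>

lemma tally_concentration:
  assumes f: "\<And>i t. t < 0 \<Longrightarrow> \<bar>f i t\<bar> \<le> 1" and e: "0 < \<epsilon>"
    and lim: "\<And>\<epsilon>. 0 < \<epsilon> \<Longrightarrow> \<forall>\<^sub>F t in at_top. \<forall>i. \<bar>exp (- t) * mean f i t - z\<bar> \<le> \<epsilon>"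
  shows "\<exists>N. \<forall>n\<ge>N.
    transition n [(id, i)] (\<lambda>Q P'. \<bar>tally f (birth Q) P' - z * exp (birth Q)\<bar>) \<le> \<epsilon> * transition n [(id, i)] (\<lambda>Q P'. exp (birth Q)) \<and>
    transition n [(id, i)] (\<lambda>Q P'. \<bar>exp (- birth Q) * tally f (birth Q) P' - z\<bar>) \<le> \<epsilon>"
proof -
  define K where "K = exp longest + \<bar>z\<bar>"
  have K: "0 < K" unfolding K_def by (simp add: add_pos_nonneg)
  \<comment> \<open>2 \<eta> = \<epsilon> / 2 serves the good paths, 2 K \<delta> = \<epsilon> / 2
    the two bad events.\<close>
  define \<eta> where "\<eta> = \<epsilon> / 4"
  define \<delta> where "\<delta> = \<epsilon> / (4 * K)"
  have \<eta>: "0 < \<eta>" and \<delta>: "0 < \<delta>" using e K by (auto simp: \<eta>_def \<delta>_def)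
  have \<eta>2: "0 < \<eta> / 2" using \<eta> by simp
  let ?P = "[(id, i)]"
  define U where "U Q P' = (if exp (birth Q) * (z + 2 * \<eta>) < tally f (birth Q) P' then exp (birth Q) else 0)" for Q P'
  define L where "L Q P' = (if exp (birth Q) * (- z + 2 * \<eta>) < tally (\<lambda>i t. - f i t) (birth Q) P' then exp (birth Q) else 0)" for Q P'
  have "\<forall>\<^sub>F t in at_top. \<forall>i. exp (- t) * mean f i t \<le> z + \<eta> / 2"
    using lim[OF \<eta>2]
  proof eventually_elim
    case (elim t)
    show ?case
    proof
      fix i
      have "\<bar>exp (- t) * mean f i t - z\<bar> \<le> \<eta> / 2" using elim by blast
      then show "exp (- t) * mean f i t \<le> z + \<eta> / 2" by linarith
    qed
  qed
  from upper_deviation[OF f \<eta> \<delta> this]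
  obtain N1 where N1: "\<forall>n\<ge>N1. transition n ?P U \<le> \<delta>" unfolding U_def by blast
  have lim': "\<forall>\<^sub>F t in at_top. \<forall>i. exp (- t) * mean (\<lambda>i t. - f i t) i t \<le> - z + \<eta> / 2"
    using lim[OF \<eta>2]
  proof eventually_elim
    case (elim t)
    show ?case
    proof
      fix i
      have "\<bar>exp (- t) * mean f i t - z\<bar> \<le> \<eta> / 2" using elim by blast
      then show "exp (- t) * mean (\<lambda>i t. - f i t) i t \<le> - z + \<eta> / 2" unfolding mean_uminus mult_minus_right by linarith
    qed
  qed
  have f': "\<bar>- f i t\<bar> \<le> 1" if "t < 0" for i t using f[OF that] by simp
  from upper_deviation[OF f' \<eta> \<delta> lim']
  obtain N2 where N2: "\<forall>n\<ge>N2. transition n ?P L \<le> \<delta>" unfolding L_def by blast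
  have UL: "0 \<le> U Q P'" "0 \<le> L Q P'" for Q P' by (auto simp: U_def L_def)
  show ?thesis
  proof (intro exI[of _ "max N1 N2"] allI impI)
    fix n assume n: "max N1 N2 \<le> n"
    have small: "transition n ?P (\<lambda>Q P'. K * (U Q P' + L Q P')) \<le> \<epsilon> / 2"
    proof -
      have "transition n ?P (\<lambda>Q P'. K * (U Q P' + L Q P')) = K * (transition n ?P U + transition n ?P L)"
        by (simp only: transition_cmult transition_add)
      also have "\<dots> \<le> K * (\<delta> + \<delta>)" using N1 N2 n K by (intro mult_left_mono add_mono) auto
      also have "\<dots> = \<epsilon> / 2" using K by (simp add: \<delta>_def)
      finally show ?thesis .
    qed
    have point: "\<bar>tally f (birth Q) P' - z * exp (birth Q)\<bar> \<le> \<epsilon> / 2 * exp (birth Q) + K * (U Q P' + L Q P')"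
      if Q: "Q \<in> set_pmf (law n ?P)" "P' \<in> set_pmf (kakutani_step \<Sigma> Q)" for Q P'
    proof (cases "exp (birth Q) * (z + 2 * \<eta>) < tally f (birth Q) P' \<or> exp (birth Q) * (- z + 2 * \<eta>) < tally (\<lambda>i t. - f i t) (birth Q) P'")
      case True
      have ad: "admissible i Q" using law_admissible[OF admissible_initial(1) Q(1)] by simp
      have "\<bar>tally f (birth Q) P' - z * exp (birth Q)\<bar> \<le> \<bar>tally f (birth Q) P'\<bar> + \<bar>z\<bar> * exp (birth Q)"
        using abs_triangle_ineq4[of "tally f (birth Q) P'" "z * exp (birth Q)"] by (simp add: abs_mult)
      also have "\<dots> \<le> K * exp (birth Q)"
        using tally_bound[OF ad Q(2) f] by (simp add: K_def distrib_right)
      also have "\<dots> \<le> K * (U Q P' + L Q P')"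
        using True K by (intro mult_left_mono) (auto simp: U_def L_def)
      also have "\<dots> \<le> \<epsilon> / 2 * exp (birth Q) + K * (U Q P' + L Q P')" using e by simp
      finally show ?thesis .
    next
      case False
      then have "tally f (birth Q) P' \<le> z * exp (birth Q) + \<epsilon> / 2 * exp (birth Q)"
        "- tally f (birth Q) P' \<le> - (z * exp (birth Q)) + \<epsilon> / 2 * exp (birth Q)"
        by (simp_all add: tally_uminus \<eta>_def not_less algebra_simps)
      then have "\<bar>tally f (birth Q) P' - z * exp (birth Q)\<bar> \<le> \<epsilon> / 2 * exp (birth Q)" by linarith
      moreover have "0 \<le> K * (U Q P' + L Q P')" using K UL by simp
      ultimately show ?thesis by linarith
    qed
    have "transition n ?P (\<lambda>Q P'. \<bar>tally f (birth Q) P' - z * exp (birth Q)\<bar>) \<le>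
      transition n ?P (\<lambda>Q P'. \<epsilon> / 2 * exp (birth Q) + K * (U Q P' + L Q P'))"
      by (rule transition_mono) (rule point)
    also have "\<dots> = \<epsilon> / 2 * transition n ?P (\<lambda>Q P'. exp (birth Q)) + transition n ?P (\<lambda>Q P'. K * (U Q P' + L Q P'))"
      unfolding transition_add transition_cmult ..
    also have "\<dots> \<le> \<epsilon> * transition n ?P (\<lambda>Q P'. exp (birth Q))"
    proof -
      \<comment> \<open>The expected exp (birth Q) is at least 1, so the absolute error \<epsilon> /
        2 is also a relative one.\<close>
      have "transition n ?P (\<lambda>Q P'. 1) \<le> transition n ?P (\<lambda>Q P'. exp (birth Q))"
        by (rule transition_mono) (simp add: birth_nonneg)
      then have "\<epsilon> / 2 * 1 \<le> \<epsilon> / 2 * transition n ?P (\<lambda>Q P'. exp (birth Q))"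
        using e by (intro mult_left_mono) (simp_all only: transition_const)
      then show ?thesis using small by linarith
    qed
    finally have 1: "transition n ?P (\<lambda>Q P'. \<bar>tally f (birth Q) P' - z * exp (birth Q)\<bar>) \<le> \<epsilon> * transition n ?P (\<lambda>Q P'. exp (birth Q))" .
    have "transition n ?P (\<lambda>Q P'. \<bar>exp (- birth Q) * tally f (birth Q) P' - z\<bar>) \<le>
      transition n ?P (\<lambda>Q P'. \<epsilon> / 2 + K * (U Q P' + L Q P'))"
    proof (rule transition_mono)
      fix Q P' assume Q: "Q \<in> set_pmf (law n ?P)" "P' \<in> set_pmf (kakutani_step \<Sigma> Q)"
      have "\<bar>exp (- birth Q) * tally f (birth Q) P' - z\<bar> = exp (- birth Q) * \<bar>tally f (birth Q) P' - z * exp (birth Q)\<bar>"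
      proof -
        have "exp (- birth Q) * tally f (birth Q) P' - z = exp (- birth Q) * (tally f (birth Q) P' - z * exp (birth Q))"
          by (simp add: exp_minus field_simps)
        then show ?thesis by (simp add: abs_mult)
      qed
      also have "\<dots> \<le> exp (- birth Q) * (\<epsilon> / 2 * exp (birth Q) + K * (U Q P' + L Q P'))"
        using point[OF Q] by (rule mult_left_mono) simp
      also have "\<dots> = \<epsilon> / 2 + exp (- birth Q) * (K * (U Q P' + L Q P'))"
        by (simp add: exp_minus field_simps)
      also have "\<dots> \<le> \<epsilon> / 2 + 1 * (K * (U Q P' + L Q P'))"
        using birth_nonneg[OF Q(1)] K UL by (intro add_left_mono mult_right_mono) auto
      finally show "\<bar>exp (- birth Q) * tally f (birth Q) P' - z\<bar> \<le> \<epsilon> / 2 + K * (U Q P' + L Q P')" by simp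
    qed
    also have "\<dots> = \<epsilon> / 2 + transition n ?P (\<lambda>Q P'. K * (U Q P' + L Q P'))"
      unfolding transition_add transition_const ..
    also have "\<dots> \<le> \<epsilon>" using small by simp
    finally show "transition n ?P (\<lambda>Q P'. \<bar>tally f (birth Q) P' - z * exp (birth Q)\<bar>) \<le> \<epsilon> * transition n ?P (\<lambda>Q P'. exp (birth Q)) \<and>
      transition n ?P (\<lambda>Q P'. \<bar>exp (- birth Q) * tally f (birth Q) P' - z\<bar>) \<le> \<epsilon>"
      using 1 by blast
  qed
qed

section \<open>Counts and volumes as statistics\<close>

definition number_weight :: "'n \<Rightarrow> 'n \<Rightarrow> real \<Rightarrow> real" where
  "number_weight r j t = (if j = r then 1 else 0)"

text \<open>At t = threshold - length, exp t is the tile volume times exp of the threshold: it stays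
  below 1 at negative times, as the estimates require, and is scaled back to the volume in
  \<open>tally_volume\<close>.\<close>

definition volume_weight :: "'n \<Rightarrow> 'n \<Rightarrow> real \<Rightarrow> real" where
  "volume_weight r j t = (if j = r then exp t else 0)"

lemma tally_number: "tally (number_weight r) t P = real (length (tiles_of_type r P))"
  by (induction P) (auto simp: tally_def number_weight_def tiles_of_type_def)

lemma tally_volume: "exp (- t) * tally (volume_weight r) t P = (\<Sum>x\<leftarrow>P. if snd x = r then exp (- tile_len x) else 0)"
  by (induction P) (auto simp: tally_def volume_weight_def distrib_left exp_diff exp_minus inverse_eq_divide)

lemma measure_UN_list_le:
  "(\<And>x. x \<in> set xs \<Longrightarrow> g x \<in> lmeasurable) \<Longrightarrow>
     (\<Union>x\<in>set xs. g x) \<in> lmeasurable \<and> measure lebesgue (\<Union>x\<in>set xs. g x) \<le> (\<Sum>x\<leftarrow>xs. measure lebesgue (g x))"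
proof (induction xs)
  case (Cons a xs)
  then have IH: "(\<Union>x\<in>set xs. g x) \<in> lmeasurable"
    "measure lebesgue (\<Union>x\<in>set xs. g x) \<le> (\<Sum>x\<leftarrow>xs. measure lebesgue (g x))" by auto
  have a: "g a \<in> lmeasurable" using Cons.prems by simp
  have "measure lebesgue (g a \<union> (\<Union>x\<in>set xs. g x)) \<le> measure lebesgue (g a) + measure lebesgue (\<Union>x\<in>set xs. g x)"
    by (rule measure_Un_le) (use a IH in \<open>auto intro: fmeasurableD\<close>)
  then show ?case using IH a by (auto intro: fmeasurable.Un)
qed simp

lemma sum_over_types:
  "(\<Sum>r\<in>UNIV. \<Sum>x\<leftarrow>P. if snd x = (r :: 'n) then g x else (0 :: real)) = (\<Sum>x\<leftarrow>P. g x)"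
  by (induction P) (simp_all add: sum.distrib)

text \<open>No overlap between tiles has to be tracked: subadditivity gives one inequality for every
  type, and the total over all types is attained.\<close>

lemma type_vol_eq:
  assumes P: "admissible i P"
  shows "type_vol \<Sigma> r P = (\<Sum>x\<leftarrow>P. if snd x = r then exp (- tile_len x) else 0)"
proof -
  have sim: "\<And>x. x \<in> set P \<Longrightarrow> similar_tile x" and total: "(\<Sum>x\<leftarrow>P. exp (- tile_len x)) = 1"
    and cover: "negligible (prototile \<Sigma> i - \<Union>(tile_set \<Sigma> ` set P))"
    using P by (auto simp: admissible_def)
  define A where "A r = (\<Union>t\<in>set (tiles_of_type r P). tile_set \<Sigma> t)" for r
  define S where "S r = (\<Sum>x\<leftarrow>P. if snd x = r then exp (- tile_len x) else 0)" for r
  have meas: "tile_set \<Sigma> x \<in> lmeasurable" if "x \<in> set P" for x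
    using sim[OF that] tile_measure(1) unfolding similar_tile_def by blast
  have AS: "A r \<in> lmeasurable \<and> measure lebesgue (A r) \<le> S r" for r
  proof -
    have "A r \<in> lmeasurable \<and> measure lebesgue (A r) \<le> (\<Sum>x\<leftarrow>tiles_of_type r P. measure lebesgue (tile_set \<Sigma> x))"
      unfolding A_def by (rule measure_UN_list_le) (auto simp: tiles_of_type_def intro: meas)
    moreover have "map (\<lambda>x. measure lebesgue (tile_set \<Sigma> x)) (tiles_of_type r P) = map (\<lambda>x. exp (- tile_len x)) (tiles_of_type r P)"
      by (rule map_cong[OF refl]) (use exp_tile_len sim in \<open>auto simp: tiles_of_type_def tile_vol_def\<close>)
    moreover have "(\<Sum>x\<leftarrow>tiles_of_type r P. exp (- tile_len x)) = S r"
      unfolding tiles_of_type_def S_def by (rule sum_list_map_filter')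
    ultimately show ?thesis by simp
  qed
  have "1 \<le> (\<Sum>r\<in>UNIV. measure lebesgue (A r))"
  proof -
    have UA: "(\<Union>r. A r) = \<Union>(tile_set \<Sigma> ` set P)" by (auto simp: A_def tiles_of_type_def)
    have UAm: "(\<Union>r. A r) \<in> lmeasurable" using AS by (intro fmeasurable.finite_UN) auto
    have "1 = measure lebesgue (prototile \<Sigma> i)" by (simp add: prototile_measure)
    also have "\<dots> \<le> measure lebesgue ((\<Union>r. A r) \<union> (prototile \<Sigma> i - (\<Union>r. A r)))"
      using prototile_measurable UAm by (intro measure_mono_fmeasurable) (auto intro: fmeasurableD)
    also have "\<dots> = measure lebesgue (\<Union>r. A r)"
    proof -
      have "negligible (prototile \<Sigma> i - (\<Union>r. A r))" using cover unfolding UA .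
      then show ?thesis using UAm by (intro measure_Un_null_set) (auto simp: negligible_iff_null_sets intro: fmeasurableD)
    qed
    also have "\<dots> \<le> (\<Sum>r\<in>UNIV. measure lebesgue (A r))"
      by (rule measure_UNION_le) (use AS in \<open>auto intro: fmeasurableD\<close>)
    finally show ?thesis .
  qed
  moreover have "(\<Sum>r\<in>UNIV. S r) = 1" unfolding S_def sum_over_types by (rule total)
  ultimately have "(\<Sum>r\<in>UNIV. S r - measure lebesgue (A r)) \<le> 0" by (simp add: sum_subtractf)
  moreover have nn: "0 \<le> S r - measure lebesgue (A r)" for r using AS[of r] by simp
  ultimately have "(\<Sum>r\<in>UNIV. S r - measure lebesgue (A r)) = 0"
    by (intro antisym sum_nonneg) auto
  then have "S r - measure lebesgue (A r) = 0" for r using nn by (subst (asm) sum_nonneg_eq_0_iff) auto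
  then show ?thesis by (simp add: type_vol_def A_def[symmetric] S_def[symmetric])
qed

lemma expectation_law_Suc:
  "measure_pmf.expectation (law (Suc n) P) h = transition n P (\<lambda>Q P'. h P' :: real)"
  unfolding law_Suc transition_def by (rule expectation_bind_finite) (auto simp: finite_law finite_step)

lemma length_by_type: "real (length P) = (\<Sum>r\<in>UNIV. real (length (tiles_of_type (r :: 'n) P)))"
proof -
  have "real (length (tiles_of_type r P)) = (\<Sum>x\<leftarrow>P. if snd x = r then 1 else 0)" for r
    by (induction P) (auto simp: tiles_of_type_def)
  then show ?thesis using sum_over_types[where g = "\<lambda>_. 1" and P = P] by (simp add: sum_list_triv)
qed

end

section \<open>From the random sequence to its law\<close>

lemma (in prob_space) integral_finite_range:
  fixes g :: "'b \<Rightarrow> real"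
  assumes A: "finite A" "\<And>\<omega>. \<omega> \<in> space M \<Longrightarrow> X \<omega> \<in> A"
    and X: "\<And>a. a \<in> A \<Longrightarrow> {\<omega> \<in> space M. X \<omega> = a} \<in> sets M"
  shows "(LINT \<omega>|M. g (X \<omega>)) = (\<Sum>a\<in>A. g a * measure M {\<omega> \<in> space M. X \<omega> = a})"
proof -
  have "(LINT \<omega>|M. g (X \<omega>)) = (LINT \<omega>|M. (\<Sum>a\<in>A. g a * indicator {\<omega> \<in> space M. X \<omega> = a} \<omega>))"
  proof (rule Bochner_Integration.integral_cong[OF refl])
    fix \<omega> assume w: "\<omega> \<in> space M"
    have "(\<Sum>a\<in>A. g a * indicator {\<omega> \<in> space M. X \<omega> = a} \<omega>) = (\<Sum>a\<in>A. if X \<omega> = a then g a else 0)"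
      using w by (intro sum.cong) (auto simp: indicator_def)
    then show "g (X \<omega>) = (\<Sum>a\<in>A. g a * indicator {\<omega> \<in> space M. X \<omega> = a} \<omega>)"
      using A w by simp
  qed
  also have "\<dots> = (\<Sum>a\<in>A. LINT \<omega>|M. g a * indicator {\<omega> \<in> space M. X \<omega> = a} \<omega>)"
    by (rule Bochner_Integration.integral_sum)
       (intro integrable_mult_right integrable_real_indicator X, auto simp: emeasure_eq_measure)
  also have "\<dots> = (\<Sum>a\<in>A. g a * measure M {\<omega> \<in> space M. X \<omega> = a})"
    using X by (intro sum.cong) auto
  finally show ?thesis .
qed

context kakutani_system begin

text \<open>The law of the next partition is specified given complete histories, so the induction
  step sums over histories. Only finitely many are possible, which turns the integrals into finite
  sums.\<close>

lemma sequence_law: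
  fixes \<pi> :: "nat \<Rightarrow> 'w \<Rightarrow> ('a, 'n) tile list" and h :: "('a, 'n) tile list \<Rightarrow> real"
  assumes seq: "random_kakutani_sequence \<Sigma> i M \<pi>"
  shows "\<omega> \<in> space M \<Longrightarrow> \<pi> n \<omega> \<in> set_pmf (law n [(id, i)])"
    and "(LINT \<omega>|M. h (\<pi> n \<omega>)) = measure_pmf.expectation (law n [(id, i)]) h"
proof -
  let ?P = "[(id, i)] :: ('a, 'n) tile list"
  interpret prob_space M using seq by (simp add: random_kakutani_sequence_def)
  have ms: "\<pi> m \<in> measurable M (count_space UNIV)" for m
    using seq by (simp add: random_kakutani_sequence_def)
  have start: "\<omega> \<in> space M \<Longrightarrow> \<pi> 0 \<omega> = ?P" for \<omega>
    using seq by (simp add: random_kakutani_sequence_def)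
  have nxt: "\<omega> \<in> space M \<Longrightarrow> \<pi> (Suc m) \<omega> \<in> set_pmf (kakutani_step \<Sigma> (\<pi> m \<omega>))" for m \<omega>
    using seq by (simp add: random_kakutani_sequence_def)
  have cond: "measure M {\<omega> \<in> space M. \<forall>s\<le>Suc m. \<pi> s \<omega> = P s} =
      measure M {\<omega> \<in> space M. \<forall>s\<le>m. \<pi> s \<omega> = P s} * pmf (kakutani_step \<Sigma> (P m)) (P (Suc m))" for m P
    using seq by (simp add: random_kakutani_sequence_def)
  have supp: "\<pi> m \<omega> \<in> set_pmf (law m ?P)" if "\<omega> \<in> space M" for m \<omega>
  proof (induction m)
    case (Suc m)
    then show ?case using nxt[OF that, of m] unfolding law_Suc set_bind_pmf by blast
  next
    case 0
    then show ?case unfolding law.simps set_return_pmf start[OF that] by blast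
  qed
  then show "\<omega> \<in> space M \<Longrightarrow> \<pi> n \<omega> \<in> set_pmf (law n ?P)" .
  have ev: "{\<omega> \<in> space M. \<pi> s \<omega> = Q} \<in> sets M" for s Q
    using measurable_sets[OF ms, of "{Q}" s] by (simp add: vimage_def Int_def conj_commute)
  have hist: "{\<omega> \<in> space M. \<forall>s\<le>m. \<pi> s \<omega> = P s} \<in> sets M" for m P
  proof -
    have "{\<omega> \<in> space M. \<forall>s\<le>m. \<pi> s \<omega> = P s} = (\<Inter>s\<in>{..m}. {\<omega> \<in> space M. \<pi> s \<omega> = P s})" by auto
    then show ?thesis using ev by (auto intro!: sets.finite_INT)
  qed
  define H where "H m = PiE {..m} (\<lambda>s. set_pmf (law s ?P))" for m
  have finH: "finite (H m)" for m unfolding H_def by (intro finite_PiE) (auto simp: finite_law)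
  \<comment> \<open>Restricting the path to {..m} makes histories elements of a finite product
    set.\<close>
  define past where "past m \<omega> = restrict (\<lambda>s. \<pi> s \<omega>) {..m}" for m \<omega>
  have past_in: "past m \<omega> \<in> H m" if "\<omega> \<in> space M" for m \<omega>
    using supp[OF that] by (auto simp: past_def H_def)
  have past_eq: "past m \<omega> = P \<longleftrightarrow> (\<forall>s\<le>m. \<pi> s \<omega> = P s)" if "P \<in> H m" for m \<omega> P
    using that unfolding past_def H_def by (auto simp: PiE_def extensional_def restrict_def fun_eq_iff)
  have past_ev: "{\<omega> \<in> space M. past m \<omega> = P} \<in> sets M" if "P \<in> H m" for m P
    unfolding past_eq[OF that] by (rule hist)
  have "\<forall>h :: ('a, 'n) tile list \<Rightarrow> real. (LINT \<omega>|M. h (\<pi> n \<omega>)) = measure_pmf.expectation (law n ?P) h" for n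
  proof (induction n)
    case 0
    show ?case
    proof
      fix h :: "('a, 'n) tile list \<Rightarrow> real"
      have "(LINT \<omega>|M. h (\<pi> 0 \<omega>)) = (LINT \<omega>|M. h ?P)"
        by (rule Bochner_Integration.integral_cong[OF refl]) (simp only: start)
      also have "\<dots> = h ?P" by (simp add: prob_space)
      also have "\<dots> = measure_pmf.expectation (return_pmf ?P) h"
        using integral_return[of ?P "count_space UNIV" h] by (simp add: return_pmf.rep_eq)
      finally show "(LINT \<omega>|M. h (\<pi> 0 \<omega>)) = measure_pmf.expectation (law 0 ?P) h" unfolding law.simps .
    qed
  next
    case (Suc m)
    show ?case
    proof
      fix h :: "('a, 'n) tile list \<Rightarrow> real"
      define S where "S = set_pmf (law (Suc m) ?P)"
      have S: "finite S" unfolding S_def by (rule finite_law)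
      have "(LINT \<omega>|M. h (\<pi> (Suc m) \<omega>)) = (LINT \<omega>|M. (\<lambda>(P, Q). h Q) (past m \<omega>, \<pi> (Suc m) \<omega>))" by simp
      also have "\<dots> = (\<Sum>x\<in>H m \<times> S. (\<lambda>(P, Q). h Q) x * measure M {\<omega> \<in> space M. (past m \<omega>, \<pi> (Suc m) \<omega>) = x})"
      proof (rule integral_finite_range)
        show "finite (H m \<times> S)" using finH S by simp
        show "(past m \<omega>, \<pi> (Suc m) \<omega>) \<in> H m \<times> S" if "\<omega> \<in> space M" for \<omega>
          using past_in[OF that] supp[OF that] unfolding S_def mem_Times_iff fst_conv snd_conv by blast
        show "{\<omega> \<in> space M. (past m \<omega>, \<pi> (Suc m) \<omega>) = x} \<in> sets M" if x: "x \<in> H m \<times> S" for x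
        proof -
          have "{\<omega> \<in> space M. (past m \<omega>, \<pi> (Suc m) \<omega>) = x} = {\<omega> \<in> space M. past m \<omega> = fst x} \<inter> {\<omega> \<in> space M. \<pi> (Suc m) \<omega> = snd x}"
            by (auto simp: prod_eq_iff)
          then show ?thesis using past_ev[of "fst x" m] ev x by auto
        qed
      qed
      also have "\<dots> = (\<Sum>P\<in>H m. \<Sum>Q\<in>S. h Q * measure M {\<omega> \<in> space M. past m \<omega> = P \<and> \<pi> (Suc m) \<omega> = Q})"
        by (simp add: sum.cartesian_product case_prod_beta prod_eq_iff)
      also have "\<dots> = (\<Sum>P\<in>H m. measure_pmf.expectation (kakutani_step \<Sigma> (P m)) h * measure M {\<omega> \<in> space M. past m \<omega> = P})"
      proof (rule sum.cong[OF refl])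
        fix P assume P: "P \<in> H m"
        have Pm: "P m \<in> set_pmf (law m ?P)" using P by (auto simp: H_def)
        have m: "measure M {\<omega> \<in> space M. past m \<omega> = P \<and> \<pi> (Suc m) \<omega> = Q} =
          measure M {\<omega> \<in> space M. past m \<omega> = P} * pmf (kakutani_step \<Sigma> (P m)) Q" for Q
        proof -
          have "{\<omega> \<in> space M. past m \<omega> = P \<and> \<pi> (Suc m) \<omega> = Q} = {\<omega> \<in> space M. \<forall>s\<le>Suc m. \<pi> s \<omega> = (P(Suc m := Q)) s}"
            unfolding past_eq[OF P] by (auto simp: le_Suc_eq)
          moreover have "{\<omega> \<in> space M. past m \<omega> = P} = {\<omega> \<in> space M. \<forall>s\<le>m. \<pi> s \<omega> = (P(Suc m := Q)) s}"
            unfolding past_eq[OF P] by auto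
          ultimately show ?thesis using cond[of m "P(Suc m := Q)"] by simp
        qed
        have "measure_pmf.expectation (kakutani_step \<Sigma> (P m)) h = (\<Sum>Q\<in>S. h Q * pmf (kakutani_step \<Sigma> (P m)) Q)"
          by (rule integral_measure_pmf_real[OF S]) (use Pm in \<open>auto simp: S_def law_Suc simp del: law.simps\<close>)
        then show "(\<Sum>Q\<in>S. h Q * measure M {\<omega> \<in> space M. past m \<omega> = P \<and> \<pi> (Suc m) \<omega> = Q}) =
          measure_pmf.expectation (kakutani_step \<Sigma> (P m)) h * measure M {\<omega> \<in> space M. past m \<omega> = P}"
          unfolding m by (simp add: sum_distrib_right mult_ac)
      qed
      also have "\<dots> = (LINT \<omega>|M. measure_pmf.expectation (kakutani_step \<Sigma> (past m \<omega> m)) h)"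
        by (rule integral_finite_range[OF finH past_in past_ev, symmetric])
      also have "\<dots> = (LINT \<omega>|M. measure_pmf.expectation (kakutani_step \<Sigma> (\<pi> m \<omega>)) h)"
        by (simp add: past_def)
      also have "\<dots> = measure_pmf.expectation (law m ?P) (\<lambda>P. measure_pmf.expectation (kakutani_step \<Sigma> P) h)"
        by (rule Suc.IH[THEN spec[of _ "\<lambda>P. measure_pmf.expectation (kakutani_step \<Sigma> P) h"]])
      also have "\<dots> = measure_pmf.expectation (law (Suc m) ?P) h"
        unfolding law_Suc by (rule expectation_bind_finite[symmetric]) (auto simp: finite_law finite_step)
      finally show "(LINT \<omega>|M. h (\<pi> (Suc m) \<omega>)) = measure_pmf.expectation (law (Suc m) ?P) h" .
    qed
  qed
  then show "(LINT \<omega>|M. h (\<pi> n \<omega>)) = measure_pmf.expectation (law n ?P) h" by blast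
qed

text \<open>With one rule per type the choice 0 is forced, so all sample paths coincide.\<close>

lemma deterministic_sequence:
  assumes seq: "random_kakutani_sequence \<Sigma> i M \<pi>" and one: "\<And>j. length (rules \<Sigma> j) = 1" and w: "\<omega> \<in> space M"
  shows "\<pi> n \<omega> = (refine (\<lambda>_. 0) ^^ n) [(id, i)]"
proof (induction n)
  case 0
  show ?case using seq w unfolding random_kakutani_sequence_def funpow_0 by blast
next
  case (Suc n)
  have "\<pi> (Suc n) \<omega> \<in> set_pmf (kakutani_step \<Sigma> (\<pi> n \<omega>))"
    using seq w by (simp add: random_kakutani_sequence_def)
  then obtain \<kappa> where k: "\<pi> (Suc n) \<omega> = refine \<kappa> (\<pi> n \<omega>)"
    "\<And>q. q \<in> maximal_indices \<Sigma> (\<pi> n \<omega>) \<Longrightarrow> \<kappa> q < length (rules \<Sigma> (snd (\<pi> n \<omega> ! q)))"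
    using step_support by blast
  have "\<kappa> q = 0" if "q \<in> maximal_indices \<Sigma> (\<pi> n \<omega>)" for q using k(2)[OF that] one by simp
  then have "refine \<kappa> (\<pi> n \<omega>) = refine (\<lambda>_. 0) (\<pi> n \<omega>)"
    unfolding refine_def by (intro arg_cong[where f = concat] map_cong refl) simp
  then show ?case using k(1) Suc by simp
qed

end

section \<open>Limits\<close>

context kakutani_system begin

lemma edges_eq: "edges = {(i, k, q). k < length (rules \<Sigma> i) \<and> q < length (rules \<Sigma> i ! k)}"
  by (auto simp: edges_def)

lemma edge_shape: "e \<in> edges \<Longrightarrow> edge e = shape (edge_piece \<Sigma> e)"
  by (cases e) (auto simp: edges_eq edge_def)

lemma edge_piece_in:
  assumes "e \<in> edges"
  obtains \<rho> where "\<rho> \<in> set (rules \<Sigma> (fst e))" "edge_piece \<Sigma> e \<in> set \<rho>"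
proof -
  obtain i k q where e: "e = (i, k, q)" "k < length (rules \<Sigma> i)" "q < length (rules \<Sigma> i ! k)"
    using assms by (auto simp: edges_eq)
  show ?thesis by (rule that[of "rules \<Sigma> i ! k"]) (use e in auto)
qed

lemma edge_length_eq: "e \<in> edges \<Longrightarrow> edge_length \<Sigma> e = fst (edge e)"
proof -
  assume e: "e \<in> edges"
  obtain \<rho> where "\<rho> \<in> set (rules \<Sigma> (fst e))" "edge_piece \<Sigma> e \<in> set \<rho>" by (rule edge_piece_in[OF e])
  then have "0 < subst_vol \<Sigma> (edge_piece \<Sigma> e)" by (rule subst_vol_range)
  then show ?thesis by (simp add: edge_length_def edge_shape[OF e] shape_def piece_len_def ln_div)
qed

lemma exp_edge: "e \<in> edges \<Longrightarrow> exp (- fst (edge e)) = subst_vol \<Sigma> (edge_piece \<Sigma> e)"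
proof -
  assume e: "e \<in> edges"
  obtain \<rho> where "\<rho> \<in> set (rules \<Sigma> (fst e))" "edge_piece \<Sigma> e \<in> set \<rho>" by (rule edge_piece_in[OF e])
  then have "exp (- piece_len (edge_piece \<Sigma> e)) = subst_vol \<Sigma> (edge_piece \<Sigma> e)" by (rule exp_piece_len)
  then show ?thesis by (simp add: edge_shape[OF e] shape_def)
qed

lemma graph_walk:
  assumes "pre_digraph.awalk (assoc_graph \<Sigma>) u p v"
  shows "walk_length edges fst (\<lambda>e. snd (edge e)) (\<lambda>e. fst (edge e)) u v (sum_list (map (edge_length \<Sigma>) p))"
proof -
  have "set p \<subseteq> edges \<Longrightarrow> pre_digraph.cas (assoc_graph \<Sigma>) u p v \<Longrightarrow>
    walk_length edges fst (\<lambda>e. snd (edge e)) (\<lambda>e. fst (edge e)) u v (sum_list (map (edge_length \<Sigma>) p))"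
  proof (induction p arbitrary: u)
    case Nil
    then show ?case by (simp add: pre_digraph.cas.simps walk_Nil)
  next
    case (Cons e p)
    have e: "e \<in> edges" using Cons.prems by simp
    have "fst e = u" "pre_digraph.cas (assoc_graph \<Sigma>) (snd (edge e)) p v"
      using Cons.prems(2) by (simp_all add: pre_digraph.cas.simps assoc_graph_def edge_shape[OF e] shape_def)
    moreover have "set p \<subseteq> edges" using Cons.prems by simp
    ultimately show ?case
      using walk_Cons[OF e, where tgt = "\<lambda>e. snd (edge e)" and src = fst and len = "\<lambda>e. fst (edge e)"] Cons.IH
      by (simp add: edge_length_eq[OF e])
  qed
  moreover have "set p \<subseteq> edges" "pre_digraph.cas (assoc_graph \<Sigma>) u p v"
    using assms by (auto simp: pre_digraph.awalk_def assoc_graph_def edges_eq)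
  ultimately show ?thesis by blast
qed

lemma nonlattice:
  assumes irr: "irreducible_system \<Sigma>" and inc: "incommensurable \<Sigma>"
  shows "nonlattice_branching (\<lambda>i. map (map shape) (rules \<Sigma> i)) (rule_pmf \<Sigma>)"
proof (unfold_locales, goal_cases)
  case (1 i j)
  interpret wf_digraph "assoc_graph \<Sigma>" by unfold_locales (auto simp: assoc_graph_def)
  have "i \<in> verts (assoc_graph \<Sigma>)" "j \<in> verts (assoc_graph \<Sigma>)" by (simp_all add: assoc_graph_def)
  then have "i \<rightarrow>\<^sup>*\<^bsub>assoc_graph \<Sigma>\<^esub> j"
    using irr unfolding irreducible_system_def strongly_connected_def by blast
  then obtain p where "awalk i p j" using reachable_awalk by blast
  then show ?case using graph_walk by blast
next
  case 2
  obtain a b where a: "a \<in> closed_path_lengths \<Sigma>" and b: "b \<in> closed_path_lengths \<Sigma>" and ab: "a \<notin> {b * q | q. q \<in> \<rat>}"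
    using inc unfolding incommensurable_def by blast
  obtain p u where p: "a = sum_list (map (edge_length \<Sigma>) p)" "pre_digraph.awalk (assoc_graph \<Sigma>) u p u"
    using a unfolding closed_path_lengths_def by blast
  obtain p' u' where p': "b = sum_list (map (edge_length \<Sigma>) p')" "pre_digraph.awalk (assoc_graph \<Sigma>) u' p' u'" "p' \<noteq> []"
    using b unfolding closed_path_lengths_def by blast
  have sub: "set p' \<subseteq> edges" using p'(2) by (auto simp: pre_digraph.awalk_def assoc_graph_def edges_eq)
  \<comment> \<open>Closed paths are nonempty by definition and all edges have positive
    length.\<close>
  have "0 < b"
  proof -
    obtain e xs where exs: "p' = e # xs" using p'(3) by (cases p') auto
    have pos: "0 < edge_length \<Sigma> x" if "x \<in> set p'" for x
    proof -
      have "x \<in> edges" using sub that by blast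
      then show ?thesis using len_pos[of x] edge_length_eq[of x] by simp
    qed
    have "0 \<le> sum_list (map (edge_length \<Sigma>) xs)"
      by (rule sum_list_nonneg) (use pos exs in \<open>auto intro: less_imp_le\<close>)
    then show ?thesis using pos[of e] by (simp add: p'(1) exs)
  qed
  then show ?case using graph_walk[OF p(2)] graph_walk[OF p'(2)] ab unfolding p(1)[symmetric] p'(1)[symmetric] by blast
qed

lemma expected_matrix_entry:
  "expected_matrix \<Sigma> g $ i $ j =
     (\<Sum>e | e \<in> edges \<and> fst e = i. pmf (rule_pmf \<Sigma> i) (fst (snd e)) * (if snd (edge e) = j then g (edge_piece \<Sigma> e) else 0))"
proof -
  have "(\<Sum>p\<leftarrow>filter (\<lambda>p. piece_type p = j) \<rho>. g p) = (\<Sum>q<length \<rho>. if piece_type (\<rho> ! q) = j then g (\<rho> ! q) else 0)" for \<rho>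
    unfolding sum_list_map_filter' by (simp add: sum_list_sum_nth atLeast0LessThan)
  then show ?thesis
    unfolding sum_edges_from expected_matrix_def
    by (simp add: edge_def shape_def sum_distrib_left cong: if_cong)
qed

lemma vector_expected_matrix:
  "(v v* expected_matrix \<Sigma> g) $ j = (\<Sum>e\<in>edges. v $ fst e *
     (pmf (rule_pmf \<Sigma> (fst e)) (fst (snd e)) * (if snd (edge e) = j then g (edge_piece \<Sigma> e) else 0)))"
proof -
  have "(v v* expected_matrix \<Sigma> g) $ j = (\<Sum>i\<in>UNIV. v $ i * expected_matrix \<Sigma> g $ i $ j)"
    by (simp add: vector_matrix_mult_def mult.commute)
  also have "\<dots> = (\<Sum>i\<in>UNIV. \<Sum>e\<in>out i. v $ fst e *
     (pmf (rule_pmf \<Sigma> (fst e)) (fst (snd e)) * (if snd (edge e) = j then g (edge_piece \<Sigma> e) else 0)))"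
    unfolding expected_matrix_entry out_def by (simp add: sum_distrib_left)
  finally show ?thesis unfolding sum_E_out .
qed

lemma V_row_sum: "(\<Sum>j\<in>UNIV. V_matrix \<Sigma> $ i $ j) = 1"
proof -
  have "(\<Sum>j\<in>UNIV. V_matrix \<Sigma> $ i $ j) = (\<Sum>e | e \<in> edges \<and> fst e = i. \<Sum>j\<in>UNIV. pmf (rule_pmf \<Sigma> i) (fst (snd e)) *
      (if snd (edge e) = j then subst_vol \<Sigma> (edge_piece \<Sigma> e) else 0))"
    unfolding V_matrix_def expected_matrix_entry by (rule sum.swap)
  also have "\<dots> = (\<Sum>e | e \<in> edges \<and> fst e = i. edge_wt e)"
    by (rule sum.cong) (auto simp: edge_wt_def exp_edge sum_distrib_left[symmetric])
  finally show ?thesis by (simp add: wt_sum)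
qed

lemma V_nonneg: "0 \<le> V_matrix \<Sigma> $ i $ j"
proof -
  have "0 \<le> (if snd (edge e) = j then subst_vol \<Sigma> (edge_piece \<Sigma> e) else 0)" if "e \<in> edges" for e
  proof -
    have "0 \<le> subst_vol \<Sigma> (edge_piece \<Sigma> e)" unfolding exp_edge[OF that, symmetric] by simp
    then show ?thesis by simp
  qed
  then show ?thesis unfolding V_matrix_def expected_matrix_entry by (intro sum_nonneg mult_nonneg_nonneg) auto
qed

text \<open>Rows sum to 1, so the all-ones vector is an eigenvector for 1; at an entry of maximal
  modulus of any eigenvector one reads off that its eigenvalue has modulus at most 1.\<close>

lemma perron_frobenius_V: "perron_frobenius_eigenvalue (V_matrix \<Sigma>) = 1"
  unfolding perron_frobenius_eigenvalue_def
proof (rule cSup_eq_maximum)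
  let ?A = "map_matrix complex_of_real (V_matrix \<Sigma>)"
  have entry: "(?A *v w) $ i = (\<Sum>j\<in>UNIV. complex_of_real (V_matrix \<Sigma> $ i $ j) * w $ j)" for w i
    by (simp add: matrix_vector_mult_def map_matrix_def)
  have "?A *v 1 = 1 *s 1"
    unfolding vec_eq_iff entry by (simp add: of_real_sum[symmetric] V_row_sum)
  moreover have "(1 :: complex^'n) \<noteq> 0" by (simp add: vec_eq_iff)
  ultimately have "\<exists>w::complex^'n. w \<noteq> 0 \<and> ?A *v w = 1 *s w" by blast
  then show "1 \<in> {cmod z |z. \<exists>w::complex^'n. w \<noteq> 0 \<and> ?A *v w = z *s w}"
    by (rule_tac CollectI, rule_tac exI[of _ 1], rule_tac conjI) simp_all
  fix x assume "x \<in> {cmod z |z. \<exists>w::complex^'n. w \<noteq> 0 \<and> ?A *v w = z *s w}"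
  then obtain z and w :: "complex^'n" where x: "x = cmod z" and w: "w \<noteq> 0" and eig: "?A *v w = z *s w" by blast
  define m where "m = Max (range (\<lambda>i. cmod (w $ i)))"
  have le: "cmod (w $ i) \<le> m" for i unfolding m_def by (intro Max_ge) auto
  have "m \<in> range (\<lambda>i. cmod (w $ i))" unfolding m_def by (intro Max_in) auto
  then obtain i where i: "m = cmod (w $ i)" by blast
  have "0 < m"
  proof -
    obtain j where "w $ j \<noteq> 0" using w by (auto simp: vec_eq_iff)
    then show ?thesis using le[of j] by (metis norm_le_zero_iff not_le order_trans)
  qed
  have "x * m = cmod ((?A *v w) $ i)" by (simp add: x i eig norm_mult)
  also have "\<dots> \<le> (\<Sum>j\<in>UNIV. V_matrix \<Sigma> $ i $ j * m)"
    unfolding entry using V_nonneg le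
    by (intro order.trans[OF norm_sum] sum_mono) (auto simp: norm_mult intro!: mult_left_mono)
  also have "\<dots> = m" by (simp add: sum_distrib_right[symmetric] V_row_sum)
  finally show "x \<le> 1" using \<open>0 < m\<close> by simp
qed

lemma stationary_eigenvector:
  assumes "left_perron_frobenius_eigenvector (V_matrix \<Sigma>) v"
  shows "stationary (\<lambda>i. v $ i)"
  unfolding stationary_def
proof
  fix j
  have "v v* V_matrix \<Sigma> = v"
    using assms by (simp add: left_perron_frobenius_eigenvector_def perron_frobenius_V)
  then have "v $ j = (v v* V_matrix \<Sigma>) $ j" by simp
  also have "\<dots> = (\<Sum>e\<in>edges. if snd (edge e) = j then v $ fst e * edge_wt e else 0)"
    unfolding V_matrix_def vector_expected_matrix by (rule sum.cong) (auto simp: edge_wt_def exp_edge)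
  also have "\<dots> = (\<Sum>e | e \<in> edges \<and> snd (edge e) = j. v $ fst e * edge_wt e)"
    by (simp add: sum.inter_filter[OF finite_edges])
  finally show "(\<Sum>e | e \<in> edges \<and> snd (edge e) = j. v $ fst e * edge_wt e) = v $ j" by simp
qed

lemma vec_sum_inner_1: "x \<bullet> 1 = (\<Sum>j\<in>UNIV. x $ j :: real)"
  by (simp add: inner_vec_def)

lemma H_entry:
  "(v v* H_matrix \<Sigma>) $ j = (\<Sum>e\<in>edges. if snd (edge e) = j then v $ fst e * edge_wt e * fst (edge e) else 0)"
  unfolding H_matrix_def vector_expected_matrix
proof (rule sum.cong[OF refl])
  fix e assume e: "e \<in> edges"
  have "- ln (subst_vol \<Sigma> (edge_piece \<Sigma> e)) = fst (edge e)"
    by (simp add: edge_shape[OF e] shape_def piece_len_def)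
  then have "- subst_vol \<Sigma> (edge_piece \<Sigma> e) * ln (subst_vol \<Sigma> (edge_piece \<Sigma> e)) = exp (- fst (edge e)) * fst (edge e)"
    unfolding exp_edge[OF e] by (metis minus_mult_commute)
  then show "v $ fst e * (pmf (rule_pmf \<Sigma> (fst e)) (fst (snd e)) * (if snd (edge e) = j
     then - subst_vol \<Sigma> (edge_piece \<Sigma> e) * ln (subst_vol \<Sigma> (edge_piece \<Sigma> e)) else 0)) =
    (if snd (edge e) = j then v $ fst e * edge_wt e * fst (edge e) else 0)"
    by (simp add: edge_wt_def mult.assoc)
qed

lemma drift_eq: "drift (\<lambda>i. v $ i) = (v v* H_matrix \<Sigma>) \<bullet> 1"
  unfolding vec_sum_inner_1 H_entry drift_def by (subst sum.swap) simp

lemma SV_entry: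
  "(v v* (S_matrix \<Sigma> - V_matrix \<Sigma>)) $ j =
     (\<Sum>e\<in>edges. if snd (edge e) = j then v $ fst e * (pmf (rule_pmf \<Sigma> (fst e)) (fst (snd e)) * (1 - exp (- fst (edge e)))) else 0)"
proof -
  have "(v v* (S_matrix \<Sigma> - V_matrix \<Sigma>)) $ j = (v v* S_matrix \<Sigma>) $ j - (v v* V_matrix \<Sigma>) $ j"
    by (simp add: vector_matrix_mult_def left_diff_distrib right_diff_distrib sum_subtractf)
  also have "\<dots> = (\<Sum>e\<in>edges. if snd (edge e) = j then v $ fst e * (pmf (rule_pmf \<Sigma> (fst e)) (fst (snd e)) * (1 - exp (- fst (edge e)))) else 0)"
    unfolding S_matrix_def V_matrix_def vector_expected_matrix sum_subtractf[symmetric]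
    by (rule sum.cong) (auto simp: exp_edge right_diff_distrib)
  finally show ?thesis .
qed

end

section \<open>Limits of counts and volumes\<close>

locale kakutani_limit = kakutani_system \<Sigma>
  for \<Sigma> :: "('a::euclidean_space, 'n::finite) subst_system" +
  fixes v :: "real^'n"
  assumes irreducible: "irreducible_system \<Sigma>" and incommensurable: "incommensurable \<Sigma>"
    and eigenvector: "left_perron_frobenius_eigenvector (V_matrix \<Sigma>) v"
begin

sublocale nonlattice_branching "\<lambda>i. map (map shape) (rules \<Sigma> i)" "rule_pmf \<Sigma>"
  by (rule nonlattice[OF irreducible incommensurable])

lemma weight_limit:
  assumes f: "\<And>i. continuous_on UNIV (f i)" "\<And>i t. 0 \<le> f i t" and e: "0 < \<epsilon>"
    and z: "\<And>e. e \<in> edges \<Longrightarrow> integral {0..fst (edge e)} (source f e) = w e"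
  shows "\<forall>\<^sub>F t in at_top. \<forall>i. \<bar>exp (- t) * mean f i t - (\<Sum>e\<in>edges. v $ fst e * w e) / ((v v* H_matrix \<Sigma>) \<bullet> 1)\<bar> \<le> \<epsilon>"
proof -
  obtain j where j: "v $ j \<noteq> 0"
    using eigenvector by (auto simp: left_perron_frobenius_eigenvector_def vec_eq_iff)
  have "(\<Sum>e\<in>edges. v $ fst e * integral {0..fst (edge e)} (source f e)) = (\<Sum>e\<in>edges. v $ fst e * w e)"
    by (rule sum.cong) (auto simp: z)
  then show ?thesis
    using mean_limit[where f = f, OF f stationary_eigenvector[OF eigenvector] j e] by (simp add: drift_eq)
qed

text \<open>The origin of S - V: a piece of length l is counted while 0 <= t < l, and the integral
  of exp (- t) over this range is 1 - exp (- l), which is 1 minus its volume.\<close>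

lemma number_limit:
  assumes e: "0 < \<epsilon>"
  shows "\<forall>\<^sub>F t in at_top. \<forall>i. \<bar>exp (- t) * mean (number_weight r) i t -
    (v v* (S_matrix \<Sigma> - V_matrix \<Sigma>)) $ r / ((v v* H_matrix \<Sigma>) \<bullet> 1)\<bar> \<le> \<epsilon>"
proof -
  let ?w = "\<lambda>e. if snd (edge e) = r then pmf (rule_pmf \<Sigma> (fst e)) (fst (snd e)) * (1 - exp (- fst (edge e))) else 0"
  have int: "integral {0..fst (edge e)} (source (number_weight r) e) = ?w e" if e: "e \<in> edges" for e
  proof -
    have "((\<lambda>t. exp (- t)) has_integral (- exp (- fst (edge e)) - - exp (- 0))) {0..fst (edge e)}"
      by (rule fundamental_theorem_of_calculus)
         (use len_pos[OF e] in \<open>auto intro!: derivative_eq_intros simp: has_real_derivative_iff_has_vector_derivative[symmetric]\<close>)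
    then have "integral {0..fst (edge e)} (\<lambda>t. exp (- t)) = 1 - exp (- fst (edge e))"
      by (simp add: integral_unique)
    moreover have "source (number_weight r) e = (\<lambda>t. if snd (edge e) = r then pmf (rule_pmf \<Sigma> (fst e)) (fst (snd e)) * exp (- t) else 0)"
      by (auto simp: source_def number_weight_def fun_eq_iff)
    ultimately show ?thesis by (cases "snd (edge e) = r") simp_all
  qed
  have eq: "(v v* (S_matrix \<Sigma> - V_matrix \<Sigma>)) $ r = (\<Sum>e\<in>edges. v $ fst e * ?w e)"
    unfolding SV_entry by (rule sum.cong) auto
  have c: "continuous_on UNIV (number_weight r i)" "0 \<le> number_weight r i t" for i t
    unfolding number_weight_def by (auto intro!: continuous_intros)
  show ?thesis unfolding eq by (rule weight_limit[where f = "number_weight r" and w = ?w, OF c e int])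
qed

text \<open>The origin of H: for 0 <= t < l the factors exp (- t) and exp (t - l) multiply to the
  constant exp (- l), so the integral is l * exp (- l), which is - vol * ln vol.\<close>

lemma volume_limit:
  assumes e: "0 < \<epsilon>"
  shows "\<forall>\<^sub>F t in at_top. \<forall>i. \<bar>exp (- t) * mean (volume_weight r) i t -
    (v v* H_matrix \<Sigma>) $ r / ((v v* H_matrix \<Sigma>) \<bullet> 1)\<bar> \<le> \<epsilon>"
proof -
  let ?w = "\<lambda>e. if snd (edge e) = r then edge_wt e * fst (edge e) else 0"
  have int: "integral {0..fst (edge e)} (source (volume_weight r) e) = ?w e" if e: "e \<in> edges" for e
  proof -
    have "source (volume_weight r) e = (\<lambda>t. if snd (edge e) = r then edge_wt e else 0)"
      by (auto simp: source_def volume_weight_def edge_wt_def exp_add[symmetric] fun_eq_iff)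
    then show ?thesis using len_pos[OF e] by simp
  qed
  have eq: "(v v* H_matrix \<Sigma>) $ r = (\<Sum>e\<in>edges. v $ fst e * ?w e)"
    unfolding H_entry by (rule sum.cong) auto
  have c: "continuous_on UNIV (volume_weight r i)" "0 \<le> volume_weight r i t" for i t
  proof -
    show "continuous_on UNIV (volume_weight r i)"
      unfolding volume_weight_def by (cases "i = r") (auto intro!: continuous_intros)
  qed (simp add: volume_weight_def)
  show ?thesis unfolding eq by (rule weight_limit[where f = "volume_weight r" and w = ?w, OF c e int])
qed

text \<open>The expected exponential of the random threshold is the common scale of all expected
  counts; it cancels in their ratio.\<close>

abbreviation growth :: "'n \<Rightarrow> nat \<Rightarrow> real" where
  "growth i n \<equiv> transition n [(id, i)] (\<lambda>Q P'. exp (birth Q))"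

lemma growth_ge_1: "1 \<le> growth i n"
proof -
  have "transition n [(id, i)] (\<lambda>Q P'. 1) \<le> growth i n"
    by (rule transition_mono) (simp add: birth_nonneg)
  then show ?thesis by (simp only: transition_const)
qed

lemma transition_diff_le:
  "\<bar>transition n P F - transition n P G\<bar> \<le> transition n P (\<lambda>Q P'. \<bar>F Q P' - G Q P'\<bar>)"
proof -
  have "transition n P F \<le> transition n P (\<lambda>Q P'. \<bar>F Q P' - G Q P'\<bar> + G Q P')"
    "transition n P G \<le> transition n P (\<lambda>Q P'. \<bar>F Q P' - G Q P'\<bar> + F Q P')"
    by (rule transition_mono, simp)+
  then show ?thesis by (simp add: transition_add)
qed

abbreviation rate_of :: "'n \<Rightarrow> real" where
  "rate_of r \<equiv> (v v* (S_matrix \<Sigma> - V_matrix \<Sigma>)) $ r / ((v v* H_matrix \<Sigma>) \<bullet> 1)"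

abbreviation expected_number :: "'n \<Rightarrow> 'n \<Rightarrow> nat \<Rightarrow> real" where
  "expected_number i r n \<equiv> measure_pmf.expectation (law n [(id, i)]) (\<lambda>P. real (length (tiles_of_type r P)))"

text \<open>Concentration makes the expected count \<open>rate_of r\<close> times
  \<open>growth\<close>, up to a small relative error. The index is \<open>Suc n\<close> because the
  threshold is read off one step earlier.\<close>

lemma expected_number_limit: "(\<lambda>n. expected_number i r (Suc n) / growth i n) \<longlonglongrightarrow> rate_of r"
proof (rule LIMSEQ_I)
  fix \<epsilon> :: real assume e: "0 < \<epsilon>"
  have f: "\<bar>number_weight r j t\<bar> \<le> 1" for j t by (simp add: number_weight_def)
  have e2: "0 < \<epsilon> / 2" using e by simp
  obtain N where N: "\<forall>n\<ge>N. transition n [(id, i)] (\<lambda>Q P'. \<bar>tally (number_weight r) (birth Q) P' - rate_of r * exp (birth Q)\<bar>) \<le> \<epsilon> / 2 * growth i n"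
    using tally_concentration[OF f e2 number_limit] by blast
  show "\<exists>N. \<forall>n\<ge>N. norm (expected_number i r (Suc n) / growth i n - rate_of r) < \<epsilon>"
  proof (intro exI[of _ N] allI impI)
    fix n assume n: "N \<le> n"
    have pos: "0 < growth i n" using growth_ge_1[of n i] by linarith
    have "\<bar>expected_number i r (Suc n) - rate_of r * growth i n\<bar> \<le>
      transition n [(id, i)] (\<lambda>Q P'. \<bar>tally (number_weight r) (birth Q) P' - rate_of r * exp (birth Q)\<bar>)"
      unfolding expectation_law_Suc transition_cmult[symmetric] tally_number by (rule transition_diff_le)
    also have "\<dots> \<le> \<epsilon> / 2 * growth i n" using N n by blast
    also have "\<dots> < \<epsilon> * growth i n" using e pos by simp
    finally have "\<bar>expected_number i r (Suc n) - rate_of r * growth i n\<bar> / growth i n < \<epsilon>"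
      using pos by (simp add: pos_divide_less_eq)
    moreover have "expected_number i r (Suc n) / growth i n - rate_of r = (expected_number i r (Suc n) - rate_of r * growth i n) / growth i n"
      using pos by (simp add: field_simps)
    ultimately show "norm (expected_number i r (Suc n) / growth i n - rate_of r) < \<epsilon>"
      using pos by (simp add: abs_divide)
  qed
qed

lemma expected_total:
  "measure_pmf.expectation (law n [(id, i)]) (\<lambda>P. real (length P)) = (\<Sum>r\<in>UNIV. expected_number i r n)"
proof -
  have "measure_pmf.expectation (law n [(id, i)]) (\<lambda>P. real (length P)) =
    measure_pmf.expectation (law n [(id, i)]) (\<lambda>P. \<Sum>r\<in>UNIV. real (length (tiles_of_type r P)))"
    by (rule expectation_cong) (rule length_by_type)
  also have "\<dots> = (\<Sum>r\<in>UNIV. expected_number i r n)"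
    by (rule Bochner_Integration.integral_sum) (rule integrable_measure_pmf_finite[OF finite_law])
  finally show ?thesis .
qed

lemma expected_total_limit:
  "(\<lambda>n. measure_pmf.expectation (law (Suc n) [(id, i)]) (\<lambda>P. real (length P)) / growth i n) \<longlonglongrightarrow> (\<Sum>r\<in>UNIV. rate_of r)"
  unfolding expected_total sum_divide_distrib by (intro tendsto_sum expected_number_limit)

text \<open>Each tile of \<open>P'\<close> has volume at most exp (- birth Q) and the total is 1, so
  there are at least exp (birth Q) tiles. This keeps the denominator of the ratio away from
  0.\<close>

lemma rate_total_ge_1: "1 \<le> (\<Sum>r\<in>UNIV. rate_of r)"
proof (rule LIMSEQ_le_const[OF expected_total_limit])
  fix i :: 'n
  have "1 \<le> measure_pmf.expectation (law (Suc n) [(id, i)]) (\<lambda>P. real (length P)) / growth i n" for n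
  proof -
    have "growth i n \<le> transition n [(id, i)] (\<lambda>Q P'. real (length P'))"
    proof (rule transition_mono)
      fix Q P' assume Q: "Q \<in> set_pmf (law n [(id, i)])" and P': "P' \<in> set_pmf (kakutani_step \<Sigma> Q)"
      have ad: "admissible i Q" using law_admissible[OF admissible_initial(1) Q] by simp
      have "1 = (\<Sum>x\<leftarrow>P'. exp (- tile_len x))" using admissible_step(1)[OF ad P'] by (simp add: admissible_def)
      also have "\<dots> \<le> (\<Sum>x\<leftarrow>P'. exp (- birth Q))"
        using admissible_step(2)[OF ad P'] by (intro sum_list_mono) (simp add: less_imp_le)
      also have "\<dots> = real (length P') * exp (- birth Q)" by (simp add: sum_list_triv)
      finally show "exp (birth Q) \<le> real (length P')" by (simp add: exp_minus field_simps)
    qed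
    then show ?thesis using growth_ge_1[of n i] unfolding expectation_law_Suc by (simp add: le_divide_eq)
  qed
  then show "\<exists>N. \<forall>n\<ge>N. 1 \<le> measure_pmf.expectation (law (Suc n) [(id, i)]) (\<lambda>P. real (length P)) / growth i n"
    by blast
qed

lemma number_ratio_limit:
  "(\<lambda>n. expected_number i r n / measure_pmf.expectation (law n [(id, i)]) (\<lambda>P. real (length P)))
     \<longlonglongrightarrow> (v v* (S_matrix \<Sigma> - V_matrix \<Sigma>)) $ r / ((v v* (S_matrix \<Sigma> - V_matrix \<Sigma>)) \<bullet> 1)"
proof -
  let ?T = "\<lambda>n. measure_pmf.expectation (law n [(id, i)]) (\<lambda>P. real (length P))"
  have ne: "(\<Sum>r\<in>UNIV. rate_of r) \<noteq> 0" using rate_total_ge_1 by linarith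
  have "(\<lambda>n. (expected_number i r (Suc n) / growth i n) / (?T (Suc n) / growth i n)) \<longlonglongrightarrow> rate_of r / (\<Sum>r\<in>UNIV. rate_of r)"
    by (rule tendsto_divide[OF expected_number_limit expected_total_limit ne])
  moreover have "(expected_number i r (Suc n) / growth i n) / (?T (Suc n) / growth i n) = expected_number i r (Suc n) / ?T (Suc n)" for n
    using growth_ge_1[of n i] by simp
  moreover have "rate_of r / (\<Sum>r\<in>UNIV. rate_of r) = (v v* (S_matrix \<Sigma> - V_matrix \<Sigma>)) $ r / ((v v* (S_matrix \<Sigma> - V_matrix \<Sigma>)) \<bullet> 1)"
  proof -
    \<comment> \<open>A zero denominator would make every rate 0 by the convention x / 0 = 0, while
      the rates sum to at least 1.\<close>
    have "(v v* H_matrix \<Sigma>) \<bullet> 1 \<noteq> 0"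
    proof
      assume "(v v* H_matrix \<Sigma>) \<bullet> 1 = 0"
      then have "(\<Sum>r\<in>UNIV. rate_of r) = 0" by simp
      then show False using ne by simp
    qed
    then show ?thesis unfolding vec_sum_inner_1[of "v v* (S_matrix \<Sigma> - V_matrix \<Sigma>)"] sum_divide_distrib[symmetric] by simp
  qed
  ultimately have "(\<lambda>n. expected_number i r (Suc n) / ?T (Suc n)) \<longlonglongrightarrow>
     (v v* (S_matrix \<Sigma> - V_matrix \<Sigma>)) $ r / ((v v* (S_matrix \<Sigma> - V_matrix \<Sigma>)) \<bullet> 1)" by (simp only:)
  then show ?thesis by (rule LIMSEQ_imp_Suc)
qed

text \<open>The pathwise normalization applies here: exp (- birth Q) times the tally is already the
  volume of type \<open>r\<close>.\<close>

lemma type_vol_limit: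
  "(\<lambda>n. measure_pmf.expectation (law n [(id, i)]) (type_vol \<Sigma> r)) \<longlonglongrightarrow> (v v* H_matrix \<Sigma>) $ r / ((v v* H_matrix \<Sigma>) \<bullet> 1)"
    (is "_ \<longlonglongrightarrow> ?z")
proof (rule LIMSEQ_imp_Suc, rule LIMSEQ_I)
  fix \<epsilon> :: real assume e: "0 < \<epsilon>"
  have f: "\<bar>volume_weight r j t\<bar> \<le> 1" if "t < 0" for j t using that by (simp add: volume_weight_def)
  have e2: "0 < \<epsilon> / 2" using e by simp
  obtain N where N: "\<forall>n\<ge>N. transition n [(id, i)] (\<lambda>Q P'. \<bar>exp (- birth Q) * tally (volume_weight r) (birth Q) P' - ?z\<bar>) \<le> \<epsilon> / 2"
    using tally_concentration[OF f e2 volume_limit] by blast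
  show "\<exists>N. \<forall>n\<ge>N. norm (measure_pmf.expectation (law (Suc n) [(id, i)]) (type_vol \<Sigma> r) - ?z) < \<epsilon>"
  proof (intro exI[of _ N] allI impI)
    fix n assume n: "N \<le> n"
    have "\<bar>transition n [(id, i)] (\<lambda>Q. type_vol \<Sigma> r) - transition n [(id, i)] (\<lambda>Q P'. ?z)\<bar> \<le>
      transition n [(id, i)] (\<lambda>Q P'. \<bar>type_vol \<Sigma> r P' - ?z\<bar>)" by (rule transition_diff_le)
    also have "\<dots> \<le> transition n [(id, i)] (\<lambda>Q P'. \<bar>exp (- birth Q) * tally (volume_weight r) (birth Q) P' - ?z\<bar>)"
    proof (rule transition_mono)
      fix Q P' assume Q: "Q \<in> set_pmf (law n [(id, i)])" and P': "P' \<in> set_pmf (kakutani_step \<Sigma> Q)"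
      have "admissible i Q" using law_admissible[OF admissible_initial(1) Q] by simp
      then show "\<bar>type_vol \<Sigma> r P' - ?z\<bar> \<le> \<bar>exp (- birth Q) * tally (volume_weight r) (birth Q) P' - ?z\<bar>"
        unfolding tally_volume using type_vol_eq[OF admissible_step(1)[OF _ P']] by simp
    qed
    also have "\<dots> \<le> \<epsilon> / 2" using N n by blast
    also have "\<dots> < \<epsilon>" using e by simp
    finally show "norm (measure_pmf.expectation (law (Suc n) [(id, i)]) (type_vol \<Sigma> r) - ?z) < \<epsilon>"
      unfolding expectation_law_Suc transition_const real_norm_def .
  qed
qed

end

theorem corollary2p4:
  fixes \<Sigma> :: "('a::euclidean_space, 'n::finite) subst_system"
    and i r :: 'n
    and M :: "'w measure"
    and \<pi> :: "nat \<Rightarrow> 'w \<Rightarrow> ('a, 'n) tile list"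
    and v :: "real^'n"
  assumes "random_substitution_system \<Sigma>"
    and "normalized \<Sigma>"
    and "irreducible_system \<Sigma>"
    and "incommensurable \<Sigma>"
    and "random_kakutani_sequence \<Sigma> i M \<pi>"
    and "left_perron_frobenius_eigenvector (V_matrix \<Sigma>) v"
  shows
    "((\<lambda>m. (LINT \<omega>|M. real (length (tiles_of_type r (\<pi> m \<omega>)))) / (LINT \<omega>|M. real (length (\<pi> m \<omega>))))
        \<longlonglongrightarrow> (v v* (S_matrix \<Sigma> - V_matrix \<Sigma>)) $ r / ((v v* (S_matrix \<Sigma> - V_matrix \<Sigma>)) \<bullet> 1)) \<and>
     ((\<lambda>m. LINT \<omega>|M. type_vol \<Sigma> r (\<pi> m \<omega>))
        \<longlonglongrightarrow> (v v* H_matrix \<Sigma>) $ r / ((v v* H_matrix \<Sigma>) \<bullet> 1)) \<and>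
     ((\<forall>j. length (rules \<Sigma> j) = 1) \<longrightarrow>
        (\<forall>\<omega>\<in>space M.
          ((\<lambda>m. real (length (tiles_of_type r (\<pi> m \<omega>))) / real (length (\<pi> m \<omega>)))
             \<longlonglongrightarrow> (v v* (S_matrix \<Sigma> - V_matrix \<Sigma>)) $ r / ((v v* (S_matrix \<Sigma> - V_matrix \<Sigma>)) \<bullet> 1)) \<and>
          ((\<lambda>m. type_vol \<Sigma> r (\<pi> m \<omega>))
             \<longlonglongrightarrow> (v v* H_matrix \<Sigma>) $ r / ((v v* H_matrix \<Sigma>) \<bullet> 1))))"
proof -
  interpret kakutani_limit \<Sigma> v
    by unfold_locales (fact assms)+
  note integrals = sequence_law(2)[OF assms(5)]
  have number: "(\<lambda>m. (LINT \<omega>|M. real (length (tiles_of_type r (\<pi> m \<omega>)))) / (LINT \<omega>|M. real (length (\<pi> m \<omega>))))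
        \<longlonglongrightarrow> (v v* (S_matrix \<Sigma> - V_matrix \<Sigma>)) $ r / ((v v* (S_matrix \<Sigma> - V_matrix \<Sigma>)) \<bullet> 1)"
    unfolding integrals[of "\<lambda>P. real (length (tiles_of_type r P))"] integrals[of "\<lambda>P. real (length P)"]
    by (rule number_ratio_limit)
  have vol: "(\<lambda>m. LINT \<omega>|M. type_vol \<Sigma> r (\<pi> m \<omega>)) \<longlonglongrightarrow> (v v* H_matrix \<Sigma>) $ r / ((v v* H_matrix \<Sigma>) \<bullet> 1)"
    unfolding integrals[of "type_vol \<Sigma> r"] by (rule type_vol_limit)
  \<comment> \<open>In the non-random case an expectation over \<open>M\<close> is the value at any
    sample point.\<close>
  have const: "(LINT \<omega>'|M. h (\<pi> m \<omega>')) = h (\<pi> m \<omega>)"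
    if one: "\<forall>j. length (rules \<Sigma> j) = 1" and w: "\<omega> \<in> space M" for h :: "('a, 'n) tile list \<Rightarrow> real" and m \<omega>
  proof -
    interpret prob_space M using assms(5) by (simp add: random_kakutani_sequence_def)
    have "\<pi> m \<omega>' = \<pi> m \<omega>" if "\<omega>' \<in> space M" for \<omega>'
      using deterministic_sequence[OF assms(5)] one w that by simp
    then have "(LINT \<omega>'|M. h (\<pi> m \<omega>')) = (LINT \<omega>'|M. h (\<pi> m \<omega>))"
      by (intro Bochner_Integration.integral_cong) auto
    then show ?thesis by (simp add: prob_space)
  qed
  show ?thesis
  proof (intro conjI impI ballI number vol)
    fix \<omega> assume one: "\<forall>j. length (rules \<Sigma> j) = 1" and w: "\<omega> \<in> space M"
    note c = const[OF one w]
    show "(\<lambda>m. real (length (tiles_of_type r (\<pi> m \<omega>))) / real (length (\<pi> m \<omega>)))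
        \<longlonglongrightarrow> (v v* (S_matrix \<Sigma> - V_matrix \<Sigma>)) $ r / ((v v* (S_matrix \<Sigma> - V_matrix \<Sigma>)) \<bullet> 1)"
      using number unfolding c[of "\<lambda>P. real (length (tiles_of_type r P))"] c[of "\<lambda>P. real (length P)"] .
    show "(\<lambda>m. type_vol \<Sigma> r (\<pi> m \<omega>)) \<longlonglongrightarrow> (v v* H_matrix \<Sigma>) $ r / ((v v* H_matrix \<Sigma>) \<bullet> 1)"
      using vol unfolding c[of "type_vol \<Sigma> r"] .
  qed
qed

end
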